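(* Let $(M,g)$ be a complete Riemannian Hilbert manifold, and let $E$ be a time-dependent endomorphism field, $R$ a time-dependent vector field and $V:M\times\mathbb{R}\to\mathbb{R}$ a time-dependent potential on $M$, all of them smooth. Write $E=S+H$, where $S$ is the pointwise self-adjoint part of $E$ and $H$ the skew-adjoint part with respect to $g$. Assume that there are positive continuous functions $C_0,C_1,C_2:\mathbb{R}\to(0,\infty)$ such that, for all $(p,t)\in M\times\mathbb{R}$: (i) $\|S_{(p,t)}\|\le C_0(t)$; (ii) $\|R_{(p,t)}\|\le C_0(t)+C_1(t)\,|p|$; (iii) $-V(p,t)\le C_0(t)+C_2(t)\,|p|^2$ and $\left|\frac{\partial V}{\partial t}(p,t)\right|\le C_0(t)+C_2(t)\,|p|^2$. Then the inextensible solutions $\gamma$ of $$\frac{D\dot\gamma}{dt}(t)=E_{(\gamma(t),t)}\,\dot\gamma(t)+R_{(\gamma(t),t)}-\nabla^M V(\gamma(t),t)$$ are complete, i.e. defined on all of $\mathbb{R}$.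
   Context: $M$ is a connected, Hausdorff, paracompact smooth ($C^\infty$) manifold modelled on a real Hilbert space (possibly infinite-dimensional). A Riemannian metric $g$ on $M$ is a smooth choice of continuous, symmetric, positive definite bilinear forms $g_p$ on $T_pM$ such that $T_pM\to T_pM^*$, $v\mapsto g_p(v,\cdot)$, is a homeomorphism for each $p$. Let $d$ be the distance associated with $g$ (infimum of lengths of curves); $(M,g)$ is complete if $(M,d)$ is a complete metric space. A base point $p_0\in M$ is fixed and $|p|:=d(p,p_0)$. A time-dependent vector field $R$ on $M$ is a smooth section of the pull-back of $TM$ by the projection $M\times\mathbb{R}\to M$, so $R_{(p,t)}\in T_pM$. A time-dependent endomorphism field $E$ is a smooth assignment to each $(p,t)\in M\times\mathbb{R}$ of a bounded linear operator $E_{(p,t)}:T_pM\to T_pM$. With $E^\dagger$ the pointwise $g$-adjoint, $S=(E+E^\dagger)/2$ and $H=(E-E^\dagger)/2$. $\|\cdot\|$ denotes the pointwise norm induced by $g$ (the operator norm for $S$, the $g_p$-norm for $R$). $\nabla^M V$ is the time-dependent vector field whose value at $(p,t)$ is the $g$-gradient at $p$ of $V(\cdot,t)$, and $D/dt$ is the covariant derivative along curves of the Levi-Civita connection of $g$. *)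

theory Defs
  imports "HOL-Analysis.Analysis"
begin

section \<open>Smooth maps between normed spaces\<close>

definition bounded_multilinear :: "nat \<Rightarrow> ('a::real_normed_vector list \<Rightarrow> 'b::real_normed_vector) \<Rightarrow> bool" where
  "bounded_multilinear n F \<longleftrightarrow>
     (\<forall>us vs. length us + length vs + 1 = n \<longrightarrow> linear (\<lambda>w. F (us @ w # vs))) \<and>
     (\<exists>K. \<forall>vs. length vs = n \<longrightarrow> norm (F vs) \<le> K * prod_list (map norm vs))"

text \<open>
  \<open>smooth_on U f\<close> says that \<open>f\<close> is of class \<open>C\<^sup>\<infinity>\<close> (in the Frechet sense) on the open set \<open>U\<close>.
  The types of the iterated derivatives depend on their order, so they are bundled into one
  family: \<open>D x\<close> restricted to lists of length \<open>n\<close> is the \<open>n\<close>-th derivative at \<open>x\<close>, a bounded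
  \<open>n\<close>-linear map. The last conjunct says that \<open>D\<close> in order \<open>n\<close> is Frechet differentiable at \<open>x\<close>
  for the operator norm on \<open>n\<close>-linear maps, with derivative \<open>h \<mapsto> (vs \<mapsto> D x (h # vs))\<close>.
\<close>
definition smooth_on :: "'a::real_normed_vector set \<Rightarrow> ('a \<Rightarrow> 'b::real_normed_vector) \<Rightarrow> bool" where
  "smooth_on U f \<longleftrightarrow> (\<exists>D :: 'a \<Rightarrow> 'a list \<Rightarrow> 'b. \<forall>x\<in>U.
     D x [] = f x \<and>
     (\<forall>n. bounded_multilinear n (D x)) \<and>
     (\<forall>n. \<forall>\<epsilon>>0. \<forall>\<^sub>F y in nhds x. \<forall>vs. length vs = n \<longrightarrow>
        norm (D y vs - D x vs - D x ((y - x) # vs)) \<le> \<epsilon> * norm (y - x) * prod_list (map norm vs)))"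


section \<open>Hilbert manifolds\<close>

text \<open>
  The manifold is the type \<open>'m\<close>, with the Hausdorff property coming from its class \<open>t2_space\<close>;
  the model Hilbert space is a type \<open>'h\<close> of class \<open>{real_inner, banach}\<close>.
  A chart is a pair of its domain and its coordinate map.
\<close>
type_synonym ('m, 'h) chart = "'m set \<times> ('m \<Rightarrow> 'h)"

abbreviation cdom :: "('m, 'h) chart \<Rightarrow> 'm set" where "cdom c \<equiv> fst c"
abbreviation cmap :: "('m, 'h) chart \<Rightarrow> 'm \<Rightarrow> 'h" where "cmap c \<equiv> snd c"
abbreviation cimg :: "('m, 'h) chart \<Rightarrow> 'h set" where "cimg c \<equiv> cmap c ` cdom c"
abbreviation cinv :: "('m, 'h) chart \<Rightarrow> 'h \<Rightarrow> 'm" where "cinv c \<equiv> inv_into (cdom c) (cmap c)"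

definition smooth_atlas :: "('m::t2_space, 'h::{real_inner,banach}) chart set \<Rightarrow> bool" where
  "smooth_atlas A \<longleftrightarrow>
     (\<forall>c\<in>A. open (cdom c) \<and> open (cimg c) \<and> homeomorphism (cdom c) (cimg c) (cmap c) (cinv c)) \<and>
     (\<Union>c\<in>A. cdom c) = UNIV \<and>
     (\<forall>c\<in>A. \<forall>c'\<in>A. smooth_on (cmap c ` (cdom c \<inter> cdom c')) (cmap c' \<circ> cinv c))"

definition paracompact :: "'m::topological_space itself \<Rightarrow> bool" where
  "paracompact _ \<longleftrightarrow> (\<forall>\<U>::'m set set. (\<forall>U\<in>\<U>. open U) \<and> \<Union>\<U> = UNIV \<longrightarrow>
     (\<exists>\<V>. (\<forall>V\<in>\<V>. open V \<and> (\<exists>U\<in>\<U>. V \<subseteq> U)) \<and> \<Union>\<V> = UNIV \<and> locally_finite_in euclidean \<V>))"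

definition hilbert_manifold :: "('m::t2_space, 'h::{real_inner,banach}) chart set \<Rightarrow> bool" where
  "hilbert_manifold A \<longleftrightarrow> smooth_atlas A \<and> connected (UNIV :: 'm set) \<and> paracompact TYPE('m)"


section \<open>Tangent spaces and tensor fields\<close>

text \<open>
  A tangent vector at \<open>p\<close> is an equivalence class of pairs (chart at \<open>p\<close>, vector of the model
  space), where \<open>(c, v)\<close> and \<open>(c', D(c' \<circ> c\<^sup>-\<^sup>1) v)\<close> are identified. Each class has exactly one
  representative in the chart \<open>chart_at A p\<close>, and the tangent space at \<open>p\<close> is realised as the
  space \<open>'h\<close> of these representatives. Hence a tangent vector at \<open>p\<close>, a bounded endomorphism of
  the tangent space, or a continuous bilinear form on it is an element of \<open>'h\<close>, \<open>'h \<Rightarrow>\<^sub>L 'h\<close>,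
  \<open>'h \<Rightarrow>\<^sub>L 'h \<Rightarrow>\<^sub>L real\<close> respectively. As the chosen chart jumps with \<open>p\<close>, smoothness of a field is
  always expressed through its components in a fixed chart, as defined below.
\<close>
definition chart_at :: "('m, 'h) chart set \<Rightarrow> 'm \<Rightarrow> ('m, 'h) chart" where
  "chart_at A p = (SOME c. c \<in> A \<and> p \<in> cdom c)"

text \<open>The map sending a tangent vector at \<open>p\<close> to its components in the chart \<open>c\<close>, and its inverse.\<close>
definition components ::
    "('m, 'h::{real_inner,banach}) chart set \<Rightarrow> ('m, 'h) chart \<Rightarrow> 'm \<Rightarrow> 'h \<Rightarrow>\<^sub>L 'h" where
  "components A c p =
     Blinfun (frechet_derivative (cmap c \<circ> cinv (chart_at A p)) (at (cmap (chart_at A p) p)))"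

definition from_components ::
    "('m, 'h::{real_inner,banach}) chart set \<Rightarrow> ('m, 'h) chart \<Rightarrow> 'm \<Rightarrow> 'h \<Rightarrow>\<^sub>L 'h" where
  "from_components A c p =
     Blinfun (frechet_derivative (cmap (chart_at A p) \<circ> cinv c) (at (cmap c p)))"

definition smooth_function ::
    "('m, 'h::{real_inner,banach}) chart set \<Rightarrow> ('m \<Rightarrow> real \<Rightarrow> real) \<Rightarrow> bool" where
  "smooth_function A V \<longleftrightarrow>
     (\<forall>c\<in>A. smooth_on (cimg c \<times> UNIV) (\<lambda>(x, t). V (cinv c x) t))"

definition smooth_vector_field ::
    "('m, 'h::{real_inner,banach}) chart set \<Rightarrow> ('m \<Rightarrow> real \<Rightarrow> 'h) \<Rightarrow> bool" where
  "smooth_vector_field A R \<longleftrightarrow>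
     (\<forall>c\<in>A. smooth_on (cimg c \<times> UNIV)
        (\<lambda>(x, t). let p = cinv c x in components A c p (R p t)))"

definition smooth_endomorphism_field ::
    "('m, 'h::{real_inner,banach}) chart set \<Rightarrow> ('m \<Rightarrow> real \<Rightarrow> 'h \<Rightarrow>\<^sub>L 'h) \<Rightarrow> bool" where
  "smooth_endomorphism_field A E \<longleftrightarrow>
     (\<forall>c\<in>A. smooth_on (cimg c \<times> UNIV)
        (\<lambda>(x, t). let p = cinv c x in components A c p o\<^sub>L E p t o\<^sub>L from_components A c p))"


section \<open>Riemannian metrics\<close>

definition metric_components ::
    "('m, 'h::{real_inner,banach}) chart set \<Rightarrow> ('m \<Rightarrow> 'h \<Rightarrow>\<^sub>L 'h \<Rightarrow>\<^sub>L real) \<Rightarrow> ('m, 'h) chart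
      \<Rightarrow> 'h \<Rightarrow> 'h \<Rightarrow>\<^sub>L 'h \<Rightarrow>\<^sub>L real" where
  "metric_components A g c x =
     Blinfun (\<lambda>u. g (cinv c x) (from_components A c (cinv c x) u)
                     o\<^sub>L from_components A c (cinv c x))"

definition riemannian_metric ::
    "('m, 'h::{real_inner,banach}) chart set \<Rightarrow> ('m \<Rightarrow> 'h \<Rightarrow>\<^sub>L 'h \<Rightarrow>\<^sub>L real) \<Rightarrow> bool" where
  "riemannian_metric A g \<longleftrightarrow>
     (\<forall>p u v. g p u v = g p v u) \<and>
     (\<forall>p v. v \<noteq> 0 \<longrightarrow> g p v v > 0) \<and>
     (\<forall>p. \<exists>k. homeomorphism UNIV UNIV (blinfun_apply (g p)) k) \<and>
     (\<forall>c\<in>A. smooth_on (cimg c) (metric_components A g c))"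

definition gnorm :: "('m \<Rightarrow> 'h::{real_inner,banach} \<Rightarrow>\<^sub>L 'h \<Rightarrow>\<^sub>L real) \<Rightarrow> 'm \<Rightarrow> 'h \<Rightarrow> real" where
  "gnorm g p v = sqrt (g p v v)"

text \<open>The quotient is 0 at \<open>v = 0\<close>, as in the definition of \<^const>\<open>onorm\<close>.\<close>
definition op_gnorm ::
    "('m \<Rightarrow> 'h::{real_inner,banach} \<Rightarrow>\<^sub>L 'h \<Rightarrow>\<^sub>L real) \<Rightarrow> 'm \<Rightarrow> ('h \<Rightarrow>\<^sub>L 'h) \<Rightarrow> real" where
  "op_gnorm g p T = (SUP v. gnorm g p (T v) / gnorm g p v)"

text \<open>
  The adjoint and the gradient exist and are unique because \<open>v \<mapsto> g p v\<close> is a bijection from the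
  tangent space onto its dual.
\<close>
definition gadjoint ::
    "('m \<Rightarrow> 'h::{real_inner,banach} \<Rightarrow>\<^sub>L 'h \<Rightarrow>\<^sub>L real) \<Rightarrow> 'm \<Rightarrow> ('h \<Rightarrow>\<^sub>L 'h) \<Rightarrow> 'h \<Rightarrow>\<^sub>L 'h" where
  "gadjoint g p T = (THE T' :: 'h \<Rightarrow>\<^sub>L 'h. \<forall>u v. g p (T u) v = g p u (T' v))"

definition gradient ::
    "('m, 'h::{real_inner,banach}) chart set \<Rightarrow> ('m \<Rightarrow> 'h \<Rightarrow>\<^sub>L 'h \<Rightarrow>\<^sub>L real) \<Rightarrow> ('m \<Rightarrow> real) \<Rightarrow> 'm \<Rightarrow> 'h" where
  "gradient A g f p = (THE z. \<forall>w. g p z w =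
     frechet_derivative (f \<circ> cinv (chart_at A p)) (at (cmap (chart_at A p) p)) w)"


section \<open>Curves, distance and completeness\<close>

definition velocity ::
    "('m, 'h::{real_inner,banach}) chart set \<Rightarrow> (real \<Rightarrow> 'm) \<Rightarrow> real \<Rightarrow> 'h" where
  "velocity A \<gamma> t = vector_derivative (cmap (chart_at A (\<gamma> t)) \<circ> \<gamma>) (at t)"

text \<open>Derivatives at the end points of \<open>J\<close> are one-sided.\<close>
definition C1_curve_on ::
    "('m::t2_space, 'h::{real_inner,banach}) chart set \<Rightarrow> real set \<Rightarrow> (real \<Rightarrow> 'm) \<Rightarrow> bool" where
  "C1_curve_on A J \<gamma> \<longleftrightarrow> continuous_on J \<gamma> \<and>
     (\<forall>c\<in>A. \<exists>w. continuous_on (J \<inter> \<gamma> -` cdom c) w \<and>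
        (\<forall>t \<in> J \<inter> \<gamma> -` cdom c. ((cmap c \<circ> \<gamma>) has_vector_derivative w t) (at t within J)))"

definition piecewise_C1_curve ::
    "('m::t2_space, 'h::{real_inner,banach}) chart set \<Rightarrow> real \<Rightarrow> real \<Rightarrow> (real \<Rightarrow> 'm) \<Rightarrow> bool" where
  "piecewise_C1_curve A a b \<gamma> \<longleftrightarrow> continuous_on {a..b} \<gamma> \<and>
     (\<exists>F. finite F \<and> (\<forall>u v. a \<le> u \<and> u < v \<and> v \<le> b \<and> {u<..<v} \<inter> F = {} \<longrightarrow> C1_curve_on A {u..v} \<gamma>))"

definition curve_length ::
    "('m, 'h::{real_inner,banach}) chart set \<Rightarrow> ('m \<Rightarrow> 'h \<Rightarrow>\<^sub>L 'h \<Rightarrow>\<^sub>L real)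
      \<Rightarrow> real \<Rightarrow> real \<Rightarrow> (real \<Rightarrow> 'm) \<Rightarrow> real" where
  "curve_length A g a b \<gamma> = integral {a..b} (\<lambda>t. gnorm g (\<gamma> t) (velocity A \<gamma> t))"

definition rdist ::
    "('m::t2_space, 'h::{real_inner,banach}) chart set \<Rightarrow> ('m \<Rightarrow> 'h \<Rightarrow>\<^sub>L 'h \<Rightarrow>\<^sub>L real)
      \<Rightarrow> 'm \<Rightarrow> 'm \<Rightarrow> real" where
  "rdist A g p q = Inf {curve_length A g a b \<gamma> | a b \<gamma>.
     a \<le> b \<and> piecewise_C1_curve A a b \<gamma> \<and> \<gamma> a = p \<and> \<gamma> b = q}"

definition riemannian_complete ::
    "('m::t2_space, 'h::{real_inner,banach}) chart set \<Rightarrow> ('m \<Rightarrow> 'h \<Rightarrow>\<^sub>L 'h \<Rightarrow>\<^sub>L real) \<Rightarrow> bool" where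
  "riemannian_complete A g \<longleftrightarrow>
     Metric_space UNIV (rdist A g) \<and> Metric_space.mcomplete UNIV (rdist A g)"


section \<open>The Levi-Civita connection and the equation of motion\<close>

text \<open>
  A linear connection is given by its components \<open>\<Gamma> c\<close> (Christoffel symbols) in the charts, with
  \<open>\<nabla>\<^sub>X Y = DY X + \<Gamma>(X, Y)\<close> in coordinates. The second condition is the transformation law under
  the change of coordinates \<open>\<tau>\<close> from \<open>c\<close> to \<open>c'\<close>; equivalently, \<open>\<nabla>\<^sub>X Y\<close> does not depend on the chart.
\<close>
definition linear_connection ::
    "('m, 'h::{real_inner,banach}) chart set \<Rightarrow> (('m, 'h) chart \<Rightarrow> 'h \<Rightarrow> 'h \<Rightarrow>\<^sub>L 'h \<Rightarrow>\<^sub>L 'h) \<Rightarrow> bool" where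
  "linear_connection A \<Gamma> \<longleftrightarrow>
     (\<forall>c\<in>A. smooth_on (cimg c) (\<Gamma> c)) \<and>
     (\<forall>c\<in>A. \<forall>c'\<in>A. \<forall>x \<in> cmap c ` (cdom c \<inter> cdom c'). \<forall>u v.
        (let \<tau> = cmap c' \<circ> cinv c; D\<tau> = (\<lambda>y. frechet_derivative \<tau> (at y)) in
           D\<tau> x (\<Gamma> c x u v) = \<Gamma> c' (\<tau> x) (D\<tau> x u) (D\<tau> x v)
              + frechet_derivative (\<lambda>y. D\<tau> y v) (at x) u))"

text \<open>The connection is torsion free and the metric is parallel.\<close>
definition levi_civita_connection ::
    "('m, 'h::{real_inner,banach}) chart set \<Rightarrow> ('m \<Rightarrow> 'h \<Rightarrow>\<^sub>L 'h \<Rightarrow>\<^sub>L real)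
      \<Rightarrow> (('m, 'h) chart \<Rightarrow> 'h \<Rightarrow> 'h \<Rightarrow>\<^sub>L 'h \<Rightarrow>\<^sub>L 'h) \<Rightarrow> bool" where
  "levi_civita_connection A g \<Gamma> \<longleftrightarrow> linear_connection A \<Gamma> \<and>
     (\<forall>c\<in>A. \<forall>x\<in>cimg c. \<forall>u v. \<Gamma> c x u v = \<Gamma> c x v u) \<and>
     (\<forall>c\<in>A. \<forall>x\<in>cimg c. \<forall>u v w.
        frechet_derivative (\<lambda>y. metric_components A g c y u v) (at x) w =
        metric_components A g c x (\<Gamma> c x w u) v + metric_components A g c x u (\<Gamma> c x w v))"

text \<open>
  Covariant derivative at \<open>t\<close> of a vector field \<open>X\<close> along \<open>\<gamma>\<close>. It is computed in the chart that
  represents the tangent space at \<open>\<gamma> t\<close>, so the result is a tangent vector at \<open>\<gamma> t\<close>.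
\<close>
definition covariant_derivative ::
    "('m, 'h::{real_inner,banach}) chart set \<Rightarrow> (('m, 'h) chart \<Rightarrow> 'h \<Rightarrow> 'h \<Rightarrow>\<^sub>L 'h \<Rightarrow>\<^sub>L 'h)
      \<Rightarrow> (real \<Rightarrow> 'm) \<Rightarrow> (real \<Rightarrow> 'h) \<Rightarrow> real \<Rightarrow> 'h" where
  "covariant_derivative A \<Gamma> \<gamma> X t = (let c = chart_at A (\<gamma> t) in
     vector_derivative (\<lambda>s. components A c (\<gamma> s) (X s)) (at t)
       + \<Gamma> c (cmap c (\<gamma> t)) (velocity A \<gamma> t) (X t))"

definition twice_differentiable_curve ::
    "('m::t2_space, 'h::{real_inner,banach}) chart set \<Rightarrow> real set \<Rightarrow> (real \<Rightarrow> 'm) \<Rightarrow> bool" where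
  "twice_differentiable_curve A I \<gamma> \<longleftrightarrow> continuous_on I \<gamma> \<and>
     (\<forall>c\<in>A. \<forall>t\<in>I. \<gamma> t \<in> cdom c \<longrightarrow>
        (cmap c \<circ> \<gamma>) differentiable (at t) \<and>
        (\<lambda>s. vector_derivative (cmap c \<circ> \<gamma>) (at s)) differentiable (at t))"

text \<open>
  \<open>solution A \<Gamma> Q I \<gamma>\<close>: on the open interval \<open>I\<close> the curve \<open>\<gamma>\<close> satisfies \<open>D\<gamma>'/dt = Q(\<gamma>, \<gamma>', t)\<close>.
  The values of \<open>\<gamma>\<close> outside \<open>I\<close> are irrelevant.
\<close>
definition solution ::
    "('m::t2_space, 'h::{real_inner,banach}) chart set \<Rightarrow> (('m, 'h) chart \<Rightarrow> 'h \<Rightarrow> 'h \<Rightarrow>\<^sub>L 'h \<Rightarrow>\<^sub>L 'h)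
      \<Rightarrow> ('m \<Rightarrow> 'h \<Rightarrow> real \<Rightarrow> 'h) \<Rightarrow> real set \<Rightarrow> (real \<Rightarrow> 'm) \<Rightarrow> bool" where
  "solution A \<Gamma> Q I \<gamma> \<longleftrightarrow> open I \<and> is_interval I \<and> I \<noteq> {} \<and> twice_differentiable_curve A I \<gamma> \<and>
     (\<forall>t\<in>I. covariant_derivative A \<Gamma> \<gamma> (velocity A \<gamma>) t = Q (\<gamma> t) (velocity A \<gamma> t) t)"

definition inextensible_solution ::
    "('m::t2_space, 'h::{real_inner,banach}) chart set \<Rightarrow> (('m, 'h) chart \<Rightarrow> 'h \<Rightarrow> 'h \<Rightarrow>\<^sub>L 'h \<Rightarrow>\<^sub>L 'h)
      \<Rightarrow> ('m \<Rightarrow> 'h \<Rightarrow> real \<Rightarrow> 'h) \<Rightarrow> real set \<Rightarrow> (real \<Rightarrow> 'm) \<Rightarrow> bool" where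
  "inextensible_solution A \<Gamma> Q I \<gamma> \<longleftrightarrow> solution A \<Gamma> Q I \<gamma> \<and>
     \<not> (\<exists>J \<delta>. solution A \<Gamma> Q J \<delta> \<and> I \<subset> J \<and> (\<forall>t\<in>I. \<delta> t = \<gamma> t))"

end

theory Submission
  imports Defs
begin

text \<open>
  A maximal solution whose interval of definition has a finite end point \<open>b\<close> could be continued
  past \<open>b\<close>; this contradiction is reached in three stages.

  \<^emph>\<open>The speed is bounded near \<open>b\<close>.\<close> Along a solution the energy
  \<open>e = g(\<gamma>', \<gamma>') / 2 + V(\<gamma>, t)\<close> has derivative \<open>g(S \<gamma>', \<gamma>') + g(R, \<gamma>') + \<partial>V/\<partial>t\<close>: the
  connection is metric, the skew part of \<open>E\<close> does no work, and the work of \<open>-\<nabla>V\<close> is absorbed by \<open>V\<close>.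
  Let \<open>\<rho>(t)\<close> be the distance of \<open>\<gamma>(t\<^sub>0)\<close> to the base point plus the length of \<open>\<gamma>\<close> between \<open>t\<^sub>0\<close> and
  \<open>t\<close>. It dominates the distance of \<open>\<gamma>(t)\<close> to the base point, so on a compact time interval the
  growth hypotheses give a constant \<open>K\<close> with \<open>\<bar>e'\<bar> \<le> K (1 + \<rho>\<^sup>2 + \<bar>\<gamma>'\<bar>\<^sup>2)\<close> and
  \<open>\<bar>\<gamma>'\<bar>\<^sup>2 / 2 \<le> e + K (1 + \<rho>\<^sup>2)\<close>. As the derivative of \<open>\<rho>\<close> is \<open>\<plusminus>\<bar>\<gamma>'\<bar>\<close>, the quantity
  \<open>e + 2 K (1 + \<rho>\<^sup>2)\<close> satisfies a linear differential inequality, and Gronwall's lemma bounds the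
  speed (\<open>speed_bound_from_energy\<close>, \<open>speed_bounded_on_bounded_times\<close>).

  \<^emph>\<open>The solution converges at \<open>b\<close>.\<close> A curve of bounded speed is Lipschitz for the Riemannian
  distance, so \<open>\<gamma>(t)\<close> converges to a point \<open>p\<close> in the complete space \<open>(M, d)\<close>
  (\<open>bounded_speed_solution_converges\<close>). It also converges in a chart at \<open>p\<close>, because a curve that
  starts at \<open>p\<close> and is short enough cannot leave a given chart ball (\<open>short_curve_in_chart_ball\<close>). The
  chart balls need not be relatively compact; completeness of the model space takes the place of
  compactness.

  \<^emph>\<open>The solution continues past \<open>b\<close>.\<close> In that chart the equation is a first order equation for
  \<open>(x, x')\<close> with a locally Lipschitz right-hand side, since the covariant derivative can be computed
  in any chart (\<open>covariant_derivative_components\<close>). As \<open>x'\<close> is bounded, so is the coordinate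
  acceleration, hence \<open>x'\<close> has a limit at \<open>b\<close>. The Picard solution with the limiting data at \<open>b\<close> is
  glued to \<open>\<gamma>\<close> (\<open>ode_solution_extends_past_boundary\<close>, \<open>bounded_speed_solution_extends\<close>). Both ends of
  the interval are treated at once, by speaking of a boundary point instead of a left or right end.
\<close>

section \<open>Derivatives and local Lipschitz constants of smooth maps\<close>

lemma smooth_on_cong:
  assumes "smooth_on U f" "\<And>x. x \<in> U \<Longrightarrow> f x = f' x"
  shows "smooth_on U f'"
proof -
  obtain D where "\<forall>x\<in>U. D x [] = f x \<and> (\<forall>n. bounded_multilinear n (D x)) \<and>
     (\<forall>n. \<forall>\<epsilon>>0. \<forall>\<^sub>F y in nhds x. \<forall>vs. length vs = n \<longrightarrow>
        norm (D y vs - D x vs - D x ((y - x) # vs)) \<le> \<epsilon> * norm (y - x) * prod_list (map norm vs))"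
    using assms(1) unfolding smooth_on_def by (elim exE)
  then show ?thesis unfolding smooth_on_def using assms(2) by (intro exI[of _ D]) simp
qed

text \<open>
  The derivative of a smooth map is again smooth as a map into the space of bounded operators. If
  \<open>D\<close> is a family of iterated derivatives of \<open>f\<close>, then fixing the last argument,
  \<open>D x (vs @ [v])\<close>, gives one for the derivative of \<open>f\<close>: differentiating puts the new direction in
  front, so the last argument is left untouched.
\<close>
lemma smooth_on_derivative:
  assumes U: "open U" and f: "smooth_on U f"
  obtains F :: "'a::real_normed_vector \<Rightarrow> 'a \<Rightarrow>\<^sub>L 'b::real_normed_vector"
  where "\<And>x. x \<in> U \<Longrightarrow> (f has_derivative blinfun_apply (F x)) (at x)" "smooth_on U F"
proof -
  obtain D where D_all: "\<forall>x\<in>U. D x [] = f x \<and> (\<forall>n. bounded_multilinear n (D x)) \<and>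
     (\<forall>n. \<forall>\<epsilon>>0. \<forall>\<^sub>F y in nhds x. \<forall>vs. length vs = n \<longrightarrow>
        norm (D y vs - D x vs - D x ((y - x) # vs)) \<le> \<epsilon> * norm (y - x) * prod_list (map norm vs))"
    using f unfolding smooth_on_def by (elim exE)
  have D: "\<And>x. x \<in> U \<Longrightarrow> D x [] = f x"
    "\<And>x n. x \<in> U \<Longrightarrow> bounded_multilinear n (D x)"
    "\<And>x n \<epsilon>. x \<in> U \<Longrightarrow> \<epsilon> > 0 \<Longrightarrow> \<forall>\<^sub>F y in nhds x. \<forall>vs. length vs = n \<longrightarrow>
        norm (D y vs - D x vs - D x ((y - x) # vs)) \<le> \<epsilon> * norm (y - x) * prod_list (map norm vs)"
    using D_all by (blast, blast, blast)
  define F where "F x vs = Blinfun (\<lambda>v. D x (vs @ [v]))" for x vs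
  have nonneg: "0 \<le> prod_list (map norm vs)" for vs :: "'a list"
    by (induction vs) auto
  have bl: "bounded_linear (\<lambda>v. D x (vs @ [v]))" if "x \<in> U" for x vs
  proof -
    have m: "bounded_multilinear (length vs + 1) (D x)" using D(2)[OF that] .
    have "linear (\<lambda>w. D x (vs @ w # []))"
      using m unfolding bounded_multilinear_def by (elim conjE allE[where x=vs] allE[where x="[]"]) auto
    moreover obtain K where "\<And>vs'. length vs' = length vs + 1 \<Longrightarrow> norm (D x vs') \<le> K * prod_list (map norm vs')"
      using m unfolding bounded_multilinear_def by blast
    from this[of "vs @ [v]" for v]
    have "norm (D x (vs @ [v])) \<le> norm v * (K * prod_list (map norm vs))" for v
      by (simp add: mult_ac)
    ultimately show ?thesis
      by (intro bounded_linear.intro bounded_linear_axioms.intro) auto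
  qed
  have F: "blinfun_apply (F x vs) v = D x (vs @ [v])" if "x \<in> U" for x vs v
    unfolding F_def using bl[OF that] by (simp add: bounded_linear_Blinfun_apply)
  have der: "(f has_derivative blinfun_apply (F x [])) (at x)" if x: "x \<in> U" for x
    unfolding has_derivative_at_alt
  proof (intro conjI allI impI)
    show "bounded_linear (blinfun_apply (F x []))" by (rule blinfun.bounded_linear_right)
    fix e :: real assume e: "e > 0"
    have "\<forall>\<^sub>F y in nhds x. y \<in> U" using x U by (simp add: eventually_nhds_in_open)
    then have "\<forall>\<^sub>F y in nhds x. norm (f y - f x - F x [] (y - x)) \<le> e * norm (y - x)"
      using D(3)[OF x e, of 0]
    proof eventually_elim
      case (elim y)
      then have "norm (D y [] - D x [] - D x [y - x]) \<le> e * norm (y - x)"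
        by (metis list.size(3) list.map(1) prod_list.Nil mult.right_neutral)
      with elim x show ?case by (simp add: D(1) F)
    qed
    then show "\<exists>d>0. \<forall>y. norm (y - x) < d \<longrightarrow> norm (f y - f x - (F x []) (y - x)) \<le> e * norm (y - x)"
      unfolding eventually_nhds_metric by (auto simp: dist_norm)
  qed
  have sm: "smooth_on U (\<lambda>x. F x [])"
    unfolding smooth_on_def
  proof (intro exI[of _ F] ballI conjI allI impI)
    fix x assume x: "x \<in> U"
    show "bounded_multilinear n (F x)" for n
      unfolding bounded_multilinear_def
    proof (intro conjI allI impI)
      fix us vs :: "'a list" assume "length us + length vs + 1 = n"
      then have lin: "linear (\<lambda>w. D x (us @ w # (vs @ [v])))" for v
        using D(2)[OF x, of "n+1"] unfolding bounded_multilinear_def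
        by (elim conjE allE[where x=us] allE[where x="vs @ [v]"]) auto
      show "linear (\<lambda>w. F x (us @ w # vs))"
        using linear_add[OF lin] linear_scale[OF lin]
        by (intro linearI blinfun_eqI) (simp_all add: F[OF x] blinfun.bilinear_simps)
    next
      obtain K where K: "\<And>vs'. length vs' = n + 1 \<Longrightarrow> norm (D x vs') \<le> K * prod_list (map norm vs')"
        using D(2)[OF x, of "n+1"] unfolding bounded_multilinear_def by blast
      have "norm (F x vs) \<le> \<bar>K\<bar> * prod_list (map norm vs)" if "length vs = n" for vs
      proof (rule norm_blinfun_bound)
        show "0 \<le> \<bar>K\<bar> * prod_list (map norm vs)" using nonneg by simp
        fix v
        have "norm (D x (vs @ [v])) \<le> K * prod_list (map norm (vs @ [v]))"
          by (rule K) (simp add: that)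
        also have "\<dots> \<le> \<bar>K\<bar> * prod_list (map norm (vs @ [v]))"
          by (intro mult_right_mono nonneg) auto
        finally show "norm (F x vs v) \<le> \<bar>K\<bar> * prod_list (map norm vs) * norm v"
          by (simp add: F[OF x] mult.assoc)
      qed
      then show "\<exists>K. \<forall>vs. length vs = n \<longrightarrow> norm (F x vs) \<le> K * prod_list (map norm vs)" by blast
    qed
    fix n and e :: real assume e: "e > 0"
    have "\<forall>\<^sub>F y in nhds x. y \<in> U" using x U by (simp add: eventually_nhds_in_open)
    then show "\<forall>\<^sub>F y in nhds x. \<forall>vs. length vs = n \<longrightarrow>
       norm (F y vs - F x vs - F x ((y - x) # vs)) \<le> e * norm (y - x) * prod_list (map norm vs)"
      using D(3)[OF x e, of "n+1"]
    proof eventually_elim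
      case (elim y)
      show ?case
      proof (intro allI impI norm_blinfun_bound)
        fix vs :: "'a list" and v assume "length vs = n"
        then have "norm (D y (vs @ [v]) - D x (vs @ [v]) - D x ((y - x) # vs @ [v]))
           \<le> e * norm (y - x) * prod_list (map norm (vs @ [v]))"
          using elim(2)[rule_format, of "vs @ [v]"] by (simp only: length_append_singleton)
        then show "norm ((F y vs - F x vs - F x ((y - x) # vs)) v)
           \<le> e * norm (y - x) * prod_list (map norm vs) * norm v"
          using elim(1) x by (simp add: F blinfun.bilinear_simps mult.assoc)
      qed (use e nonneg in auto)
    qed
  qed simp
  from that[OF der sm] show thesis .
qed

lemma smooth_on_imp_continuous_on:
  assumes "open U" "smooth_on U f"
  shows "continuous_on U f"
proof -
  obtain F where "\<And>x. x \<in> U \<Longrightarrow> (f has_derivative blinfun_apply (F x)) (at x)"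
    using smooth_on_derivative[OF assms] by blast
  then show ?thesis by (intro continuous_at_imp_continuous_on ballI has_derivative_continuous)
qed


text \<open>
  A pointwise notion of local Lipschitz continuity. It is stable under composition and under
  bounded bilinear operations, hence the right-hand side of the equation of motion inherits it from
  its smooth ingredients.
\<close>
definition lipschitz_near :: "('a::metric_space \<Rightarrow> 'b::metric_space) \<Rightarrow> 'a \<Rightarrow> bool" where
  "lipschitz_near f x \<longleftrightarrow> (\<exists>e>0. \<exists>L. L-lipschitz_on (ball x e) f)"

lemma lipschitz_near_minI:
  assumes "e > 0" "d > 0" "L-lipschitz_on (ball x (min e d)) f"
  shows "lipschitz_near f x"
  unfolding lipschitz_near_def using assms by (intro exI[of _ "min e d"]) auto

lemma lipschitz_near_isCont:
  assumes "lipschitz_near f x" shows "isCont f x"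
proof -
  obtain e L where "e > 0" "L-lipschitz_on (ball x e) f" using assms unfolding lipschitz_near_def by blast
  then have "continuous_on (ball x e) f" "x \<in> ball x e" by (auto intro: lipschitz_on_continuous_on)
  then show ?thesis by (simp add: continuous_on_eq_continuous_at)
qed

lemma lipschitz_near_bounded:
  fixes f :: "'a::metric_space \<Rightarrow> 'b::real_normed_vector"
  assumes "lipschitz_near f x"
  obtains e L B where "e > 0" "L-lipschitz_on (ball x e) f" "\<And>y. y \<in> ball x e \<Longrightarrow> norm (f y) \<le> B" "B \<ge> 0"
proof -
  obtain e L where e: "e > 0" and L: "L-lipschitz_on (ball x e) f" using assms unfolding lipschitz_near_def by blast
  have "norm (f y) \<le> norm (f x) + L * e" if "y \<in> ball x e" for y
  proof -
    have "norm (f y - f x) \<le> L * dist y x"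
      using lipschitz_onD[OF L that] e by (simp add: dist_norm)
    also have "\<dots> \<le> L * e"
      using that lipschitz_on_nonneg[OF L] by (intro mult_left_mono) (auto simp: dist_commute)
    finally show ?thesis using norm_triangle_ineq2[of "f y" "f x"] by linarith
  qed
  moreover have "norm (f x) + L * e \<ge> 0" using lipschitz_on_nonneg[OF L] e by simp
  ultimately show ?thesis using that e L by blast
qed

lemma lipschitz_near_bounded_linear:
  assumes "bounded_linear f" shows "lipschitz_near f x"
  using bounded_linear.lipschitz_boundE[OF assms, of "ball x 1"] unfolding lipschitz_near_def
  by (metis zero_less_one)

lemma lipschitz_near_compose:
  assumes "lipschitz_near f x" "lipschitz_near h (f x)"
  shows "lipschitz_near (\<lambda>y. h (f y)) x"
proof -
  obtain e L where e: "e > 0" and L: "L-lipschitz_on (ball x e) f" using assms unfolding lipschitz_near_def by blast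
  obtain d M where d: "d > 0" and M: "M-lipschitz_on (ball (f x) d) h" using assms unfolding lipschitz_near_def by blast
  have "\<forall>\<^sub>F y in nhds x. f y \<in> ball (f x) d"
    using lipschitz_near_isCont[OF assms(1)] d
    by (intro topological_tendstoD) (auto simp: isCont_def tendsto_nhds_iff)
  then obtain r where r: "r > 0" "\<And>y. dist y x < r \<Longrightarrow> f y \<in> ball (f x) d" unfolding eventually_nhds_metric by blast
  have L': "L-lipschitz_on (ball x (min e r)) f" by (rule lipschitz_on_subset[OF L]) auto
  have "M-lipschitz_on (f ` ball x (min e r)) h"
    using r by (intro lipschitz_on_subset[OF M]) (auto simp: dist_commute)
  from lipschitz_on_compose2[OF L' this]
  show ?thesis by (rule lipschitz_near_minI[OF e r(1)])
qed

lemma lipschitz_near_Pair: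
  assumes "lipschitz_near f x" "lipschitz_near h x"
  shows "lipschitz_near (\<lambda>y. (f y, h y)) x"
proof -
  obtain e L where e: "e > 0" and L: "L-lipschitz_on (ball x e) f" using assms unfolding lipschitz_near_def by blast
  obtain d M where d: "d > 0" and M: "M-lipschitz_on (ball x d) h" using assms unfolding lipschitz_near_def by blast
  have "L-lipschitz_on (ball x (min e d)) f" "M-lipschitz_on (ball x (min e d)) h"
    by (rule lipschitz_on_subset[OF L] lipschitz_on_subset[OF M], auto)+
  from lipschitz_on_Pair[OF this] show ?thesis by (rule lipschitz_near_minI[OF e d])
qed

lemma lipschitz_near_add:
  fixes f h :: "'a::metric_space \<Rightarrow> 'b::real_normed_vector"
  assumes "lipschitz_near f x" "lipschitz_near h x"
  shows "lipschitz_near (\<lambda>y. f y + h y) x"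
  using lipschitz_near_compose[OF lipschitz_near_Pair[OF assms]
      lipschitz_near_bounded_linear[OF bounded_linear_add[OF bounded_linear_fst bounded_linear_snd]]]
  by simp

lemma lipschitz_near_minus:
  fixes f h :: "'a::metric_space \<Rightarrow> 'b::real_normed_vector"
  assumes "lipschitz_near f x" "lipschitz_near h x"
  shows "lipschitz_near (\<lambda>y. f y - h y) x"
  using lipschitz_near_compose[OF lipschitz_near_Pair[OF assms]
      lipschitz_near_bounded_linear[OF bounded_linear_sub[OF bounded_linear_fst bounded_linear_snd]]]
  by simp

lemma lipschitz_near_bilinear:
  fixes f :: "'a::metric_space \<Rightarrow> 'b::real_normed_vector" and h :: "'a \<Rightarrow> 'c::real_normed_vector"
  assumes P: "bounded_bilinear P" and "lipschitz_near f x" "lipschitz_near h x"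
  shows "lipschitz_near (\<lambda>y. P (f y) (h y)) x"
proof -
  interpret P: bounded_bilinear P by fact
  obtain e L B where e: "e > 0" and L: "L-lipschitz_on (ball x e) f" and B: "\<And>y. y \<in> ball x e \<Longrightarrow> norm (f y) \<le> B" "B \<ge> 0"
    using lipschitz_near_bounded[OF assms(2)] by blast
  obtain d M C where d: "d > 0" and M: "M-lipschitz_on (ball x d) h" and C: "\<And>y. y \<in> ball x d \<Longrightarrow> norm (h y) \<le> C" "C \<ge> 0"
    using lipschitz_near_bounded[OF assms(3)] by blast
  obtain K where K: "K > 0" "\<And>a b. norm (P a b) \<le> norm a * norm b * K" using P.pos_bounded by blast
  have "(L * C * K + B * M * K)-lipschitz_on (ball x (min e d)) (\<lambda>y. P (f y) (h y))"
  proof (rule lipschitz_onI)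
    show "0 \<le> L * C * K + B * M * K" using lipschitz_on_nonneg[OF L] lipschitz_on_nonneg[OF M] B C K by simp
    fix y z assume y: "y \<in> ball x (min e d)" and z: "z \<in> ball x (min e d)"
    have "P (f y) (h y) - P (f z) (h z) = P (f y - f z) (h y) + P (f z) (h y - h z)"
      by (simp add: P.diff_left P.diff_right)
    also have "norm \<dots> \<le> norm (f y - f z) * norm (h y) * K + norm (f z) * norm (h y - h z) * K"
      by (intro norm_triangle_le add_mono K(2))
    also have "\<dots> \<le> (L * dist y z) * C * K + B * (M * dist y z) * K"
      using lipschitz_onD[OF L, of y z] lipschitz_onD[OF M, of y z] lipschitz_on_nonneg[OF L]
        lipschitz_on_nonneg[OF M] y z K B C
      by (intro add_mono mult_mono) (simp_all add: dist_norm)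
    finally show "dist (P (f y) (h y)) (P (f z) (h z)) \<le> (L * C * K + B * M * K) * dist y z"
      by (simp add: dist_norm algebra_simps)
  qed
  then show ?thesis by (rule lipschitz_near_minI[OF e d])
qed

lemmas lipschitz_near_blinfun_apply = lipschitz_near_bilinear[OF bounded_bilinear_blinfun_apply]

lemma smooth_on_lipschitz_near:
  fixes f :: "'a::real_normed_vector \<Rightarrow> 'b::real_normed_vector"
  assumes U: "open U" and f: "smooth_on U f" and x: "x \<in> U"
  shows "lipschitz_near f x"
proof -
  obtain F where F: "\<And>y. y \<in> U \<Longrightarrow> (f has_derivative blinfun_apply (F y)) (at y)" "smooth_on U F"
    using smooth_on_derivative[OF U f] by blast
  have "isCont F x"
    using smooth_on_imp_continuous_on[OF U F(2)] U x by (simp add: continuous_on_eq_continuous_at)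
  then have "\<exists>d>0. \<forall>y. dist y x < d \<longrightarrow> dist (F y) (F x) < 1"
    unfolding continuous_at_eps_delta using zero_less_one by blast
  then obtain d where d: "d > 0" "\<And>y. dist y x < d \<Longrightarrow> dist (F y) (F x) < 1" by blast
  obtain e where e: "e > 0" "ball x e \<subseteq> U" using U x openE by blast
  have B: "norm (F y) \<le> norm (F x) + 1" if "y \<in> ball x (min d e)" for y
    using d(2)[of y] that norm_triangle_ineq2[of "F y" "F x"] norm_minus_commute[of "F x" "F y"]
    by (simp add: dist_commute) (simp add: dist_norm)
  have "(norm (F x) + 1)-lipschitz_on (ball x (min d e)) f"
  proof (rule lipschitz_onI)
    fix y z assume yz: "y \<in> ball x (min d e)" "z \<in> ball x (min d e)"
    have "norm (f y - f z) \<le> (norm (F x) + 1) * norm (y - z)"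
    proof (rule differentiable_bound[OF convex_ball])
      fix w assume w: "w \<in> ball x (min d e)"
      then have "w \<in> U" using e(2) by auto
      then show "(f has_derivative F w) (at w within ball x (min d e))"
        by (rule has_derivative_at_withinI[OF F(1)])
      show "onorm (F w) \<le> norm (F x) + 1" using B[OF w] by (simp add: norm_blinfun.rep_eq)
    qed (use yz in auto)
    then show "dist (f y) (f z) \<le> (norm (F x) + 1) * dist y z" by (simp add: dist_norm)
  qed simp
  then show ?thesis by (rule lipschitz_near_minI[OF d(1) e(1)])
qed

text \<open>
  Solutions of \<open>G y (z y) = \<omega> y\<close> depend on \<open>y\<close> as regularly as the data. The lower bound on
  \<open>G x\<close> persists near \<open>x\<close> because \<open>G\<close> is continuous there, and
  \<open>G y (z y - z y') = \<omega> y - \<omega> y' - (G y - G y') (z y')\<close>. For the gradient, \<open>G\<close> is the metric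
  and \<open>\<omega>\<close> the differential.
\<close>
lemma lipschitz_near_solve:
  fixes G :: "'a::metric_space \<Rightarrow> 'b::real_normed_vector \<Rightarrow>\<^sub>L 'c::real_normed_vector"
  assumes G: "lipschitz_near G x" and w: "lipschitz_near \<omega> x"
    and B: "\<And>v. norm v \<le> B * norm (G x v)"
    and z: "\<forall>\<^sub>F y in nhds x. G y (z y) = \<omega> y"
  shows "lipschitz_near z x"
proof -
  obtain e L where e: "e > 0" and L: "L-lipschitz_on (ball x e) G" using G unfolding lipschitz_near_def by blast
  obtain d M C where d: "d > 0" and M: "M-lipschitz_on (ball x d) \<omega>" and C: "\<And>y. y \<in> ball x d \<Longrightarrow> norm (\<omega> y) \<le> C" "C \<ge> 0"
    using lipschitz_near_bounded[OF w] by blast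
  obtain r where r: "r > 0" "\<And>y. dist y x < r \<Longrightarrow> G y (z y) = \<omega> y" using z unfolding eventually_nhds_metric by blast
  define B' where "B' = \<bar>B\<bar> + 1"
  have B': "norm v \<le> B' * norm (G x v)" "B' > 0" for v
    using order_trans[OF B[of v] mult_right_mono[of B "\<bar>B\<bar> + 1" "norm (G x v)"]]
    unfolding B'_def by auto
  have "isCont G x" by (rule lipschitz_near_isCont[OF G])
  then obtain s where s: "s > 0" "\<And>y. dist y x < s \<Longrightarrow> dist (G y) (G x) < 1 / (2 * B')"
    unfolding continuous_at_eps_delta using B' by (elim allE[of _ "1 / (2 * B')"]) auto
  define t where "t = Min {e, d, r, s}"
  have t: "t > 0" "t \<le> e" "t \<le> d" "t \<le> r" "t \<le> s" unfolding t_def using e d r s by auto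
  \<comment> \<open>The perturbation costs at most half of the lower bound, hence the factor 2.\<close>
  have inv: "norm v \<le> 2 * B' * norm (G y v)" if "y \<in> ball x t" for y v
  proof -
    have "norm v \<le> B' * norm (G x v)" by (rule B')
    also have "G x v = G y v - (G y - G x) v" by (simp add: blinfun.bilinear_simps)
    also have "norm \<dots> \<le> norm (G y v) + norm (G y - G x) * norm v"
      by (intro norm_triangle_le_diff add_left_mono norm_blinfun)
    also have "\<dots> \<le> norm (G y v) + 1 / (2 * B') * norm v"
      using s(2)[of y] that t by (intro add_left_mono mult_right_mono) (auto simp: dist_norm dist_commute)
    finally show ?thesis using B' by (simp add: field_simps)
  qed
  have zb: "norm (z y) \<le> 2 * B' * C" if "y \<in> ball x t" for y
  proof -
    have "norm (z y) \<le> 2 * B' * norm (\<omega> y)"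
      using inv[OF that, of "z y"] r(2)[of y] that t by (simp add: dist_commute)
    also have "\<dots> \<le> 2 * B' * C" using C(1)[of y] that t B' by (intro mult_left_mono) auto
    finally show ?thesis .
  qed
  have "(2 * B' * (M + L * (2 * B' * C)))-lipschitz_on (ball x t) z"
  proof (rule lipschitz_onI)
    show "0 \<le> 2 * B' * (M + L * (2 * B' * C))"
      using lipschitz_on_nonneg[OF L] lipschitz_on_nonneg[OF M] B' C by simp
    fix y y' assume y: "y \<in> ball x t" "y' \<in> ball x t"
    have "G y (z y - z y') = \<omega> y - \<omega> y' - (G y - G y') (z y')"
      using r(2)[of y] r(2)[of y'] y t by (simp add: blinfun.bilinear_simps dist_commute)
    also have "norm \<dots> \<le> norm (\<omega> y - \<omega> y') + norm (G y - G y') * norm (z y')"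
      by (intro norm_triangle_le_diff add_left_mono norm_blinfun)
    also have "\<dots> \<le> M * dist y y' + (L * dist y y') * (2 * B' * C)"
      using lipschitz_onD[OF L, of y y'] lipschitz_onD[OF M, of y y'] lipschitz_on_nonneg[OF L] y t zb[OF y(2)]
      by (intro add_mono mult_mono) (simp_all add: dist_norm)
    finally have "norm (G y (z y - z y')) \<le> (M + L * (2 * B' * C)) * dist y y'" by (simp add: algebra_simps)
    then have "2 * B' * norm (G y (z y - z y')) \<le> 2 * B' * ((M + L * (2 * B' * C)) * dist y y')"
      using B' by (intro mult_left_mono) auto
    with inv[OF y(1), of "z y - z y'"]
    show "dist (z y) (z y') \<le> 2 * B' * (M + L * (2 * B' * C)) * dist y y'" by (simp add: dist_norm mult.assoc)
  qed
  then show ?thesis unfolding lipschitz_near_def using t by blast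
qed

section \<open>Changes of charts\<close>

text \<open>
  The derivative of the change of coordinates from \<open>c\<close> to \<open>c'\<close>.
\<close>
definition dtrans :: "('m, 'h::{real_inner,banach}) chart \<Rightarrow> ('m, 'h) chart \<Rightarrow> 'h \<Rightarrow> 'h \<Rightarrow>\<^sub>L 'h" where
  "dtrans c c' x = Blinfun (frechet_derivative (cmap c' \<circ> cinv c) (at x))"

lemma components_eq_dtrans: "components A c p = dtrans (chart_at A p) c (cmap (chart_at A p) p)"
  by (simp add: components_def dtrans_def)

lemma from_components_eq_dtrans: "from_components A c p = dtrans c (chart_at A p) (cmap c p)"
  by (simp add: from_components_def dtrans_def)

locale atlas =
  fixes A :: "('m::t2_space, 'h::{real_inner,banach}) chart set"
  assumes smooth_atlas: "smooth_atlas A"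
begin

lemma chart_homeomorphism: "c \<in> A \<Longrightarrow> homeomorphism (cdom c) (cimg c) (cmap c) (cinv c)"
  using smooth_atlas unfolding smooth_atlas_def by blast

lemma open_cdom: "c \<in> A \<Longrightarrow> open (cdom c)"
  and open_cimg: "c \<in> A \<Longrightarrow> open (cimg c)"
  using smooth_atlas unfolding smooth_atlas_def by blast+

lemma cinv_cmap [simp]: "c \<in> A \<Longrightarrow> p \<in> cdom c \<Longrightarrow> cinv c (cmap c p) = p"
  by (rule homeomorphism_apply1[OF chart_homeomorphism])

lemma cmap_cinv [simp]: "c \<in> A \<Longrightarrow> x \<in> cimg c \<Longrightarrow> cmap c (cinv c x) = x"
  by (rule homeomorphism_apply2[OF chart_homeomorphism])

lemma cinv_in_cdom: "x \<in> cimg c \<Longrightarrow> cinv c x \<in> cdom c"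
  by (rule inv_into_into)

lemma isCont_cmap: "c \<in> A \<Longrightarrow> p \<in> cdom c \<Longrightarrow> isCont (cmap c) p"
  using homeomorphism_cont1[OF chart_homeomorphism] open_cdom
  by (simp add: continuous_on_eq_continuous_at)

lemma isCont_cinv: "c \<in> A \<Longrightarrow> x \<in> cimg c \<Longrightarrow> isCont (cinv c) x"
  using continuous_on_eq_continuous_at[OF open_cimg, THEN iffD1, OF _ homeomorphism_cont2[OF chart_homeomorphism]]
  by blast

lemma open_cmap_image:
  assumes "c \<in> A" "open W" "W \<subseteq> cdom c" shows "open (cmap c ` W)"
proof -
  have "openin (top_of_set (cdom c)) W"
    using assms open_cdom by (simp add: openin_open_eq)
  from homeomorphism_imp_open_map[OF chart_homeomorphism[OF assms(1)] this]
  show ?thesis using open_cimg[OF assms(1)] by (simp add: openin_open_eq)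
qed

lemma open_cinv_image:
  assumes "c \<in> A" "open W" "W \<subseteq> cimg c" shows "open (cinv c ` W)"
proof -
  have "openin (top_of_set (cimg c)) W"
    using assms open_cimg by (simp add: openin_open_eq)
  from homeomorphism_imp_open_map[OF homeomorphism_symD[OF chart_homeomorphism[OF assms(1)]] this]
  show ?thesis using open_cdom[OF assms(1)] by (simp add: openin_open_eq)
qed

lemma chart_at: "chart_at A p \<in> A" "p \<in> cdom (chart_at A p)"
proof -
  have "\<exists>c. c \<in> A \<and> p \<in> cdom c" using smooth_atlas unfolding smooth_atlas_def by blast
  then show "chart_at A p \<in> A" "p \<in> cdom (chart_at A p)"
    unfolding chart_at_def by (metis (mono_tags, lifting) someI_ex)+
qed

lemma open_overlap: "c \<in> A \<Longrightarrow> c' \<in> A \<Longrightarrow> open (cmap c ` (cdom c \<inter> cdom c'))"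
  by (intro open_cmap_image) (auto simp: open_cdom)

text \<open>
  The Frechet derivative chosen in the definition is the smooth one provided by
  \<open>smooth_on_derivative\<close>.
\<close>
lemma dtrans_smooth:
  assumes c: "c \<in> A" "c' \<in> A"
  shows "\<And>x. x \<in> cmap c ` (cdom c \<inter> cdom c') \<Longrightarrow> ((cmap c' \<circ> cinv c) has_derivative dtrans c c' x) (at x)"
    and "smooth_on (cmap c ` (cdom c \<inter> cdom c')) (dtrans c c')"
proof -
  let ?U = "cmap c ` (cdom c \<inter> cdom c')"
  have "smooth_on ?U (cmap c' \<circ> cinv c)"
    using smooth_atlas c unfolding smooth_atlas_def by blast
  then obtain F where F: "\<And>x. x \<in> ?U \<Longrightarrow> ((cmap c' \<circ> cinv c) has_derivative blinfun_apply (F x)) (at x)" "smooth_on ?U F"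
    using smooth_on_derivative[OF open_overlap[OF c]] by blast
  have eq: "F x = dtrans c c' x" if "x \<in> ?U" for x
    unfolding dtrans_def frechet_derivative_at[OF F(1)[OF that], symmetric] by (simp add: blinfun_apply_inverse)
  show "((cmap c' \<circ> cinv c) has_derivative dtrans c c' x) (at x)" if "x \<in> ?U" for x
    using F(1)[OF that] eq[OF that] by simp
  show "smooth_on ?U (dtrans c c')"
    by (rule smooth_on_cong[OF F(2) eq])
qed

lemma dtrans_has_derivative:
  assumes "c \<in> A" "c' \<in> A" "p \<in> cdom c" "p \<in> cdom c'"
  shows "((cmap c' \<circ> cinv c) has_derivative dtrans c c' (cmap c p)) (at (cmap c p))"
  by (rule dtrans_smooth(1)) (use assms in auto)

lemma dtrans_compose:
  assumes c: "c \<in> A" "c' \<in> A" "c'' \<in> A" and p: "p \<in> cdom c" "p \<in> cdom c'" "p \<in> cdom c''"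
  shows "dtrans c' c'' (cmap c' p) (dtrans c c' (cmap c p) v) = dtrans c c'' (cmap c p) v"
proof -
  have "((cmap c' \<circ> cinv c) has_derivative dtrans c c' (cmap c p)) (at (cmap c p))"
    by (rule dtrans_has_derivative) (use c p in auto)
  moreover have "((cmap c'' \<circ> cinv c') has_derivative dtrans c' c'' (cmap c' p)) (at ((cmap c' \<circ> cinv c) (cmap c p)))"
    using dtrans_has_derivative[of c' c'' p] c p by simp
  ultimately have 1: "((cmap c'' \<circ> cinv c') \<circ> (cmap c' \<circ> cinv c) has_derivative
      (dtrans c' c'' (cmap c' p) \<circ> dtrans c c' (cmap c p))) (at (cmap c p))"
    by (rule diff_chain_at)
  have "((cmap c'' \<circ> cinv c) has_derivative (dtrans c' c'' (cmap c' p) \<circ> dtrans c c' (cmap c p))) (at (cmap c p))"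
  proof (rule has_derivative_transform_within_open[OF 1 open_overlap[OF c(1,2)]])
    show "cmap c p \<in> cmap c ` (cdom c \<inter> cdom c')" using p by auto
    show "((cmap c'' \<circ> cinv c') \<circ> (cmap c' \<circ> cinv c)) x = (cmap c'' \<circ> cinv c) x"
      if "x \<in> cmap c ` (cdom c \<inter> cdom c')" for x using that c by auto
  qed
  from has_derivative_unique[OF this dtrans_has_derivative[OF c(1,3) p(1,3)]]
  show ?thesis by (metis comp_apply)
qed

lemma dtrans_self:
  assumes "c \<in> A" "p \<in> cdom c" shows "dtrans c c (cmap c p) v = v"
proof -
  have "((cmap c \<circ> cinv c) has_derivative id) (at (cmap c p))"
  proof (rule has_derivative_transform_within_open[OF has_derivative_id open_cimg[OF assms(1)]])
    show "cmap c p \<in> cimg c" using assms by auto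
  qed (use assms in auto)
  from has_derivative_unique[OF this dtrans_has_derivative[OF assms(1,1,2,2)]]
  show ?thesis by (metis id_apply)
qed

lemma dtrans_inverse:
  assumes "c \<in> A" "c' \<in> A" "p \<in> cdom c" "p \<in> cdom c'"
  shows "dtrans c' c (cmap c' p) (dtrans c c' (cmap c p) v) = v"
  using assms by (simp add: dtrans_compose dtrans_self)

lemma components_from_components [simp]:
  assumes "c \<in> A" "p \<in> cdom c"
  shows "components A c p (from_components A c p v) = v"
    and "from_components A c p (components A c p v) = v"
  unfolding components_eq_dtrans from_components_eq_dtrans
  using assms by (auto intro!: dtrans_inverse simp: chart_at)

lemma components_chart_at [simp]: "components A (chart_at A p) p v = v"
  by (simp add: components_eq_dtrans dtrans_self chart_at)

lemma components_eq_iff: "c \<in> A \<Longrightarrow> p \<in> cdom c \<Longrightarrow> components A c p u = components A c p v \<longleftrightarrow> u = v"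
  by (metis components_from_components(2))

text \<open>
  Stated within a set \<open>J\<close>, since curves in the definition of length have one-sided derivatives at
  their break points.
\<close>
lemma chart_change_vector_derivative:
  assumes c: "c \<in> A" "c' \<in> A" and t: "\<gamma> t \<in> cdom c" "\<gamma> t \<in> cdom c'" "t \<in> J"
    and cont: "continuous (at t within J) \<gamma>"
    and der: "((cmap c \<circ> \<gamma>) has_vector_derivative v) (at t within J)"
  shows "((cmap c' \<circ> \<gamma>) has_vector_derivative dtrans c c' (cmap c (\<gamma> t)) v) (at t within J)"
proof -
  have "((cmap c' \<circ> cinv c) has_derivative dtrans c c' (cmap c (\<gamma> t)))
      (at ((cmap c \<circ> \<gamma>) t) within (cmap c \<circ> \<gamma>) ` J)"
    using dtrans_has_derivative[OF c t(1,2)] by (simp add: has_derivative_at_withinI)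
  from vector_derivative_diff_chain_within[OF der this]
  have 1: "((cmap c' \<circ> cinv c) \<circ> (cmap c \<circ> \<gamma>) has_vector_derivative dtrans c c' (cmap c (\<gamma> t)) v) (at t within J)" .
  have "\<forall>\<^sub>F s in at t within J. \<gamma> s \<in> cdom c"
    using topological_tendstoD[OF cont[unfolded continuous_within] open_cdom[OF c(1)] t(1)] .
  then have ev: "\<forall>\<^sub>F s in at t within J. ((cmap c' \<circ> cinv c) \<circ> (cmap c \<circ> \<gamma>)) s = (cmap c' \<circ> \<gamma>) s"
    by eventually_elim (use c in auto)
  have "((cmap c' \<circ> cinv c) \<circ> (cmap c \<circ> \<gamma>)) t = (cmap c' \<circ> \<gamma>) t" using t c by simp
  from has_derivative_transform_eventually[OF 1[unfolded has_vector_derivative_def] ev this t(3)]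
  show ?thesis unfolding has_vector_derivative_def .
qed

lemma velocity_components:
  assumes c: "c \<in> A" "\<gamma> t \<in> cdom c" and cont: "isCont \<gamma> t"
    and der: "((cmap c \<circ> \<gamma>) has_vector_derivative v) (at t)"
  shows "components A c (\<gamma> t) (velocity A \<gamma> t) = v"
proof -
  let ?c = "chart_at A (\<gamma> t)"
  have "((cmap ?c \<circ> \<gamma>) has_vector_derivative dtrans c ?c (cmap c (\<gamma> t)) v) (at t)"
    by (rule chart_change_vector_derivative[OF c(1) chart_at(1) c(2) chart_at(2) UNIV_I cont der])
  then have "velocity A \<gamma> t = dtrans c ?c (cmap c (\<gamma> t)) v"
    unfolding velocity_def by (rule vector_derivative_at)
  then show ?thesis
    unfolding components_eq_dtrans using c by (simp add: dtrans_inverse chart_at)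
qed

section \<open>Second order behaviour of curves and the covariant derivative\<close>

text \<open>
  Near \<open>t\<close> the curve stays in the chart \<open>c\<close> with coordinate velocity \<open>v\<close>, and \<open>a\<close> is its
  coordinate acceleration at \<open>t\<close>. This is the local form of \<open>twice_differentiable_curve\<close>, and it
  allows second derivatives to be computed without reference to the chart that happens to represent
  the tangent space.
\<close>
definition chart_jet :: "('m, 'h) chart \<Rightarrow> (real \<Rightarrow> 'm) \<Rightarrow> real \<Rightarrow> (real \<Rightarrow> 'h) \<Rightarrow> 'h \<Rightarrow> bool" where
  "chart_jet c \<gamma> t v a \<longleftrightarrow> c \<in> A \<and>
     (\<forall>\<^sub>F s in nhds t. \<gamma> s \<in> cdom c \<and> isCont \<gamma> s \<and> ((cmap c \<circ> \<gamma>) has_vector_derivative v s) (at s)) \<and>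
     (v has_vector_derivative a) (at t)"

lemma chart_jetD:
  assumes "chart_jet c \<gamma> t v a"
  shows "c \<in> A" "\<gamma> t \<in> cdom c" "isCont \<gamma> t" "((cmap c \<circ> \<gamma>) has_vector_derivative v t) (at t)"
    "(v has_vector_derivative a) (at t)"
proof -
  show "c \<in> A" "(v has_vector_derivative a) (at t)" using assms unfolding chart_jet_def by blast+
  show "\<gamma> t \<in> cdom c" "isCont \<gamma> t" "((cmap c \<circ> \<gamma>) has_vector_derivative v t) (at t)"
    using eventually_nhds_x_imp_x[OF assms[unfolded chart_jet_def, THEN conjunct2, THEN conjunct1]] by blast+
qed

lemma chart_jet_unique:
  assumes "chart_jet c \<gamma> t v a" "chart_jet c \<gamma> t v' a'"
  shows "\<forall>\<^sub>F s in nhds t. v s = v' s" "v t = v' t" "a = a'"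
proof -
  show ev: "\<forall>\<^sub>F s in nhds t. v s = v' s"
    using assms[unfolded chart_jet_def, THEN conjunct2, THEN conjunct1]
    by eventually_elim (elim conjE, rule vector_derivative_unique_at)
  then show "v t = v' t" by (rule eventually_nhds_x_imp_x)
  obtain W where W: "open W" "t \<in> W" "\<And>s. s \<in> W \<Longrightarrow> v s = v' s"
    using ev unfolding eventually_nhds by blast
  have "(v' has_vector_derivative a) (at t)"
    by (rule has_vector_derivative_transform_within_open[OF chart_jetD(5)[OF assms(1)] W])
  then show "a = a'" using chart_jetD(5)[OF assms(2)] by (rule vector_derivative_unique_at)
qed

lemma dtrans_apply_has_derivative:
  assumes c: "c \<in> A" "c' \<in> A" and x: "x \<in> cmap c ` (cdom c \<inter> cdom c')"
  obtains D where "(dtrans c c' has_derivative blinfun_apply D) (at x)"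
    "\<And>v. frechet_derivative (\<lambda>y. frechet_derivative (cmap c' \<circ> cinv c) (at y) v) (at x) = (\<lambda>u. D u v)"
proof -
  obtain F where F: "(dtrans c c' has_derivative blinfun_apply (F x)) (at x)"
    using smooth_on_derivative[OF open_overlap[OF c] dtrans_smooth(2)[OF c]] x by blast
  have "frechet_derivative (\<lambda>y. frechet_derivative (cmap c' \<circ> cinv c) (at y) v) (at x) = (\<lambda>u. F x u v)" for v
  proof (rule frechet_derivative_at[symmetric])
    have 1: "((\<lambda>y. dtrans c c' y v) has_derivative (\<lambda>u. F x u v)) (at x)"
      by (auto intro!: derivative_eq_intros F)
    show "((\<lambda>y. frechet_derivative (cmap c' \<circ> cinv c) (at y) v) has_derivative (\<lambda>u. F x u v)) (at x)"
    proof (rule has_derivative_transform_within_open[OF 1 open_overlap[OF c] x])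
      fix y assume "y \<in> cmap c ` (cdom c \<inter> cdom c')"
      from frechet_derivative_at[OF dtrans_smooth(1)[OF c this]]
      show "dtrans c c' y v = frechet_derivative (cmap c' \<circ> cinv c) (at y) v" by simp
    qed
  qed
  with F that show thesis by blast
qed

text \<open>
  Second derivatives are not tensorial: the acceleration picks up the second derivative of the
  change of coordinates, exactly the term that the Christoffel symbols compensate.
\<close>
lemma chart_jet_change:
  assumes jet: "chart_jet c \<gamma> t v a" and c': "c' \<in> A" "\<gamma> t \<in> cdom c'"
  shows "chart_jet c' \<gamma> t (\<lambda>s. dtrans c c' (cmap c (\<gamma> s)) (v s))
    (frechet_derivative (\<lambda>y. frechet_derivative (cmap c' \<circ> cinv c) (at y) (v t)) (at (cmap c (\<gamma> t))) (v t)
       + dtrans c c' (cmap c (\<gamma> t)) a)"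
  unfolding chart_jet_def
proof (intro conjI)
  note c = chart_jetD(1)[OF jet]
  have "\<forall>\<^sub>F s in nhds t. \<gamma> s \<in> cdom c'"
    using chart_jetD(3)[OF jet] open_cdom[OF c'(1)] c'(2)
    by (auto simp: isCont_def tendsto_nhds_iff intro: topological_tendstoD)
  with jet[unfolded chart_jet_def, THEN conjunct2, THEN conjunct1]
  show "\<forall>\<^sub>F s in nhds t. \<gamma> s \<in> cdom c' \<and> isCont \<gamma> s \<and>
      ((cmap c' \<circ> \<gamma>) has_vector_derivative dtrans c c' (cmap c (\<gamma> s)) (v s)) (at s)"
    by eventually_elim (use c c' in \<open>auto intro!: chart_change_vector_derivative\<close>)
  have x: "cmap c (\<gamma> t) \<in> cmap c ` (cdom c \<inter> cdom c')" using chart_jetD(2)[OF jet] c' by auto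
  obtain D where D: "(dtrans c c' has_derivative blinfun_apply D) (at (cmap c (\<gamma> t)))"
    "\<And>v. frechet_derivative (\<lambda>y. frechet_derivative (cmap c' \<circ> cinv c) (at y) v) (at (cmap c (\<gamma> t))) = (\<lambda>u. D u v)"
    using dtrans_apply_has_derivative[OF c c'(1) x] by blast
  have "((\<lambda>s. dtrans c c' (cmap c (\<gamma> s))) has_vector_derivative D (v t)) (at t)"
    using vector_derivative_diff_chain_within[OF chart_jetD(4)[OF jet], of "dtrans c c'" D] D(1)
    by (simp add: has_derivative_at_withinI o_def)
  from bounded_bilinear.has_vector_derivative[OF bounded_bilinear_blinfun_apply this chart_jetD(5)[OF jet]]
  show "((\<lambda>s. dtrans c c' (cmap c (\<gamma> s)) (v s)) has_vector_derivative
      (frechet_derivative (\<lambda>y. frechet_derivative (cmap c' \<circ> cinv c) (at y) (v t)) (at (cmap c (\<gamma> t))) (v t)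
       + dtrans c c' (cmap c (\<gamma> t)) a)) (at t)"
    by (simp add: D(2) add.commute)
qed (use c' in auto)

text \<open>
  Jets depend only on the curve near \<open>t\<close>, so they survive the gluing of solutions.
\<close>
lemma chart_jet_transform:
  assumes jet: "chart_jet c \<gamma> t v a" and eq: "\<forall>\<^sub>F s in nhds t. \<gamma> s = \<delta> s"
  shows "chart_jet c \<delta> t v a"
  unfolding chart_jet_def
proof (intro conjI)
  have ev: "\<forall>\<^sub>F s in nhds t. \<forall>\<^sub>F s' in nhds s. \<gamma> s' = \<delta> s'"
    using eq by (simp add: eventually_eventually)
  from jet[unfolded chart_jet_def, THEN conjunct2, THEN conjunct1] ev
  show "\<forall>\<^sub>F s in nhds t. \<delta> s \<in> cdom c \<and> isCont \<delta> s \<and> ((cmap c \<circ> \<delta>) has_vector_derivative v s) (at s)"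
  proof eventually_elim
    case (elim s)
    then obtain W where W: "open W" "s \<in> W" "\<And>s'. s' \<in> W \<Longrightarrow> \<gamma> s' = \<delta> s'" unfolding eventually_nhds by blast
    have "((cmap c \<circ> \<delta>) has_vector_derivative v s) (at s)"
      by (rule has_vector_derivative_transform_within_open[OF _ W(1,2), of "cmap c \<circ> \<gamma>"]) (use elim W(3) in auto)
    moreover have "isCont \<delta> s" using elim isCont_cong[of \<gamma> \<delta> s] by blast
    moreover have "\<delta> s \<in> cdom c" using elim W by force
    ultimately show ?case by blast
  qed
qed (use chart_jetD[OF jet] in auto)

lemma twice_differentiable_curve_jet:
  assumes \<gamma>: "twice_differentiable_curve A I \<gamma>" and I: "open I" "t \<in> I" and c: "c \<in> A" "\<gamma> t \<in> cdom c"
  obtains a where "chart_jet c \<gamma> t (\<lambda>s. vector_derivative (cmap c \<circ> \<gamma>) (at s)) a"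
proof -
  have cont: "isCont \<gamma> s" if "s \<in> I" for s
    using \<gamma> I that unfolding twice_differentiable_curve_def by (auto simp: continuous_on_eq_continuous_at)
  have d: "(cmap c \<circ> \<gamma>) differentiable (at s) \<and>
        (\<lambda>s. vector_derivative (cmap c \<circ> \<gamma>) (at s)) differentiable (at s)" if "s \<in> I" "\<gamma> s \<in> cdom c" for s
    using \<gamma> that c unfolding twice_differentiable_curve_def by blast
  have "\<forall>\<^sub>F s in nhds t. \<gamma> s \<in> cdom c"
    using cont[OF I(2)] open_cdom[OF c(1)] c(2)
    by (auto simp: isCont_def tendsto_nhds_iff intro: topological_tendstoD)
  moreover have "\<forall>\<^sub>F s in nhds t. s \<in> I" using I by (simp add: eventually_nhds_in_open)
  ultimately have "\<forall>\<^sub>F s in nhds t. \<gamma> s \<in> cdom c \<and> isCont \<gamma> s \<and>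
      ((cmap c \<circ> \<gamma>) has_vector_derivative vector_derivative (cmap c \<circ> \<gamma>) (at s)) (at s)"
    by eventually_elim (use cont d vector_derivative_works in blast)
  then show thesis using that c d[OF I(2) c(2)] unfolding chart_jet_def vector_derivative_works by blast
qed

lemma twice_differentiable_curveI:
  assumes "\<And>t. t \<in> I \<Longrightarrow> \<exists>c v a. chart_jet c \<gamma> t v a"
  shows "twice_differentiable_curve A I \<gamma>"
  unfolding twice_differentiable_curve_def
proof (intro conjI ballI impI)
  show "continuous_on I \<gamma>"
    using assms chart_jetD(3) by (blast intro: continuous_at_imp_continuous_on)
  fix c t assume "c \<in> A" "t \<in> I" "\<gamma> t \<in> cdom c"
  then obtain v a where j: "chart_jet c \<gamma> t v a" using assms chart_jet_change by blast
  from chart_jetD(4)[OF j] show "(cmap c \<circ> \<gamma>) differentiable at t" by (rule differentiableI_vector)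
  have "\<forall>\<^sub>F s in nhds t. v s = vector_derivative (cmap c \<circ> \<gamma>) (at s)"
    using j[unfolded chart_jet_def, THEN conjunct2, THEN conjunct1]
    by eventually_elim (auto simp: vector_derivative_at)
  then obtain W where W: "open W" "t \<in> W" "\<And>s. s \<in> W \<Longrightarrow> v s = vector_derivative (cmap c \<circ> \<gamma>) (at s)"
    unfolding eventually_nhds by blast
  have "((\<lambda>s. vector_derivative (cmap c \<circ> \<gamma>) (at s)) has_vector_derivative a) (at t)"
    by (rule has_vector_derivative_transform_within_open[OF chart_jetD(5)[OF j] W])
  then show "(\<lambda>s. vector_derivative (cmap c \<circ> \<gamma>) (at s)) differentiable at t" by (rule differentiableI_vector)
qed

lemma velocity_components_jet:
  assumes "chart_jet c \<gamma> t v a"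
  shows "components A c (\<gamma> t) (velocity A \<gamma> t) = v t"
  using chart_jetD[OF assms] by (intro velocity_components)

text \<open>
  The covariant derivative is defined through the chart chosen at \<open>\<gamma> t\<close>, which jumps along the
  curve. By the transformation law of the Christoffel symbols, \<open>a + \<Gamma> (v, v)\<close> computed in any
  chart \<open>c\<close> represents the same tangent vector. Every statement about the equation of motion
  reduces to coordinates through this lemma.
\<close>
lemma covariant_derivative_components:
  assumes \<Gamma>: "linear_connection A \<Gamma>" and jet: "chart_jet c \<gamma> t v a"
  shows "components A c (\<gamma> t) (covariant_derivative A \<Gamma> \<gamma> (velocity A \<gamma>) t)
    = a + \<Gamma> c (cmap c (\<gamma> t)) (v t) (v t)"
proof -
  note c = chart_jetD(1,2)[OF jet]
  define c0 where "c0 = chart_at A (\<gamma> t)"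
  have c0: "c0 \<in> A" "\<gamma> t \<in> cdom c0" by (simp_all add: c0_def chart_at)
  obtain v0 a0 where j0: "chart_jet c0 \<gamma> t v0 a0" using chart_jet_change[OF jet c0] by blast
  have "\<forall>\<^sub>F s in nhds t. v0 s = components A c0 (\<gamma> s) (velocity A \<gamma> s)"
    using j0[unfolded chart_jet_def, THEN conjunct2, THEN conjunct1]
    by eventually_elim (elim conjE, rule velocity_components[OF c0(1), symmetric])
  then obtain W where W: "open W" "t \<in> W" "\<And>s. s \<in> W \<Longrightarrow> v0 s = components A c0 (\<gamma> s) (velocity A \<gamma> s)"
    unfolding eventually_nhds by blast
  have "((\<lambda>s. components A c0 (\<gamma> s) (velocity A \<gamma> s)) has_vector_derivative a0) (at t)"
    by (rule has_vector_derivative_transform_within_open[OF chart_jetD(5)[OF j0] W])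
  then have "vector_derivative (\<lambda>s. components A c0 (\<gamma> s) (velocity A \<gamma> s)) (at t) = a0"
    by (rule vector_derivative_at)
  moreover have "velocity A \<gamma> t = v0 t"
    using velocity_components_jet[OF j0] by (simp add: c0_def)
  ultimately have cov: "covariant_derivative A \<Gamma> \<gamma> (velocity A \<gamma>) t
      = a0 + \<Gamma> c0 (cmap c0 (\<gamma> t)) (v0 t) (v0 t)"
    by (simp add: covariant_derivative_def Let_def flip: c0_def)
  let ?y = "cmap c0 (\<gamma> t)"
  have jc: "chart_jet c \<gamma> t (\<lambda>s. dtrans c0 c (cmap c0 (\<gamma> s)) (v0 s))
    (frechet_derivative (\<lambda>y. frechet_derivative (cmap c \<circ> cinv c0) (at y) (v0 t)) (at ?y) (v0 t)
       + dtrans c0 c ?y a0)"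
    by (rule chart_jet_change[OF j0 c])
  have y: "?y \<in> cmap c0 ` (cdom c0 \<inter> cdom c)" using c c0 by auto
  have fd: "frechet_derivative (cmap c \<circ> cinv c0) (at ?y) = dtrans c0 c ?y"
    by (rule frechet_derivative_at[OF dtrans_smooth(1), symmetric]) (use c c0 y in auto)
  have "dtrans c0 c ?y (\<Gamma> c0 ?y (v0 t) (v0 t)) =
      \<Gamma> c (cmap c (\<gamma> t)) (dtrans c0 c ?y (v0 t)) (dtrans c0 c ?y (v0 t))
      + frechet_derivative (\<lambda>y. frechet_derivative (cmap c \<circ> cinv c0) (at y) (v0 t)) (at ?y) (v0 t)"
    using \<Gamma>[unfolded linear_connection_def, THEN conjunct2, rule_format, OF c0(1) c(1) y, of "v0 t" "v0 t"] c0
    unfolding Let_def fd by simp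
  moreover have "components A c (\<gamma> t) = dtrans c0 c ?y" by (simp add: components_eq_dtrans c0_def)
  ultimately show ?thesis
    unfolding cov chart_jet_unique(2,3)[OF jet jc] by (simp add: blinfun.bilinear_simps)
qed

end

section \<open>Pointwise Riemannian geometry\<close>

locale riemannian = atlas +
  fixes g :: "'a \<Rightarrow> 'b \<Rightarrow>\<^sub>L 'b \<Rightarrow>\<^sub>L real"
  assumes riemannian_metric: "riemannian_metric A g"
begin

lemma g_sym: "g p u v = g p v u"
  using riemannian_metric[unfolded riemannian_metric_def, THEN conjunct1, rule_format] .

lemma g_pos: "v \<noteq> 0 \<Longrightarrow> g p v v > 0"
  using riemannian_metric[unfolded riemannian_metric_def, THEN conjunct2, THEN conjunct1, rule_format] .

lemma g_homeomorphism: "\<exists>k. homeomorphism UNIV UNIV (blinfun_apply (g p)) k"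
  using riemannian_metric[unfolded riemannian_metric_def, THEN conjunct2, THEN conjunct2, THEN conjunct1, rule_format] .

lemma metric_components_smooth: "c \<in> A \<Longrightarrow> smooth_on (cimg c) (metric_components A g c)"
  using riemannian_metric[unfolded riemannian_metric_def, THEN conjunct2, THEN conjunct2, THEN conjunct2, rule_format] .

lemma g_nonneg: "g p v v \<ge> 0"
  by (cases "v = 0") (auto simp: blinfun.bilinear_simps g_pos less_imp_le)

lemma gnorm_nonneg [simp]: "gnorm g p v \<ge> 0"
  by (simp add: gnorm_def g_nonneg)

lemma gnorm_sq: "(gnorm g p v)\<^sup>2 = g p v v"
  by (simp add: gnorm_def g_nonneg)

lemma g_Cauchy_Schwarz: "\<bar>g p u v\<bar> \<le> gnorm g p u * gnorm g p v"
proof (cases "v = 0")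
  case True
  then show ?thesis by (simp add: blinfun.bilinear_simps)
next
  case False
  define s where "s = g p u v / g p v v"
  have s: "s * g p v v = g p u v" using g_pos[OF False, of p] by (simp add: s_def)
  have "0 \<le> g p (u - s *\<^sub>R v) (u - s *\<^sub>R v)" by (rule g_nonneg)
  also have "\<dots> = g p u u - s * g p u v - s * (g p u v - s * g p v v)"
    by (simp add: blinfun.bilinear_simps g_sym[of p v u] algebra_simps)
  also have "\<dots> = g p u u - s * g p u v" by (simp add: s)
  finally have "s * g p u v * g p v v \<le> g p u u * g p v v"
    using g_nonneg[of p v] by (intro mult_right_mono) auto
  moreover have "(g p u v)\<^sup>2 = s * g p u v * g p v v" using s by (simp add: power2_eq_square mult_ac)
  moreover have "(gnorm g p u * gnorm g p v)\<^sup>2 = g p u u * g p v v" by (simp add: power_mult_distrib gnorm_sq)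
  ultimately have "(g p u v)\<^sup>2 \<le> (gnorm g p u * gnorm g p v)\<^sup>2" by simp
  then show ?thesis by (simp add: abs_le_square_iff[symmetric])
qed

lemma gnorm_le: "gnorm g p v \<le> sqrt (norm (g p)) * norm v"
proof -
  have "g p v v \<le> norm (g p v) * norm v" using norm_blinfun[of "g p v" v] by simp
  also have "\<dots> \<le> norm (g p) * norm v * norm v" by (intro mult_right_mono norm_blinfun) simp
  finally have "gnorm g p v \<le> sqrt (norm (g p) * norm v * norm v)"
    unfolding gnorm_def by (rule real_sqrt_le_mono)
  then show ?thesis by (simp add: real_sqrt_mult mult.assoc)
qed

text \<open>
  In infinite dimensions positivity alone gives no such bound; it comes from the continuity of the
  inverse of \<open>v \<mapsto> g p v\<close> at the origin.
\<close>
lemma g_bounded_below: obtains B where "B > 0" "\<And>v. norm v \<le> B * norm (g p v)"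
proof -
  obtain k where k: "homeomorphism UNIV UNIV (blinfun_apply (g p)) k"
    using g_homeomorphism by blast
  have kg: "k (g p v) = v" for v using homeomorphism_apply1[OF k] by simp
  have "isCont k 0" using homeomorphism_cont2[OF k] by (simp add: continuous_on_eq_continuous_at)
  moreover have "k 0 = 0" using kg[of 0] by (simp add: blinfun.bilinear_simps)
  ultimately have "\<exists>d>0. \<forall>y. dist y 0 < d \<longrightarrow> dist (k y) 0 < 1"
    unfolding continuous_at_eps_delta using zero_less_one by force
  then obtain d where d: "d > 0" "\<And>y. norm y < d \<Longrightarrow> norm (k y) < 1" by auto
  have "norm v \<le> (2 / d) * norm (g p v)" for v
  proof (cases "v = 0")
    case False
    have "g p v \<noteq> 0" using kg[of v] \<open>k 0 = 0\<close> False by metis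
    define s where "s = d / (2 * norm (g p v))"
    have s: "s > 0" using d \<open>g p v \<noteq> 0\<close> by (simp add: s_def)
    have "norm (g p (s *\<^sub>R v)) < d" using d \<open>g p v \<noteq> 0\<close> by (simp add: blinfun.bilinear_simps s_def)
    from d(2)[OF this] have "s * norm v < 1" using s by (simp add: kg)
    then show ?thesis using d \<open>g p v \<noteq> 0\<close> by (simp add: s_def field_simps)
  qed (simp add: d less_imp_le)
  moreover have "2 / d > 0" using d by simp
  ultimately show thesis using that by blast
qed

text \<open>
  The intrinsic norm is equivalent to the norm of the model space: by the Cauchy-Schwarz inequality
  the dual norm of \<open>g p v\<close> is at most a constant times \<open>gnorm g p v\<close>.
\<close>
lemma gnorm_coercive: obtains C where "C > 0" "\<And>v. norm v \<le> C * gnorm g p v"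
proof -
  obtain B where B: "B > 0" "\<And>v. norm v \<le> B * norm (g p v)" using g_bounded_below by blast
  have *: "norm (g p v) \<le> gnorm g p v * sqrt (norm (g p))" for v
  proof (rule norm_blinfun_bound)
    fix w
    have "norm (g p v w) \<le> gnorm g p v * gnorm g p w" using g_Cauchy_Schwarz by simp
    also have "\<dots> \<le> gnorm g p v * (sqrt (norm (g p)) * norm w)" by (intro mult_left_mono gnorm_le) simp
    finally show "norm (g p v w) \<le> gnorm g p v * sqrt (norm (g p)) * norm w" by (simp add: mult.assoc)
  qed simp
  have "norm v \<le> (B * sqrt (norm (g p)) + 1) * gnorm g p v" for v
  proof -
    have "norm v \<le> B * norm (g p v)" by (rule B)
    also have "\<dots> \<le> B * (gnorm g p v * sqrt (norm (g p)))"
      using B(1) by (intro mult_left_mono *) simp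
    also have "\<dots> \<le> B * (gnorm g p v * sqrt (norm (g p))) + gnorm g p v" by simp
    finally show ?thesis by (simp add: algebra_simps)
  qed
  moreover have "B * sqrt (norm (g p)) + 1 > 0" using B by (simp add: add_nonneg_pos)
  ultimately show thesis using that by blast
qed

lemma g_represents:
  fixes f :: "'b \<Rightarrow>\<^sub>L real"
  shows "\<exists>!z. \<forall>w. g p z w = f w"
proof -
  obtain k where k: "homeomorphism UNIV UNIV (blinfun_apply (g p)) k"
    using g_homeomorphism by blast
  have "g p (k f) = f" "\<And>z. k (g p z) = z" using homeomorphism_apply1[OF k] homeomorphism_apply2[OF k] by auto
  then show ?thesis by (metis blinfun_eqI)
qed

lemma g_nondegenerate: "(\<And>w. g p z w = g p z' w) \<Longrightarrow> z = z'"
  using g_represents[of p "g p z'"] by blast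

text \<open>
  The candidate \<open>a v\<close> represents the functional \<open>u \<mapsto> g(T u, v)\<close>. Its boundedness, which the
  definition of the adjoint requires, follows from \<open>g_bounded_below\<close>.
\<close>
lemma gadjoint:
  fixes T :: "'b \<Rightarrow>\<^sub>L 'b"
  shows "g p (T u) v = g p u (gadjoint g p T v)"
proof -
  define F where "F v = g p v o\<^sub>L T" for v
  define a where "a v = (THE z. \<forall>w. g p z w = F v w)" for v
  have a: "g p (a v) w = g p v (T w)" for v w
    using theI'[OF g_represents[of p "F v"]] unfolding a_def[symmetric] by (simp add: F_def)
  obtain B where B: "B > 0" "\<And>v. norm v \<le> B * norm (g p v)" using g_bounded_below by blast
  have "bounded_linear a"
  proof (rule bounded_linear_intro)
    show "a (x + y) = a x + a y" for x y by (rule g_nondegenerate[of p]) (simp add: blinfun.bilinear_simps a)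
    show "a (r *\<^sub>R x) = r *\<^sub>R a x" for r x by (rule g_nondegenerate[of p]) (simp add: blinfun.bilinear_simps a)
    fix x
    have "g p (a x) = g p x o\<^sub>L T" by (rule blinfun_eqI) (simp add: a)
    then have "norm (a x) \<le> B * norm (g p x o\<^sub>L T)" using B(2)[of "a x"] by simp
    also have "\<dots> \<le> B * (norm (g p) * norm x * norm T)"
      using B norm_blinfun_compose[of "g p x" T] mult_right_mono[OF norm_blinfun[of "g p" x], of "norm T"]
      by (intro mult_left_mono) auto
    finally show "norm (a x) \<le> norm x * (B * norm (g p) * norm T)" by (simp add: mult_ac)
  qed
  then have "blinfun_apply (Blinfun a) = a" by (rule bounded_linear_Blinfun_apply)
  then have ex: "\<forall>u v. g p (T u) v = g p u (Blinfun a v)" by (simp add: a g_sym[of p _ "a _"] g_sym[of p "T _"])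
  have "gadjoint g p T = Blinfun a"
    unfolding gadjoint_def
  proof (rule the_equality[of _ "Blinfun a"])
    fix T' :: "'b \<Rightarrow>\<^sub>L 'b" assume T': "\<forall>u v. g p (T u) v = g p u (T' v)"
    show "T' = Blinfun a"
    proof (rule blinfun_eqI, rule g_nondegenerate[of p])
      fix v w
      have "g p w (T' v) = g p w (Blinfun a v)" using T' ex by metis
      then show "g p (T' v) w = g p (Blinfun a v) w" by (simp add: g_sym[of p w])
    qed
  qed (rule ex)
  with ex show ?thesis by simp
qed

text \<open>
  The supremum that defines \<open>op_gnorm\<close> is meaningful only if it is finite, which is where the
  equivalence of the two norms enters.
\<close>
lemma gnorm_op_gnorm:
  fixes T :: "'b \<Rightarrow>\<^sub>L 'b"
  shows "gnorm g p (T v) \<le> op_gnorm g p T * gnorm g p v"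
proof -
  obtain C where C: "C > 0" "\<And>v. norm v \<le> C * gnorm g p v" using gnorm_coercive by blast
  have bdd: "bdd_above (range (\<lambda>v. gnorm g p (T v) / gnorm g p v))"
  proof (rule bdd_aboveI2)
    fix v
    have "gnorm g p (T v) \<le> sqrt (norm (g p)) * norm (T v)" by (rule gnorm_le)
    also have "\<dots> \<le> sqrt (norm (g p)) * (norm T * (C * gnorm g p v))"
      by (intro mult_left_mono order_trans[OF norm_blinfun[of T v]] C) auto
    finally show "gnorm g p (T v) / gnorm g p v \<le> sqrt (norm (g p)) * norm T * C"
      using C by (cases "gnorm g p v = 0") (auto simp: divide_le_eq mult_ac less_le)
  qed
  show ?thesis
  proof (cases "v = 0")
    case False
    then have "gnorm g p v > 0" using g_pos by (simp add: gnorm_def)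
    moreover have "gnorm g p (T v) / gnorm g p v \<le> op_gnorm g p T"
      unfolding op_gnorm_def by (rule cSUP_upper[OF UNIV_I bdd])
    ultimately show ?thesis by (simp add: divide_le_eq)
  qed (simp add: gnorm_def blinfun.bilinear_simps)
qed

text \<open>
  The skew-adjoint part of an endomorphism does no work.
\<close>
lemma g_self_adjoint_part_bound:
  fixes S T :: "'b \<Rightarrow>\<^sub>L 'b"
  assumes "S = (1/2) *\<^sub>R (T + gadjoint g p T)"
  shows "\<bar>g p (T v) v\<bar> \<le> op_gnorm g p S * (gnorm g p v)\<^sup>2"
proof -
  have "g p (S v) v = g p (T v) v"
    using gadjoint[of p T v v] g_sym[of p "gadjoint g p T v" v]
    by (simp add: assms blinfun.bilinear_simps)
  moreover have "\<bar>g p (S v) v\<bar> \<le> gnorm g p (S v) * gnorm g p v" by (rule g_Cauchy_Schwarz)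
  moreover have "gnorm g p (S v) * gnorm g p v \<le> op_gnorm g p S * gnorm g p v * gnorm g p v"
    by (intro mult_right_mono gnorm_op_gnorm) simp
  ultimately show ?thesis by (simp add: power2_eq_square mult.assoc)
qed

text \<open>
  The gradient is defined by means of the chart chosen at \<open>p\<close>; the differential may be taken in any
  chart.
\<close>
lemma gradient:
  assumes c: "c \<in> A" "p \<in> cdom c" and f: "((f \<circ> cinv c) has_derivative d) (at (cmap c p))"
  shows "g p (gradient A g f p) w = d (components A c p w)"
proof -
  define c0 where "c0 = chart_at A p"
  have c0: "c0 \<in> A" "p \<in> cdom c0" by (simp_all add: c0_def chart_at)
  let ?y = "cmap c0 p"
  have "((f \<circ> cinv c) has_derivative d) (at ((cmap c \<circ> cinv c0) ?y))" using f c0 by simp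
  from diff_chain_at[OF dtrans_has_derivative[OF c0(1) c(1) c0(2) c(2)] this]
  have 1: "((f \<circ> cinv c) \<circ> (cmap c \<circ> cinv c0) has_derivative (d \<circ> dtrans c0 c ?y)) (at ?y)" .
  have "((f \<circ> cinv c0) has_derivative (d \<circ> dtrans c0 c ?y)) (at ?y)"
    by (rule has_derivative_transform_within_open[OF 1 open_overlap[OF c0(1) c(1)]]) (use c c0 in auto)
  then have fd: "frechet_derivative (f \<circ> cinv c0) (at ?y) = (d \<circ> dtrans c0 c ?y)" "bounded_linear (d \<circ> dtrans c0 c ?y)"
    by (rule frechet_derivative_at[symmetric], rule has_derivative_bounded_linear)
  have "\<forall>w. g p (gradient A g f p) w = frechet_derivative (f \<circ> cinv c0) (at ?y) w"
    unfolding gradient_def c0_def[symmetric] fd(1)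
    using theI'[OF g_represents[of p "Blinfun (d \<circ> dtrans c0 c ?y)"]]
    by (simp add: bounded_linear_Blinfun_apply[OF fd(2)])
  then show ?thesis by (simp add: fd(1) components_eq_dtrans flip: c0_def)
qed

section \<open>The metric in charts\<close>

lemma metric_components_apply:
  assumes c: "c \<in> A" "p \<in> cdom c"
  shows "metric_components A g c (cmap c p) u = g p (from_components A c p u) o\<^sub>L from_components A c p"
proof -
  have "bounded_linear (\<lambda>u. g p (from_components A c p u) o\<^sub>L from_components A c p)"
    by (intro bounded_linear_intros)
  then show ?thesis
    unfolding metric_components_def using c by (simp add: bounded_linear_Blinfun_apply)
qed

lemma metric_components_components:
  assumes c: "c \<in> A" "p \<in> cdom c"
  shows "metric_components A g c (cmap c p) (components A c p u) (components A c p v) = g p u v"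
  using c by (simp add: metric_components_apply)

lemma metric_components_bounded_below:
  assumes c: "c \<in> A" "p \<in> cdom c"
  obtains B where "\<And>u. norm u \<le> B * norm (metric_components A g c (cmap c p) u)"
proof -
  let ?P = "components A c p" and ?F = "from_components A c p" and ?G = "metric_components A g c (cmap c p)"
  obtain B where B: "B > 0" "\<And>v. norm v \<le> B * norm (g p v)" using g_bounded_below by blast
  have "norm u \<le> (norm ?P * B * norm ?P) * norm (?G u)" for u
  proof -
    have "norm u = norm (?P (?F u))" using c by simp
    also have "\<dots> \<le> norm ?P * norm (?F u)" by (rule norm_blinfun)
    also have "\<dots> \<le> norm ?P * (B * norm (g p (?F u)))" by (intro mult_left_mono B) simp
    also have "g p (?F u) = ?G u o\<^sub>L ?P" using c by (intro blinfun_eqI) (simp add: metric_components_apply)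
    also have "norm ?P * (B * norm (?G u o\<^sub>L ?P)) \<le> norm ?P * (B * (norm (?G u) * norm ?P))"
      using B by (intro mult_left_mono norm_blinfun_compose) auto
    finally show ?thesis by (simp add: mult_ac)
  qed
  then show thesis using that by blast
qed

text \<open>
  The constant \<open>k\<close> can be chosen uniformly on a chart ball because the components of the metric are
  continuous in the operator norm. This is the comparison between Riemannian length and the norm of
  the model space used below.
\<close>
lemma metric_components_coercive_near:
  assumes c: "c \<in> A" "p \<in> cdom c"
  obtains k r where "k > 0" "r > 0" "ball (cmap c p) r \<subseteq> cimg c"
    "\<And>q u. q \<in> cdom c \<Longrightarrow> cmap c q \<in> ball (cmap c p) r \<Longrightarrow> k * norm (components A c q u) \<le> gnorm g q u"
proof -
  let ?P = "components A c p" and ?F = "from_components A c p" and ?G = "metric_components A g c"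
  let ?x = "cmap c p"
  obtain C where C: "C > 0" "\<And>v. norm v \<le> C * gnorm g p v" using gnorm_coercive by blast
  define K where "K = (norm ?P + 1) * C"
  have K: "K > 0" unfolding K_def using C by (simp add: add_nonneg_pos)
  \<comment> \<open>The pointwise bound, squared so that it can be perturbed additively.\<close>
  have low: "(norm u)\<^sup>2 \<le> K\<^sup>2 * ?G ?x u u" for u
  proof -
    have "norm u = norm (?P (?F u))" using c by simp
    also have "\<dots> \<le> norm ?P * norm (?F u)" by (rule norm_blinfun)
    also have "\<dots> \<le> (norm ?P + 1) * (C * gnorm g p (?F u))" by (intro mult_mono C) auto
    finally have "(norm u)\<^sup>2 \<le> (K * gnorm g p (?F u))\<^sup>2" unfolding K_def by (intro power_mono) (auto simp: mult.assoc)
    also have "\<dots> = K\<^sup>2 * ?G ?x u u" using c by (simp add: power_mult_distrib gnorm_sq metric_components_apply)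
    finally show ?thesis .
  qed
  have x: "?x \<in> cimg c" using c by simp
  have "isCont ?G ?x"
    using lipschitz_near_isCont[OF smooth_on_lipschitz_near[OF open_cimg[OF c(1)] metric_components_smooth[OF c(1)] x]] .
  moreover have "0 < 1 / (2 * K\<^sup>2)" using K by simp
  ultimately have "\<exists>s>0. \<forall>y. dist y ?x < s \<longrightarrow> dist (?G y) (?G ?x) < 1 / (2 * K\<^sup>2)"
    unfolding continuous_at_eps_delta by blast
  then obtain s where s: "s > 0" "\<And>y. dist y ?x < s \<Longrightarrow> dist (?G y) (?G ?x) < 1 / (2 * K\<^sup>2)" by blast
  obtain e where e: "e > 0" "ball ?x e \<subseteq> cimg c" using open_cimg[OF c(1)] x openE by blast
  have "(1 / (2 * K)) * norm (components A c q w) \<le> gnorm g q w"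
    if q: "q \<in> cdom c" "cmap c q \<in> ball ?x (min s e)" for q w
  proof -
    define u where "u = components A c q w"
    let ?y = "cmap c q"
    have "dist (?G ?x) (?G ?y) \<le> 1 / (2 * K\<^sup>2)" using s(2)[of ?y] q by (simp add: dist_commute)
    then have n: "norm (?G ?x - ?G ?y) \<le> 1 / (2 * K\<^sup>2)" by (simp add: dist_norm)
    have "?G ?x u u = ?G ?y u u + (?G ?x - ?G ?y) u u" by (simp add: blinfun.bilinear_simps)
    also have "(?G ?x - ?G ?y) u u \<le> norm ((?G ?x - ?G ?y) u) * norm u"
      using norm_blinfun[of "(?G ?x - ?G ?y) u" u] by simp
    also have "\<dots> \<le> norm (?G ?x - ?G ?y) * norm u * norm u" by (intro mult_right_mono norm_blinfun) simp
    also have "\<dots> \<le> 1 / (2 * K\<^sup>2) * norm u * norm u" by (intro mult_right_mono n) auto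
    finally have "K\<^sup>2 * ?G ?x u u \<le> K\<^sup>2 * (?G ?y u u + 1 / (2 * K\<^sup>2) * norm u * norm u)"
      by (intro mult_left_mono) auto
    with low[of u] have "(norm u)\<^sup>2 \<le> K\<^sup>2 * ?G ?y u u + (norm u)\<^sup>2 / 2"
      using K by (simp add: distrib_left power2_eq_square)
    then have "(norm u)\<^sup>2 \<le> 2 * K\<^sup>2 * ?G ?y u u" by simp
    also have "\<dots> = 2 * K\<^sup>2 * (gnorm g q w)\<^sup>2"
      using c q by (simp add: u_def metric_components_components gnorm_sq)
    also have "\<dots> \<le> (2 * K * gnorm g q w)\<^sup>2" by (simp add: power_mult_distrib)
    finally have "norm u \<le> 2 * K * gnorm g q w"
      by (rule power2_le_imp_le) (use K in simp)
    then show ?thesis using K by (simp add: u_def field_simps)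
  qed
  moreover have "1 / (2 * K) > 0" "min s e > 0" "ball ?x (min s e) \<subseteq> cimg c" using K s e by auto
  ultimately show thesis using that by blast
qed

end

section \<open>Derivatives of kinetic and potential energy\<close>

locale levi_civita = riemannian +
  fixes \<Gamma> :: "('a, 'b) chart \<Rightarrow> 'b \<Rightarrow> 'b \<Rightarrow>\<^sub>L 'b \<Rightarrow>\<^sub>L 'b"
  assumes levi_civita: "levi_civita_connection A g \<Gamma>"
begin

lemma linear_connection: "linear_connection A \<Gamma>"
  using levi_civita unfolding levi_civita_connection_def by blast

text \<open>
  Parallelism of the metric turns the derivative of its components into Christoffel symbols, and the
  symmetry of \<open>g\<close> collects all terms into the covariant derivative of the velocity.
\<close>
lemma kinetic_energy_derivative:
  assumes jet: "chart_jet c \<gamma> t v a"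
  shows "((\<lambda>s. g (\<gamma> s) (velocity A \<gamma> s) (velocity A \<gamma> s)) has_real_derivative
    2 * g (\<gamma> t) (covariant_derivative A \<Gamma> \<gamma> (velocity A \<gamma>) t) (velocity A \<gamma> t)) (at t)"
proof -
  note c = chart_jetD(1,2)[OF jet]
  let ?G = "metric_components A g c" and ?x = "cmap c (\<gamma> t)"
  have x: "?x \<in> cimg c" using c by simp
  obtain D where D: "(?G has_derivative blinfun_apply D) (at ?x)"
    using smooth_on_derivative[OF open_cimg[OF c(1)] metric_components_smooth[OF c(1)]] x by blast
  have "((\<lambda>y. ?G y u w) has_derivative (\<lambda>h. D h u w)) (at ?x)" for u w
    by (auto intro!: derivative_eq_intros D)
  then have fd: "frechet_derivative (\<lambda>y. ?G y u w) (at ?x) = (\<lambda>h. D h u w)" for u w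
    by (rule frechet_derivative_at[symmetric])
  have par: "D h u w = ?G ?x (\<Gamma> c ?x h u) w + ?G ?x u (\<Gamma> c ?x h w)" for h u w
    using levi_civita[unfolded levi_civita_connection_def, THEN conjunct2, THEN conjunct2, rule_format,
        OF c(1) x, of u w h] unfolding fd .
  have "((\<lambda>s. ?G (cmap c (\<gamma> s))) has_vector_derivative D (v t)) (at t)"
    using vector_derivative_diff_chain_within[OF chart_jetD(4)[OF jet], of ?G D] D
    by (simp add: has_derivative_at_withinI o_def)
  from bounded_bilinear.has_vector_derivative[OF bounded_bilinear_blinfun_apply this chart_jetD(5)[OF jet]]
  have "((\<lambda>s. ?G (cmap c (\<gamma> s)) (v s)) has_vector_derivative (?G ?x a + D (v t) (v t))) (at t)" .
  from bounded_bilinear.has_vector_derivative[OF bounded_bilinear_blinfun_apply this chart_jetD(5)[OF jet]]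
  have 1: "((\<lambda>s. ?G (cmap c (\<gamma> s)) (v s) (v s)) has_vector_derivative
      (?G ?x (v t) a + (?G ?x a + D (v t) (v t)) (v t))) (at t)" .
  have "\<forall>\<^sub>F s in nhds t. ?G (cmap c (\<gamma> s)) (v s) (v s) = g (\<gamma> s) (velocity A \<gamma> s) (velocity A \<gamma> s)"
    using jet[unfolded chart_jet_def, THEN conjunct2, THEN conjunct1]
  proof eventually_elim
    case (elim s)
    then have "components A c (\<gamma> s) (velocity A \<gamma> s) = v s" using c by (intro velocity_components) auto
    then show ?case using metric_components_components[OF c(1), of "\<gamma> s" "velocity A \<gamma> s" "velocity A \<gamma> s"] elim by simp
  qed
  then obtain W where W: "open W" "t \<in> W"
    "\<And>s. s \<in> W \<Longrightarrow> ?G (cmap c (\<gamma> s)) (v s) (v s) = g (\<gamma> s) (velocity A \<gamma> s) (velocity A \<gamma> s)"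
    unfolding eventually_nhds by blast
  have 2: "((\<lambda>s. g (\<gamma> s) (velocity A \<gamma> s) (velocity A \<gamma> s)) has_vector_derivative
      (?G ?x (v t) a + (?G ?x a + D (v t) (v t)) (v t))) (at t)"
    by (rule has_vector_derivative_transform_within_open[OF 1 W])
  let ?cov = "covariant_derivative A \<Gamma> \<gamma> (velocity A \<gamma>) t"
  have Gsym: "?G ?x u w = ?G ?x w u" for u w using c by (simp add: metric_components_apply g_sym)
  have "g (\<gamma> t) ?cov (velocity A \<gamma> t) = ?G ?x (a + \<Gamma> c ?x (v t) (v t)) (v t)"
    using metric_components_components[OF c, of ?cov "velocity A \<gamma> t"]
      covariant_derivative_components[OF linear_connection jet] velocity_components_jet[OF jet] by simp
  then have "?G ?x (v t) a + (?G ?x a + D (v t) (v t)) (v t) = 2 * g (\<gamma> t) ?cov (velocity A \<gamma> t)"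
    by (simp add: par blinfun.bilinear_simps Gsym[of "v t"])
  with 2 show ?thesis by (simp add: has_real_derivative_iff_has_vector_derivative)
qed

text \<open>
  In a chart, \<open>V\<close> is a smooth function on a product, and its derivative in the direction
  \<open>(v, 1)\<close> splits into the differential of \<open>V(\<cdot>, t)\<close> and the time derivative.
\<close>
lemma potential_derivative:
  assumes V: "smooth_function A V" and jet: "chart_jet c \<gamma> t v a"
  shows "((\<lambda>s. V (\<gamma> s) s) has_real_derivative
    g (\<gamma> t) (gradient A g (\<lambda>q. V q t) (\<gamma> t)) (velocity A \<gamma> t) + deriv (V (\<gamma> t)) t) (at t)"
proof -
  note c = chart_jetD(1,2)[OF jet]
  let ?x = "cmap c (\<gamma> t)" and ?U = "cimg c \<times> (UNIV :: real set)" and ?W = "\<lambda>(x, t). V (cinv c x) t"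
  have U: "open ?U" "(?x, t) \<in> ?U" using c open_cimg by (auto intro: open_Times)
  have "smooth_on ?U ?W" using V c unfolding smooth_function_def by blast
  then obtain D where D: "(?W has_derivative blinfun_apply D) (at (?x, t))"
    using smooth_on_derivative[OF U(1)] U(2) by blast
  have "((\<lambda>x. (x, t)) has_derivative (\<lambda>h. (h, 0))) (at ?x)"
    by (auto intro!: derivative_eq_intros)
  from diff_chain_at[OF this D]
  have "(((\<lambda>q. V q t) \<circ> cinv c) has_derivative (\<lambda>h. D (h, 0))) (at ?x)" by (simp add: o_def)
  from gradient[OF c this, of "velocity A \<gamma> t"]
  have grad: "g (\<gamma> t) (gradient A g (\<lambda>q. V q t) (\<gamma> t)) (velocity A \<gamma> t) = D (v t, 0)"
    by (simp add: velocity_components_jet[OF jet])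
  have "((\<lambda>s. (?x, s)) has_derivative (\<lambda>h. (0, h))) (at t)"
    by (auto intro!: derivative_eq_intros)
  from diff_chain_at[OF this D] c
  have "(V (\<gamma> t) has_derivative (\<lambda>h. D (0, h))) (at t)" by (simp add: o_def)
  moreover have "(\<lambda>h. D (0, h)) = (*) (D (0, 1))"
  proof (rule ext)
    fix h :: real
    have "D (h *\<^sub>R (0, 1)) = h *\<^sub>R D (0, 1)" by (rule blinfun.scaleR_right)
    then have "D (0, h) = h *\<^sub>R D (0, 1)" by (simp only: scaleR_Pair scaleR_zero_right real_scaleR_def mult_1_right)
    then show "D (0, h) = D (0, 1) * h" by (simp only: real_scaleR_def mult.commute)
  qed
  ultimately have "(V (\<gamma> t) has_real_derivative D (0, 1)) (at t)" by (simp only: has_field_derivative_def)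
  then have der: "deriv (V (\<gamma> t)) t = D (0, 1)" by (rule DERIV_imp_deriv)
  have "((\<lambda>s. (cmap c (\<gamma> s), s)) has_vector_derivative (v t, 1)) (at t)"
    using has_vector_derivative_Pair[OF chart_jetD(4)[OF jet] has_vector_derivative_id] by (simp add: o_def)
  from vector_derivative_diff_chain_within[OF this, of ?W D] D
  have 1: "((\<lambda>s. V (cinv c (cmap c (\<gamma> s))) s) has_vector_derivative D (v t, 1)) (at t)"
    by (simp add: has_derivative_at_withinI o_def)
  have "\<forall>\<^sub>F s in nhds t. V (cinv c (cmap c (\<gamma> s))) s = V (\<gamma> s) s"
    using jet[unfolded chart_jet_def, THEN conjunct2, THEN conjunct1]
    by eventually_elim (use c in simp)
  then obtain W where W: "open W" "t \<in> W" "\<And>s. s \<in> W \<Longrightarrow> V (cinv c (cmap c (\<gamma> s))) s = V (\<gamma> s) s"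
    unfolding eventually_nhds by blast
  have "((\<lambda>s. V (\<gamma> s) s) has_vector_derivative D (v t, 1)) (at t)"
    by (rule has_vector_derivative_transform_within_open[OF 1 W])
  moreover have "D (v t, 1) = D (v t, 0) + D (0, 1)"
    using blinfun.add_right[of D "(v t, 0)" "(0, 1)"] by simp
  ultimately show ?thesis by (simp add: grad der has_real_derivative_iff_has_vector_derivative)
qed

end

section \<open>Length of curves and the distance\<close>

context riemannian
begin

abbreviation speed :: "(real \<Rightarrow> 'a) \<Rightarrow> real \<Rightarrow> real" where
  "speed \<gamma> t \<equiv> gnorm g (\<gamma> t) (velocity A \<gamma> t)"

text \<open>
  The integral of a non-integrable function is 0 by convention, so lengths are meaningful only
  together with this fact. The two-sided derivative in \<open>velocity\<close> is arbitrary at the end points;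
  the one-sided speed is continuous on the closed interval and agrees with it inside.
\<close>
lemma speed_integrable_on_C1_piece:
  assumes \<gamma>: "C1_curve_on A {u..v} \<gamma>"
  shows "speed \<gamma> integrable_on {u..v}"
proof (cases "u < v")
  case False
  then show ?thesis using integrable_on_refl[of "speed \<gamma>" v] by (cases "u = v") auto
next
  case uv: True
  define X where "X t = vector_derivative (cmap (chart_at A (\<gamma> t)) \<circ> \<gamma>) (at t within {u..v})" for t
  have cont: "continuous_on {u..v} \<gamma>" using \<gamma> unfolding C1_curve_on_def by blast
  have "continuous (at t within {u..v}) (\<lambda>t. gnorm g (\<gamma> t) (X t))" if t: "t \<in> {u..v}" for t
  proof -
    define c where "c = chart_at A (\<gamma> t)"
    have c: "c \<in> A" "\<gamma> t \<in> cdom c" by (simp_all add: c_def chart_at)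
    let ?D = "{u..v} \<inter> \<gamma> -` cdom c"
    obtain w where w: "continuous_on ?D w"
      "\<And>s. s \<in> ?D \<Longrightarrow> ((cmap c \<circ> \<gamma>) has_vector_derivative w s) (at s within {u..v})"
      using \<gamma> c(1) unfolding C1_curve_on_def by blast
    have tD: "t \<in> ?D" using t c by simp
    have ev: "\<forall>\<^sub>F s in at t within {u..v}. s \<in> ?D"
    proof -
      have "\<forall>\<^sub>F s in at t within {u..v}. \<gamma> s \<in> cdom c"
        using cont t by (intro topological_tendstoD[OF _ open_cdom[OF c(1)] c(2)]) (simp add: continuous_on_def)
      moreover have "\<forall>\<^sub>F s in at t within {u..v}. s \<in> {u..v}" by (simp add: eventually_at_filter)
      ultimately show ?thesis by eventually_elim auto
    qed
    have eq: "gnorm g (\<gamma> s) (X s) = sqrt (metric_components A g c (cmap c (\<gamma> s)) (w s) (w s))" if s: "s \<in> ?D" for s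
    proof -
      let ?c = "chart_at A (\<gamma> s)"
      have s': "\<gamma> s \<in> cdom c" "s \<in> {u..v}" using s by auto
      have "continuous (at s within {u..v}) \<gamma>" using cont s' by (simp add: continuous_on_eq_continuous_within)
      from chart_change_vector_derivative[OF c(1) chart_at(1) s'(1) chart_at(2) s'(2) this w(2)[OF s]]
      have "((cmap ?c \<circ> \<gamma>) has_vector_derivative dtrans c ?c (cmap c (\<gamma> s)) (w s)) (at s within {u..v})" .
      then have "X s = dtrans c ?c (cmap c (\<gamma> s)) (w s)"
        unfolding X_def using uv s'(2) by (intro vector_derivative_within_cbox[of u v, simplified]) auto
      then have "components A c (\<gamma> s) (X s) = w s"
        unfolding components_eq_dtrans using c s' by (simp add: dtrans_inverse chart_at)
      then show ?thesis using metric_components_components[OF c(1) s'(1), of "X s" "X s"] by (simp add: gnorm_def)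
    qed
    have cw: "(w \<longlongrightarrow> w t) (at t within {u..v})"
    proof -
      have "(w \<longlongrightarrow> w t) (at t within ?D)" using w(1) tD by (simp add: continuous_on_def)
      then show ?thesis
      proof (intro topological_tendstoI)
        fix S assume "open S" "w t \<in> S"
        with \<open>(w \<longlongrightarrow> w t) (at t within ?D)\<close> have "\<forall>\<^sub>F s in at t within ?D. w s \<in> S"
          by (rule topological_tendstoD)
        with ev show "\<forall>\<^sub>F s in at t within {u..v}. w s \<in> S"
          unfolding eventually_at_filter by eventually_elim blast
      qed
    qed
    have cx: "((\<lambda>s. cmap c (\<gamma> s)) \<longlongrightarrow> cmap c (\<gamma> t)) (at t within {u..v})"
      using cont t by (intro isCont_tendsto_compose[OF isCont_cmap[OF c]]) (simp add: continuous_on_def)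
    have "isCont (metric_components A g c) (cmap c (\<gamma> t))"
      by (rule lipschitz_near_isCont[OF smooth_on_lipschitz_near[OF open_cimg[OF c(1)] metric_components_smooth[OF c(1)]]])
        (use c in simp)
    from isCont_tendsto_compose[OF this cx]
    have "((\<lambda>s. metric_components A g c (cmap c (\<gamma> s)) (w s) (w s)) \<longlongrightarrow>
        metric_components A g c (cmap c (\<gamma> t)) (w t) (w t)) (at t within {u..v})"
      by (intro tendsto_intros cw)
    then have "((\<lambda>s. sqrt (metric_components A g c (cmap c (\<gamma> s)) (w s) (w s))) \<longlongrightarrow> gnorm g (\<gamma> t) (X t)) (at t within {u..v})"
      unfolding eq[OF tD] by (rule tendsto_real_sqrt)
    moreover have "\<forall>\<^sub>F s in at t within {u..v}. sqrt (metric_components A g c (cmap c (\<gamma> s)) (w s) (w s)) = gnorm g (\<gamma> s) (X s)"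
      using ev by eventually_elim (rule eq[symmetric])
    ultimately show ?thesis unfolding continuous_within by (rule Lim_transform_eventually)
  qed
  then have "(\<lambda>t. gnorm g (\<gamma> t) (X t)) integrable_on {u..v}"
    by (intro integrable_continuous_real) (simp add: continuous_on_eq_continuous_within)
  moreover have "speed \<gamma> t = gnorm g (\<gamma> t) (X t)" if "t \<in> {u..v} - {u, v}" for t
  proof -
    have "u < t" "t < v" using that by auto
    from at_within_Icc_at[OF this] show ?thesis by (simp add: X_def velocity_def)
  qed
  ultimately show ?thesis
    using integrable_spike_finite[of "{u, v}" "{u..v}" "speed \<gamma>" "\<lambda>t. gnorm g (\<gamma> t) (X t)"] by blast
qed

text \<open>
  Integrability is a local property of the interval, and near each of its points at most one break
  point occurs.
\<close>
lemma speed_integrable: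
  assumes \<gamma>: "piecewise_C1_curve A a b \<gamma>"
  shows "speed \<gamma> integrable_on {a..b}"
proof -
  obtain F where F: "finite F" "\<And>u v. a \<le> u \<Longrightarrow> u < v \<Longrightarrow> v \<le> b \<Longrightarrow> {u<..<v} \<inter> F = {} \<Longrightarrow> C1_curve_on A {u..v} \<gamma>"
    using \<gamma> unfolding piecewise_C1_curve_def by blast
  have piece: "speed \<gamma> integrable_on {u..v}" if "a \<le> u" "u \<le> v" "v \<le> b" "{u<..<v} \<inter> F = {}" for u v
  proof (cases "u = v")
    case True
    then show ?thesis using integrable_on_refl[of "speed \<gamma>" u] by simp
  next
    case False
    then show ?thesis using speed_integrable_on_C1_piece[OF F(2)[of u v]] that by simp
  qed
  have "speed \<gamma> integrable_on cbox a b"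
  proof (rule integrable_on_little_subintervals, rule ballI)
    fix x assume x: "x \<in> cbox a b"
    obtain d where d: "d > 0" "\<And>y. y \<in> F \<Longrightarrow> y \<noteq> x \<Longrightarrow> d \<le> dist x y"
      using finite_set_avoid[OF F(1), of x] by blast
    have "speed \<gamma> integrable_on cbox u v"
      if uv: "x \<in> cbox u v" "cbox u v \<subseteq> ball x d" "cbox u v \<subseteq> cbox a b" for u v
    proof -
      have le: "u \<le> x" "x \<le> v" "a \<le> u" "v \<le> b" using uv x by auto
      have only_x: "{u<..<v} \<inter> F \<subseteq> {x}"
      proof
        fix y assume y: "y \<in> {u<..<v} \<inter> F"
        then have "y \<in> cbox u v" by simp
        then have "y \<in> ball x d" by (rule subsetD[OF uv(2)])
        then show "y \<in> {x}" using d(2)[of y] y by force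
      qed
      have "{u<..<x} \<subseteq> {u<..<v} - {x}" "{x<..<v} \<subseteq> {u<..<v} - {x}" using le by auto
      then have "{u<..<x} \<inter> F = {}" "{x<..<v} \<inter> F = {}" using only_x by blast+
      then have "speed \<gamma> integrable_on {u..x}" "speed \<gamma> integrable_on {x..v}"
        using piece[of u x] piece[of x v] le by auto
      then show ?thesis
        using Henstock_Kurzweil_Integration.integrable_combine[OF le(1,2)] by simp
    qed
    then show "\<exists>d>0. \<forall>u v. x \<in> cbox u v \<and> cbox u v \<subseteq> ball x d \<and> cbox u v \<subseteq> cbox a b \<longrightarrow>
        speed \<gamma> integrable_on cbox u v" using d(1) by blast
  qed
  then show ?thesis by simp
qed

lemma chart_displacement_le_length:
  assumes \<gamma>: "piecewise_C1_curve A a b \<gamma>" and st: "a \<le> s" "s \<le> t" "t \<le> b" and c: "c \<in> A" and k: "k > 0"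
    and B: "\<And>\<tau>. \<tau> \<in> {s..t} \<Longrightarrow> \<gamma> \<tau> \<in> cdom c"
      "\<And>\<tau> u. \<tau> \<in> {s..t} \<Longrightarrow> k * norm (components A c (\<gamma> \<tau>) u) \<le> gnorm g (\<gamma> \<tau>) u"
  shows "k * norm (cmap c (\<gamma> t) - cmap c (\<gamma> s)) \<le> integral {s..t} (speed \<gamma>)"
proof -
  obtain F where F: "finite F" "\<And>u v. a \<le> u \<Longrightarrow> u < v \<Longrightarrow> v \<le> b \<Longrightarrow> {u<..<v} \<inter> F = {} \<Longrightarrow> C1_curve_on A {u..v} \<gamma>"
    and cont: "continuous_on {a..b} \<gamma>"
    using \<gamma> unfolding piecewise_C1_curve_def by blast
  have cont': "continuous_on {s..t} (\<lambda>\<tau>. cmap c (\<gamma> \<tau>))"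
  proof (rule continuous_on_compose2[OF homeomorphism_cont1[OF chart_homeomorphism[OF c]]])
    show "continuous_on {s..t} \<gamma>" using continuous_on_subset[OF cont] st by auto
  qed (use B in auto)
  define w where "w \<tau> = components A c (\<gamma> \<tau>) (velocity A \<gamma> \<tau>)" for \<tau>
  have der: "((\<lambda>\<tau>. cmap c (\<gamma> \<tau>)) has_vector_derivative w \<tau>) (at \<tau>)" if \<tau>: "\<tau> \<in> {s<..<t} - F" for \<tau>
  proof -
    have "open ({s<..<t} - F)" using F(1) by (intro open_Diff finite_imp_closed) auto
    then obtain d where d: "d > 0" "cball \<tau> d \<subseteq> {s<..<t} - F" using \<tau> open_contains_cball by blast
    have sub: "{\<tau> - d..\<tau> + d} \<subseteq> {s<..<t} - F" using d(2) by (simp add: cball_eq_atLeastAtMost)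
    have "{\<tau> - d<..<\<tau> + d} \<subseteq> {\<tau> - d..\<tau> + d}" by auto
    then have "{\<tau> - d<..<\<tau> + d} \<inter> F = {}" using sub by blast
    moreover have "\<tau> - d \<in> {\<tau> - d..\<tau> + d}" "\<tau> + d \<in> {\<tau> - d..\<tau> + d}" using d(1) by simp_all
    then have "\<tau> - d \<in> {s<..<t}" "\<tau> + d \<in> {s<..<t}" using sub by blast+
    ultimately have "C1_curve_on A {\<tau> - d..\<tau> + d} \<gamma>" using d(1) st by (intro F(2)) auto
    then obtain v where v_all: "\<forall>t \<in> {\<tau> - d..\<tau> + d} \<inter> \<gamma> -` cdom c. ((cmap c \<circ> \<gamma>) has_vector_derivative v t) (at t within {\<tau> - d..\<tau> + d})"
      using c unfolding C1_curve_on_def by blast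
    have "\<tau> \<in> {\<tau> - d..\<tau> + d} \<inter> \<gamma> -` cdom c" using B(1)[of \<tau>] \<tau> d(1) by simp
    moreover have "at \<tau> within {\<tau> - d..\<tau> + d} = at \<tau>" using d(1) by (intro at_within_Icc_at) auto
    ultimately have v: "((cmap c \<circ> \<gamma>) has_vector_derivative v \<tau>) (at \<tau>)" using v_all by metis
    have "isCont \<gamma> \<tau>" using cont \<tau> st by (intro continuous_on_interior[of "{a..b}"]) auto
    then have "w \<tau> = v \<tau>" unfolding w_def using v B(1)[of \<tau>] \<tau> c by (intro velocity_components) auto
    with v show ?thesis by (simp add: o_def)
  qed
  have w: "(w has_integral (cmap c (\<gamma> t) - cmap c (\<gamma> s))) {s..t}"
    by (rule fundamental_theorem_of_calculus_interior_strong[OF F(1) st(2) der cont'])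
  have sp: "speed \<gamma> integrable_on {s..t}"
    by (rule integrable_on_subinterval[OF speed_integrable[OF \<gamma>]]) (use st in auto)
  have "norm (integral {s..t} w) \<le> integral {s..t} (\<lambda>\<tau>. (1 / k) * speed \<gamma> \<tau>)"
  proof (rule integral_norm_bound_integral)
    show "w integrable_on {s..t}" using w by blast
    show "(\<lambda>\<tau>. (1 / k) * speed \<gamma> \<tau>) integrable_on {s..t}"
      by (rule integrable_on_mult_right[OF sp])
    show "norm (w \<tau>) \<le> (1 / k) * speed \<gamma> \<tau>" if "\<tau> \<in> {s..t}" for \<tau>
      using B(2)[OF that, of "velocity A \<gamma> \<tau>"] k by (simp add: w_def field_simps)
  qed
  then show ?thesis using k integral_unique[OF w] by (simp add: field_simps)
qed

lemma curve_length_nonneg: "curve_length A g a b \<gamma> \<ge> 0"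
proof (cases "speed \<gamma> integrable_on {a..b}")
  case True
  then show ?thesis unfolding curve_length_def by (rule integral_nonneg) simp
qed (simp add: curve_length_def not_integrable_integral)

text \<open>
  Let \<open>T\<close> be the supremum of the times up to which the curve stays in the chart ball. Its coordinate
  displacement before \<open>T\<close> is at most \<open>length / k < r\<close>, and the coordinates are a Cauchy family as
  the time tends to \<open>T\<close>. They converge in the model space to a point of the open ball, and this point
  represents \<open>\<gamma> T\<close> because \<open>M\<close> is Hausdorff. So \<open>\<gamma> T\<close> is in the ball, and \<open>T\<close> is the end of
  the interval because the ball is open.
\<close>
lemma short_curve_in_chart_ball:
  assumes c: "c \<in> A" "p \<in> cdom c" and k: "k > 0"
    and r: "ball (cmap c p) r \<subseteq> cimg c"
    and coercive: "\<And>q u. q \<in> cdom c \<Longrightarrow> cmap c q \<in> ball (cmap c p) r \<Longrightarrow> k * norm (components A c q u) \<le> gnorm g q u"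
    and \<gamma>: "piecewise_C1_curve A a b \<gamma>" "a \<le> b" "\<gamma> a = p"
    and len: "curve_length A g a b \<gamma> < k * r"
  shows "\<gamma> b \<in> cdom c" "cmap c (\<gamma> b) \<in> ball (cmap c p) r"
proof -
  let ?x = "cmap c p" and ?L = "curve_length A g a b \<gamma>"
  define B where "B = cinv c ` ball ?x r"
  have B: "open B" unfolding B_def by (rule open_cinv_image[OF c(1) open_ball r])
  have B_iff: "q \<in> B \<longleftrightarrow> q \<in> cdom c \<and> cmap c q \<in> ball ?x r" for q
  proof
    assume "q \<in> B"
    then obtain y where "y \<in> ball ?x r" "q = cinv c y" unfolding B_def by blast
    then show "q \<in> cdom c \<and> cmap c q \<in> ball ?x r" using r c cinv_in_cdom by (metis cmap_cinv subsetD)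
  next
    assume "q \<in> cdom c \<and> cmap c q \<in> ball ?x r"
    then show "q \<in> B" unfolding B_def using c by (metis cinv_cmap imageI)
  qed
  have cont: "continuous_on {a..b} \<gamma>" using \<gamma>(1) unfolding piecewise_C1_curve_def by blast
  have "0 \<le> ?L" by (rule curve_length_nonneg)
  then have "r > 0" using len k by (metis le_less_trans zero_less_mult_pos)
  have int: "speed \<gamma> integrable_on {s..t}" if "a \<le> s" "t \<le> b" for s t
    by (rule integrable_on_subinterval[OF speed_integrable[OF \<gamma>(1)]]) (use that in auto)
  define \<phi> where "\<phi> t = integral {a..t} (speed \<gamma>)" for t
  have \<phi>_diff: "integral {s..t} (speed \<gamma>) = \<phi> t - \<phi> s" if "a \<le> s" "s \<le> t" "t \<le> b" for s t
    using Henstock_Kurzweil_Integration.integral_combine[OF that(1,2) int[of a t]] that unfolding \<phi>_def by simp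
  have \<phi>_cont: "continuous_on {a..b} \<phi>"
    unfolding \<phi>_def by (rule indefinite_integral_continuous_1[OF int]) auto
  define S where "S = {t \<in> {a..b}. \<forall>s\<in>{a..t}. \<gamma> s \<in> B}"
  have step: "k * norm (cmap c (\<gamma> t) - cmap c (\<gamma> s)) \<le> \<phi> t - \<phi> s" if "t \<in> S" "a \<le> s" "s \<le> t" for s t
  proof -
    have "\<gamma> \<tau> \<in> B" if "\<tau> \<in> {s..t}" for \<tau> using that \<open>t \<in> S\<close> \<open>a \<le> s\<close> unfolding S_def by auto
    moreover have "t \<le> b" using \<open>t \<in> S\<close> unfolding S_def by auto
    ultimately show ?thesis
      unfolding \<phi>_diff[OF that(2,3) \<open>t \<le> b\<close>, symmetric]
      by (intro chart_displacement_le_length[OF \<gamma>(1) that(2,3) _ c(1) k] coercive) (auto simp: B_iff)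
  qed
  have a: "a \<in> S" unfolding S_def using \<gamma> c \<open>r > 0\<close> by (auto simp: B_iff)
  have bdd: "bdd_above S" unfolding S_def by (rule bdd_aboveI[of _ b]) auto
  define T where "T = Sup S"
  have T: "a \<le> T" "T \<le> b"
  proof -
    show "a \<le> T" unfolding T_def by (rule cSup_upper[OF a bdd])
    have "S \<noteq> {}" using a by blast
    then show "T \<le> b" unfolding T_def by (rule cSup_least) (simp add: S_def)
  qed
  have below: "t \<in> S" if t: "a \<le> t" "t < T" for t
  proof -
    obtain t' where "t' \<in> S" "t < t'" using t(2) less_cSupD[of S t] a unfolding T_def by blast
    then show ?thesis using t unfolding S_def by auto
  qed
  have "\<gamma> T \<in> B"
  proof (cases "T = a")
    case True
    then show ?thesis using a unfolding S_def by auto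
  next
    case False
    then have aT: "a < T" using T by simp
    define \<tau> where "\<tau> n = T - (T - a) / real (n + 1)" for n
    have \<tau>: "a \<le> \<tau> n" "\<tau> n < T" for n
    proof -
      have "(T - a) / real (n + 1) \<le> (T - a) / 1" using aT by (intro divide_left_mono) auto
      moreover have "0 < (T - a) / real (n + 1)" using aT by simp
      ultimately show "a \<le> \<tau> n" "\<tau> n < T" unfolding \<tau>_def by simp_all
    qed
    have "(\<lambda>n. (T - a) / real (n + 1)) \<longlonglongrightarrow> 0"
      using LIMSEQ_ignore_initial_segment[OF lim_const_over_n[of "T - a"], of 1] by simp
    from tendsto_diff[OF tendsto_const[of T] this]
    have \<tau>_lim: "\<tau> \<longlonglongrightarrow> T" by (simp add: \<tau>_def[abs_def])
    have lim: "(\<lambda>n. f (\<tau> n)) \<longlonglongrightarrow> f T" if "continuous_on {a..b} f" for f :: "real \<Rightarrow> 'c::topological_space"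
      using T \<tau> by (intro continuous_on_tendsto_compose[OF that \<tau>_lim]) (auto simp: less_imp_le intro!: always_eventually order_trans[OF less_imp_le[OF \<tau>(2)]])
    let ?y = "\<lambda>n. cmap c (\<gamma> (\<tau> n))"
    have dist_le: "k * dist (?y m) (?y n) \<le> dist (\<phi> (\<tau> m)) (\<phi> (\<tau> n))" for m n
    proof (cases "\<tau> m \<le> \<tau> n")
      case True
      then show ?thesis using step[OF below[OF \<tau>[of n]] \<tau>(1)[of m]]
        by (simp add: dist_norm norm_minus_commute abs_minus_commute)
    next
      case False
      then show ?thesis using step[OF below[OF \<tau>[of m]] \<tau>(1)[of n]] by (simp add: dist_norm)
    qed
    have "Cauchy ?y"
    proof (rule metric_CauchyI)
      fix e :: real assume "e > 0"
      then have "k * e > 0" using k by simp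
      then obtain M where M: "\<And>m n. m \<ge> M \<Longrightarrow> n \<ge> M \<Longrightarrow> dist (\<phi> (\<tau> m)) (\<phi> (\<tau> n)) < k * e"
        using LIMSEQ_imp_Cauchy[OF lim[OF \<phi>_cont]] unfolding Cauchy_def by blast
      have "dist (?y m) (?y n) < e" if "m \<ge> M" "n \<ge> M" for m n
        using le_less_trans[OF dist_le M[OF that]] k by simp
      then show "\<exists>M. \<forall>m\<ge>M. \<forall>n\<ge>M. dist (?y m) (?y n) < e" by blast
    qed
    then obtain y where y: "?y \<longlonglongrightarrow> y" using Cauchy_convergent_iff convergent_def by blast
    have "norm (?y n - ?x) \<le> ?L / k" for n
    proof -
      have "k * norm (?y n - ?x) \<le> \<phi> (\<tau> n) - \<phi> a"
        using step[OF below[OF \<tau>[of n]], of a] \<tau>(1)[of n] \<gamma>(3) by simp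
      also have "\<dots> \<le> \<phi> b - \<phi> a"
      proof -
        have "0 \<le> integral {\<tau> n..b} (speed \<gamma>)"
          using \<tau>[of n] T by (intro integral_nonneg int) auto
        then show ?thesis using \<phi>_diff[of "\<tau> n" b] \<tau>[of n] T by simp
      qed
      also have "\<dots> = ?L" by (simp add: \<phi>_def curve_length_def)
      finally show ?thesis using k by (simp add: field_simps)
    qed
    then have "norm (y - ?x) \<le> ?L / k"
      by (intro LIMSEQ_le_const2[OF tendsto_norm[OF tendsto_diff[OF y tendsto_const]]]) auto
    also have "\<dots> < r" using len k by (simp add: field_simps)
    finally have yr: "y \<in> ball ?x r" by (simp add: dist_norm norm_minus_commute)
    then have "y \<in> cimg c" using r by blast
    from isCont_tendsto_compose[OF isCont_cinv[OF c(1) this] y]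
    have "(\<lambda>n. cinv c (?y n)) \<longlonglongrightarrow> cinv c y" .
    moreover have "cinv c (?y n) = \<gamma> (\<tau> n)" for n
    proof -
      have "\<gamma> (\<tau> n) \<in> B" using below[OF \<tau>[of n]] \<tau>(1)[of n] unfolding S_def by auto
      then show ?thesis using c by (simp add: B_iff)
    qed
    ultimately have "(\<lambda>n. \<gamma> (\<tau> n)) \<longlonglongrightarrow> cinv c y" by simp
    from LIMSEQ_unique[OF lim[OF cont] this] show ?thesis unfolding B_def using yr by auto
  qed
  have TS: "T \<in> S"
  proof -
    have "\<gamma> s \<in> B" if "s \<in> {a..T}" for s
    proof (cases "s = T")
      case False
      then have "s \<in> S" using that by (intro below) auto
      then show ?thesis using that unfolding S_def by auto
    qed (simp add: \<open>\<gamma> T \<in> B\<close>)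
    then show ?thesis using T unfolding S_def by auto
  qed
  have "T = b"
  proof (rule ccontr)
    assume "T \<noteq> b"
    then have Tb: "T < b" using T by simp
    have "\<forall>\<^sub>F s in at T within {a..b}. \<gamma> s \<in> B"
      using cont T by (intro topological_tendstoD[OF _ B \<open>\<gamma> T \<in> B\<close>]) (simp add: continuous_on_def)
    then obtain d where d: "d > 0" "\<And>s. s \<in> {a..b} \<Longrightarrow> s \<noteq> T \<Longrightarrow> dist s T < d \<Longrightarrow> \<gamma> s \<in> B"
      unfolding eventually_at by blast
    define T' where "T' = min b (T + d / 2)"
    have T': "T < T'" "T' \<le> b" "T' < T + d" using Tb d by (auto simp: T'_def)
    have "\<gamma> s \<in> B" if "s \<in> {a..T'}" for s
    proof (cases "s \<le> T")
      case True
      then show ?thesis using TS that unfolding S_def by auto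
    next
      case False
      then show ?thesis using that T' by (intro d(2)) (auto simp: dist_real_def)
    qed
    then have "T' \<in> S" using T T' unfolding S_def by auto
    then have "T' \<le> T" unfolding T_def using bdd by (rule cSup_upper)
    with T' show False by simp
  qed
  then have "\<gamma> b \<in> B" using \<open>\<gamma> T \<in> B\<close> by simp
  then show "\<gamma> b \<in> cdom c" "cmap c (\<gamma> b) \<in> ball ?x r" by (auto simp: B_iff)
qed

lemma rdist_le_length:
  assumes "a \<le> b" "piecewise_C1_curve A a b \<gamma>"
  shows "rdist A g (\<gamma> a) (\<gamma> b) \<le> curve_length A g a b \<gamma>"
  unfolding rdist_def
proof (rule cInf_lower)
  show "bdd_below {curve_length A g a' b' \<delta> |a' b' \<delta>. a' \<le> b' \<and> piecewise_C1_curve A a' b' \<delta> \<and> \<delta> a' = \<gamma> a \<and> \<delta> b' = \<gamma> b}"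
    using curve_length_nonneg by (intro bdd_belowI[of _ 0]) auto
qed (use assms in blast)

text \<open>
  Small distances are realised by short curves. Some care is needed for points joined by no curve,
  whose distance is the infimum of the empty set, an unspecified real number: were it not positive,
  the axioms of a metric would identify such points. If such points exist it is therefore positive, and
  \<open>\<delta>\<close> is taken equal to it.
\<close>
lemma rdist_less_curve:
  assumes M: "Metric_space UNIV (rdist A g)"
  obtains \<delta> where "\<delta> > 0" "\<And>p q e. rdist A g p q < e \<Longrightarrow> e \<le> \<delta> \<Longrightarrow>
    \<exists>a b \<gamma>. a \<le> b \<and> piecewise_C1_curve A a b \<gamma> \<and> \<gamma> a = p \<and> \<gamma> b = q \<and> curve_length A g a b \<gamma> < e"
proof -
  interpret Metric_space UNIV "rdist A g" by (rule M)
  define L where "L p q = {curve_length A g a b \<gamma> |a b \<gamma>. a \<le> b \<and> piecewise_C1_curve A a b \<gamma> \<and> \<gamma> a = p \<and> \<gamma> b = q}" for p q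
  have rd: "rdist A g p q = Inf (L p q)" for p q unfolding rdist_def L_def ..
  have "L p p \<noteq> {}" for p
  proof -
    have "piecewise_C1_curve A 0 0 (\<lambda>_. p)" unfolding piecewise_C1_curve_def by (auto intro!: exI[of _ "{}"])
    then have "curve_length A g 0 0 (\<lambda>_. p) \<in> L p p" unfolding L_def by blast
    then show ?thesis by blast
  qed
  define \<delta> :: real where "\<delta> = (if Inf {} \<le> (0::real) then 1 else Inf {})"
  have ne: "L p q \<noteq> {}" if "rdist A g p q < \<delta>" for p q
  proof
    assume "L p q = {}"
    then have r: "rdist A g p q = Inf {}" using rd by simp
    then have "Inf {} \<le> (0::real)" using that unfolding \<delta>_def by (auto split: if_splits)
    then have "rdist A g p q = 0" using r nonneg[of p q] by simp
    then have "p = q" by simp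
    with \<open>L p p \<noteq> {}\<close> \<open>L p q = {}\<close> show False by simp
  qed
  have "\<delta> > 0" unfolding \<delta>_def by auto
  moreover have "\<exists>a b \<gamma>. a \<le> b \<and> piecewise_C1_curve A a b \<gamma> \<and> \<gamma> a = p \<and> \<gamma> b = q \<and> curve_length A g a b \<gamma> < e"
    if "rdist A g p q < e" "e \<le> \<delta>" for p q e
  proof -
    have "L p q \<noteq> {}" using that by (intro ne) simp
    from cInf_lessD[OF this] that(1) rd obtain l where "l \<in> L p q" "l < e" by metis
    then show ?thesis unfolding L_def by blast
  qed
  ultimately show thesis using that by blast
qed

text \<open>
  The topology of the Riemannian distance is at least as fine as that of the manifold.
\<close>
lemma rdist_ball_subset_chart_ball:
  assumes M: "Metric_space UNIV (rdist A g)" and c: "c \<in> A" "p \<in> cdom c" and r: "r > 0"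
  obtains e where "e > 0" "\<And>q. rdist A g p q < e \<Longrightarrow> q \<in> cdom c \<and> cmap c q \<in> ball (cmap c p) r"
proof -
  obtain k s where ks: "k > 0" "s > 0" "ball (cmap c p) s \<subseteq> cimg c"
    "\<And>q u. q \<in> cdom c \<Longrightarrow> cmap c q \<in> ball (cmap c p) s \<Longrightarrow> k * norm (components A c q u) \<le> gnorm g q u"
    using metric_components_coercive_near[OF c] by blast
  obtain \<delta> where \<delta>: "\<delta> > 0" "\<And>p q e. rdist A g p q < e \<Longrightarrow> e \<le> \<delta> \<Longrightarrow>
    \<exists>a b \<gamma>. a \<le> b \<and> piecewise_C1_curve A a b \<gamma> \<and> \<gamma> a = p \<and> \<gamma> b = q \<and> curve_length A g a b \<gamma> < e"
    using rdist_less_curve[OF M] by blast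
  define m where "m = min r s"
  have m: "m > 0" "m \<le> r" "m \<le> s" unfolding m_def using r ks by auto
  have sub: "ball (cmap c p) m \<subseteq> ball (cmap c p) s" "ball (cmap c p) m \<subseteq> ball (cmap c p) r" using m by auto
  have sub': "ball (cmap c p) m \<subseteq> cimg c" using sub(1) ks(3) by (rule subset_trans)
  have coer: "k * norm (components A c q u) \<le> gnorm g q u" if "q \<in> cdom c" "cmap c q \<in> ball (cmap c p) m" for q u
    by (rule ks(4)[OF that(1) subsetD[OF sub(1) that(2)]])
  have "q \<in> cdom c \<and> cmap c q \<in> ball (cmap c p) r" if q: "rdist A g p q < min \<delta> (k * m)" for q
  proof -
    obtain a b \<gamma> where \<gamma>: "a \<le> b" "piecewise_C1_curve A a b \<gamma>" "\<gamma> a = p" "\<gamma> b = q"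
      "curve_length A g a b \<gamma> < min \<delta> (k * m)"
      using \<delta>(2)[OF q] by auto
    have len: "curve_length A g a b \<gamma> < k * m" using \<gamma>(5) by simp
    from short_curve_in_chart_ball[OF c ks(1) sub' coer \<gamma>(2,1,3) len]
    show ?thesis unfolding \<gamma>(4) using sub(2) by blast
  qed
  moreover have "min \<delta> (k * m) > 0" using \<delta> ks m by simp
  ultimately show thesis using that by blast
qed

text \<open>
  Arcs of solutions are admissible in the definition of the distance.
\<close>
lemma twice_differentiable_curve_piecewise_C1:
  assumes \<gamma>: "twice_differentiable_curve A I \<gamma>" and I: "open I" "{a..b} \<subseteq> I"
  shows "piecewise_C1_curve A a b \<gamma>"
  unfolding piecewise_C1_curve_def
proof (intro conjI exI[of _ "{}"] allI impI)
  show cont: "continuous_on {a..b} \<gamma>"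
    using \<gamma> I(2) continuous_on_subset unfolding twice_differentiable_curve_def by blast
  fix u v assume uv: "a \<le> u \<and> u < v \<and> v \<le> b \<and> {u<..<v} \<inter> {} = {}"
  then have sub: "{u..v} \<subseteq> {a..b}" by auto
  show "C1_curve_on A {u..v} \<gamma>"
    unfolding C1_curve_on_def
  proof (intro conjI ballI)
    show "continuous_on {u..v} \<gamma>" by (rule continuous_on_subset[OF cont sub])
    fix c assume c: "c \<in> A"
    let ?w = "\<lambda>t. vector_derivative (cmap c \<circ> \<gamma>) (at t)"
    have "isCont ?w t \<and> ((cmap c \<circ> \<gamma>) has_vector_derivative ?w t) (at t)"
      if t: "t \<in> {u..v} \<inter> \<gamma> -` cdom c" for t
    proof -
      have "t \<in> I" "\<gamma> t \<in> cdom c" using t sub I(2) by auto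
      from twice_differentiable_curve_jet[OF \<gamma> I(1) this(1) c this(2)]
      obtain a where "chart_jet c \<gamma> t ?w a" by blast
      from chart_jetD(4,5)[OF this] show ?thesis by (blast intro: has_vector_derivative_continuous)
    qed
    note * = this
    show "\<exists>w. continuous_on ({u..v} \<inter> \<gamma> -` cdom c) w \<and>
        (\<forall>t\<in>{u..v} \<inter> \<gamma> -` cdom c. ((cmap c \<circ> \<gamma>) has_vector_derivative w t) (at t within {u..v}))"
    proof (rule exI[of _ ?w], rule conjI)
      show "continuous_on ({u..v} \<inter> \<gamma> -` cdom c) ?w"
        by (rule continuous_at_imp_continuous_on) (rule ballI, rule conjunct1[OF *])
      show "\<forall>t\<in>{u..v} \<inter> \<gamma> -` cdom c. ((cmap c \<circ> \<gamma>) has_vector_derivative ?w t) (at t within {u..v})"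
        by (rule ballI, rule has_vector_derivative_at_within, rule conjunct2[OF *])
    qed
  qed
qed simp

end

section \<open>Growth of the energy\<close>

lemma gronwall_linear:
  fixes \<Phi> \<Phi>' :: "real \<Rightarrow> real"
  assumes L: "0 \<le> L" and cont: "continuous_on {0..L} \<Phi>"
    and der: "\<And>s. 0 < s \<Longrightarrow> s < L \<Longrightarrow> (\<Phi> has_real_derivative \<Phi>' s) (at s)"
    and le: "\<And>s. 0 < s \<Longrightarrow> s < L \<Longrightarrow> \<Phi>' s \<le> K * \<Phi> s"
  shows "\<Phi> L \<le> \<Phi> 0 * exp (K * L)"
proof -
  define f where "f s = \<Phi> s * exp (- K * s)" for s
  have "f L \<le> f 0"
  proof (cases "L = 0")
    case False
    then have "0 < L" using L by simp
    show ?thesis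
    proof (rule DERIV_nonpos_imp_decreasing_open[OF L])
      fix s assume s: "0 < s" "s < L"
      have "(f has_real_derivative (\<Phi>' s - K * \<Phi> s) * exp (- K * s)) (at s)"
        unfolding f_def by (rule derivative_eq_intros der s refl)+ (simp add: algebra_simps)
      moreover have "(\<Phi>' s - K * \<Phi> s) * exp (- K * s) \<le> 0"
        using le[OF s] by (simp add: mult_le_0_iff)
      ultimately show "\<exists>y. DERIV f s :> y \<and> y \<le> 0" by blast
    next
      show "continuous_on {0..L} f" unfolding f_def by (intro continuous_intros cont)
    qed
  qed simp
  then have "f L * exp (K * L) \<le> f 0 * exp (K * L)" by (intro mult_right_mono) auto
  then show ?thesis by (simp add: f_def mult.assoc flip: exp_add)
qed

text \<open>
  The energy \<open>e\<close> itself may be negative, with \<open>- e\<close> growing like \<open>\<rho>\<^sup>2\<close>. Adding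
  \<open>2 K (1 + \<rho>\<^sup>2)\<close> gives a function \<open>\<Phi>\<close> that dominates both \<open>w\<^sup>2 / 2\<close> and
  \<open>K (1 + \<rho>\<^sup>2)\<close>. The derivative of \<open>\<Phi>\<close> is bounded by these two quantities, because
  \<open>2 \<rho> w \<le> \<rho>\<^sup>2 + w\<^sup>2\<close>, and so by a multiple of \<open>\<Phi>\<close>.
\<close>
lemma speed_bound_from_energy:
  fixes e e' w \<rho> :: "real \<Rightarrow> real"
  assumes L: "0 \<le> L" and K: "0 \<le> K"
    and cont: "continuous_on {0..L} e" "continuous_on {0..L} \<rho>"
    and der: "\<And>s. 0 < s \<Longrightarrow> s < L \<Longrightarrow> (e has_real_derivative e' s) (at s)"
      "\<And>s. 0 < s \<Longrightarrow> s < L \<Longrightarrow> (\<rho> has_real_derivative w s) (at s)"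
    and e': "\<And>s. 0 < s \<Longrightarrow> s < L \<Longrightarrow> \<bar>e' s\<bar> \<le> K * (1 + (\<rho> s)\<^sup>2 + (w s)\<^sup>2)"
    and w: "\<And>s. 0 \<le> s \<Longrightarrow> s \<le> L \<Longrightarrow> (w s)\<^sup>2 / 2 \<le> e s + K * (1 + (\<rho> s)\<^sup>2)"
  shows "(w L)\<^sup>2 \<le> 2 * (e 0 + 2 * K * (1 + (\<rho> 0)\<^sup>2)) * exp ((3 + 6 * K) * L)"
proof -
  define \<Phi> where "\<Phi> s = e s + 2 * K * (1 + (\<rho> s)\<^sup>2)" for s
  have w_le: "(w s)\<^sup>2 \<le> 2 * \<Phi> s" and \<rho>_le: "K * (1 + (\<rho> s)\<^sup>2) \<le> \<Phi> s" if "0 \<le> s" "s \<le> L" for s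
  proof -
    have "0 \<le> (w s)\<^sup>2" "0 \<le> K * (1 + (\<rho> s)\<^sup>2)" using K by (auto intro: mult_nonneg_nonneg)
    moreover have "\<Phi> s = e s + 2 * (K * (1 + (\<rho> s)\<^sup>2))" by (simp add: \<Phi>_def)
    moreover have "0 \<le> e s + K * (1 + (\<rho> s)\<^sup>2)"
      using w[OF that] zero_le_power2[of "w s"] by linarith
    ultimately show "(w s)\<^sup>2 \<le> 2 * \<Phi> s" "K * (1 + (\<rho> s)\<^sup>2) \<le> \<Phi> s" using w[OF that] by simp_all
  qed
  have "\<Phi> L \<le> \<Phi> 0 * exp ((3 + 6 * K) * L)"
  proof (rule gronwall_linear[OF L])
    show "continuous_on {0..L} \<Phi>" unfolding \<Phi>_def by (intro continuous_intros cont)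
    fix s assume s: "0 < s" "s < L"
    show "(\<Phi> has_real_derivative e' s + 4 * K * (\<rho> s * w s)) (at s)"
      unfolding \<Phi>_def by (rule derivative_eq_intros der s refl)+ (simp add: algebra_simps)
    have "2 * (\<rho> s * w s) \<le> (\<rho> s)\<^sup>2 + (w s)\<^sup>2"
      using zero_le_power2[of "\<rho> s - w s"] by (simp add: power2_diff)
    then have "2 * K * (2 * (\<rho> s * w s)) \<le> 2 * K * ((\<rho> s)\<^sup>2 + (w s)\<^sup>2)"
      using K by (intro mult_left_mono) auto
    moreover have "e' s \<le> K * (1 + (\<rho> s)\<^sup>2 + (w s)\<^sup>2)" using e'[OF s] by simp
    ultimately have "e' s + 4 * K * (\<rho> s * w s) \<le> 3 * (K * (1 + (\<rho> s)\<^sup>2)) + 3 * K * (w s)\<^sup>2"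
      using K by (simp add: algebra_simps)
    also have "\<dots> \<le> 3 * \<Phi> s + 3 * K * (2 * \<Phi> s)"
      using w_le[of s] \<rho>_le[of s] s K by (intro add_mono mult_left_mono) auto
    finally show "e' s + 4 * K * (\<rho> s * w s) \<le> (3 + 6 * K) * \<Phi> s" by (simp add: algebra_simps)
  qed
  then have "(w L)\<^sup>2 \<le> 2 * (\<Phi> 0 * exp ((3 + 6 * K) * L))" using w_le[of L] L by linarith
  then show ?thesis by (simp only: \<Phi>_def mult.assoc)
qed

text \<open>
  The same bound forward and backward in time. Here \<open>P\<close> is an antiderivative of the speed, so that
  \<open>\<bar>P s - P t0\<bar>\<close> is the length of the arc between \<open>t0\<close> and \<open>s\<close> in either direction.
\<close>
lemma speed_bound_from_energy_two_sided:
  fixes e e' W P :: "real \<Rightarrow> real"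
  assumes K: "0 \<le> K" and t: "t0 \<in> {\<alpha>..\<beta>}" "t \<in> {\<alpha>..\<beta>}"
    and cont: "continuous_on {\<alpha>..\<beta>} e" "continuous_on {\<alpha>..\<beta>} P"
    and der: "\<And>s. \<alpha> < s \<Longrightarrow> s < \<beta> \<Longrightarrow> (e has_real_derivative e' s) (at s)"
      "\<And>s. \<alpha> < s \<Longrightarrow> s < \<beta> \<Longrightarrow> (P has_real_derivative W s) (at s)"
    and e': "\<And>s. \<alpha> < s \<Longrightarrow> s < \<beta> \<Longrightarrow> \<bar>e' s\<bar> \<le> K * (1 + (r0 + \<bar>P s - P t0\<bar>)\<^sup>2 + (W s)\<^sup>2)"
    and W: "\<And>s. \<alpha> \<le> s \<Longrightarrow> s \<le> \<beta> \<Longrightarrow> (W s)\<^sup>2 / 2 \<le> e s + K * (1 + (r0 + \<bar>P s - P t0\<bar>)\<^sup>2)"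
    and mono: "\<And>s s'. \<alpha> \<le> s \<Longrightarrow> s \<le> s' \<Longrightarrow> s' \<le> \<beta> \<Longrightarrow> P s \<le> P s'"
  shows "(W t)\<^sup>2 \<le> 2 * (e t0 + 2 * K * (1 + r0\<^sup>2)) * exp ((3 + 6 * K) * \<bar>t - t0\<bar>)"
proof -
  \<comment> \<open>The direction of time; \<open>\<theta>\<close> runs from \<open>t0\<close> to \<open>t\<close>.\<close>
  define \<sigma> :: real where "\<sigma> = (if t0 \<le> t then 1 else - 1)"
  have \<sigma>: "\<sigma> * \<sigma> = 1" "\<bar>\<sigma>\<bar> = 1" "\<sigma> * \<bar>t - t0\<bar> = t - t0" by (auto simp: \<sigma>_def)
  define L where "L = \<bar>t - t0\<bar>"
  define \<theta> where "\<theta> s = t0 + \<sigma> * s" for s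
  have \<theta>: "\<theta> s \<in> {\<alpha>..\<beta>}" if "0 \<le> s" "s \<le> L" for s
    using that t by (auto simp: \<theta>_def \<sigma>_def L_def split: if_splits)
  have \<theta>': "\<alpha> < \<theta> s" "\<theta> s < \<beta>" if "0 < s" "s < L" for s
    using that t by (auto simp: \<theta>_def \<sigma>_def L_def split: if_splits)
  have \<theta>_der: "(\<theta> has_real_derivative \<sigma>) (at s)" for s
    unfolding \<theta>_def by (auto intro!: derivative_eq_intros)
  have \<theta>_cont: "continuous_on {0..L} \<theta>" unfolding \<theta>_def by (intro continuous_intros)
  have \<theta>_end: "\<theta> 0 = t0" "\<theta> L = t" using \<sigma>(3) by (auto simp: \<theta>_def L_def)
  define \<rho> where "\<rho> s = r0 + \<sigma> * (P (\<theta> s) - P t0)" for s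
  have \<rho>: "\<rho> s = r0 + \<bar>P (\<theta> s) - P t0\<bar>" if "0 \<le> s" "s \<le> L" for s
  proof (cases "t0 \<le> t")
    case True
    then have "P t0 \<le> P (\<theta> s)" using that \<theta>[OF that] t by (intro mono) (auto simp: \<theta>_def \<sigma>_def)
    then show ?thesis using True by (simp add: \<rho>_def \<sigma>_def)
  next
    case False
    then have "P (\<theta> s) \<le> P t0" using that \<theta>[OF that] t by (intro mono) (auto simp: \<theta>_def \<sigma>_def)
    then show ?thesis using False by (simp add: \<rho>_def \<sigma>_def)
  qed
  have "(W (\<theta> L))\<^sup>2 \<le> 2 * (e (\<theta> 0) + 2 * K * (1 + (\<rho> 0)\<^sup>2)) * exp ((3 + 6 * K) * L)"
  proof (rule speed_bound_from_energy[where e = "\<lambda>s. e (\<theta> s)" and e' = "\<lambda>s. \<sigma> * e' (\<theta> s)"])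
    show "0 \<le> L" by (simp add: L_def)
    show "0 \<le> K" by (rule K)
    show "continuous_on {0..L} (\<lambda>s. e (\<theta> s))"
      by (rule continuous_on_compose2[OF cont(1) \<theta>_cont]) (use \<theta> in auto)
    have "continuous_on {0..L} (\<lambda>s. P (\<theta> s))"
      by (rule continuous_on_compose2[OF cont(2) \<theta>_cont]) (use \<theta> in auto)
    then show "continuous_on {0..L} \<rho>" unfolding \<rho>_def by (intro continuous_intros)
    fix s assume s: "0 < s" "s < L"
    note i = \<theta>'[OF s]
    show "((\<lambda>s. e (\<theta> s)) has_real_derivative \<sigma> * e' (\<theta> s)) (at s)"
      using DERIV_chain2[OF der(1)[OF i] \<theta>_der] by (simp add: mult.commute)
    have "((\<lambda>s. P (\<theta> s)) has_real_derivative W (\<theta> s) * \<sigma>) (at s)"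
      by (rule DERIV_chain2[OF der(2)[OF i] \<theta>_der])
    then have "(\<rho> has_real_derivative \<sigma> * (W (\<theta> s) * \<sigma>)) (at s)"
      unfolding \<rho>_def by (auto intro!: derivative_eq_intros)
    moreover have "\<sigma> * (W (\<theta> s) * \<sigma>) = W (\<theta> s)" using \<sigma>(1) by (simp add: mult.left_commute)
    ultimately show "(\<rho> has_real_derivative W (\<theta> s)) (at s)" by simp
    show "\<bar>\<sigma> * e' (\<theta> s)\<bar> \<le> K * (1 + (\<rho> s)\<^sup>2 + (W (\<theta> s))\<^sup>2)"
      using e'[OF i] \<rho>[of s] s \<sigma>(2) by (simp add: abs_mult)
  next
    fix s assume s: "0 \<le> s" "s \<le> L"
    show "(W (\<theta> s))\<^sup>2 / 2 \<le> e (\<theta> s) + K * (1 + (\<rho> s)\<^sup>2)"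
      using W[of "\<theta> s"] \<theta>[OF s] \<rho>[OF s] by simp
  qed
  then show ?thesis unfolding \<theta>_end by (simp add: \<rho>_def L_def \<theta>_def)
qed

section \<open>Local solutions of ordinary differential equations\<close>

lemma norm_integral_difference_le:
  fixes h :: "real \<Rightarrow> 'a::banach"
  assumes h: "continuous_on {\<alpha>..\<beta>} h" "\<And>s. s \<in> {\<alpha>..\<beta>} \<Longrightarrow> norm (h s) \<le> M"
    and uv: "u \<in> {\<alpha>..\<beta>}" "v \<in> {\<alpha>..\<beta>}"
  shows "norm (integral {\<alpha>..u} h - integral {\<alpha>..v} h) \<le> M * \<bar>u - v\<bar>"
proof -
  have *: "norm (integral {\<alpha>..v} h - integral {\<alpha>..u} h) \<le> M * (v - u)"
    if "u \<le> v" "u \<in> {\<alpha>..\<beta>}" "v \<in> {\<alpha>..\<beta>}" for u v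
  proof -
    have "h integrable_on {\<alpha>..v}"
      using that by (intro integrable_continuous_real continuous_on_subset[OF h(1)]) auto
    then have "integral {\<alpha>..u} h + integral {u..v} h = integral {\<alpha>..v} h"
      using that by (intro Henstock_Kurzweil_Integration.integral_combine) auto
    then have "integral {\<alpha>..v} h - integral {\<alpha>..u} h = integral {u..v} h" by (simp add: algebra_simps)
    moreover have "norm (integral {u..v} h) \<le> M * (v - u)"
      using that by (intro integral_bound continuous_on_subset[OF h(1)] h(2)) auto
    ultimately show ?thesis by simp
  qed
  show ?thesis
  proof (cases "u \<le> v")
    case True
    then show ?thesis using *[OF True uv] by (simp add: norm_minus_commute)
  next
    case False
    then show ?thesis using *[of v u] uv by simp
  qed
qed

text \<open>
  The theorem of Picard and Lindelof. The contraction acts on bounded continuous functions on the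
  whole line with values in a closed ball about \<open>y0\<close>; the upper limit of integration is clamped to
  \<open>b - \<epsilon> .. b + \<epsilon>\<close>, so that functions on that interval need no type of their own.
\<close>
lemma picard_local_solution:
  fixes G :: "real \<times> 'a::banach \<Rightarrow> 'a"
  assumes G: "lipschitz_near G (b, y0)" and r: "r > 0"
  obtains \<epsilon> z where "\<epsilon> > 0" "z b = y0"
    "\<And>t. t \<in> ball b \<epsilon> \<Longrightarrow> (z has_vector_derivative G (t, z t)) (at t)"
    "\<And>t. t \<in> ball b \<epsilon> \<Longrightarrow> z t \<in> ball y0 r"
proof -
  obtain e L B where e: "e > 0" and L: "L-lipschitz_on (ball (b, y0) e) G"
    and B: "\<And>y. y \<in> ball (b, y0) e \<Longrightarrow> norm (G y) \<le> B" "B \<ge> 0"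
    using lipschitz_near_bounded[OF G] by blast
  have L0: "L \<ge> 0" by (rule lipschitz_on_nonneg[OF L])
  define \<rho> where "\<rho> = min (e / 3) (r / 2)"
  have \<rho>: "\<rho> > 0" "\<rho> \<le> e / 3" "\<rho> < r" using e r by (auto simp: \<rho>_def)
  \<comment> \<open>The three bounds keep the graph in the Lipschitz ball, keep values within \<open>\<rho>\<close> of \<open>y0\<close>, and give contraction factor 1/2.\<close>
  define \<epsilon> where "\<epsilon> = Min {e / 3, \<rho> / (B + 1), 1 / (2 * (L + 1))}"
  have \<epsilon>: "\<epsilon> > 0" "\<epsilon> \<le> e / 3" "\<epsilon> \<le> \<rho> / (B + 1)" "\<epsilon> \<le> 1 / (2 * (L + 1))"
  proof -
    show "\<epsilon> > 0" using e \<rho> B L0 by (simp add: \<epsilon>_def)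
  qed (unfold \<epsilon>_def, (rule Min_le, simp, simp)+)
  have B\<epsilon>: "B * \<epsilon> \<le> \<rho>"
  proof -
    have "B * \<epsilon> \<le> (B + 1) * \<epsilon>" using \<epsilon>(1) by (simp add: algebra_simps)
    also have "\<dots> \<le> \<rho>" using \<epsilon>(3) B(2) by (simp add: field_simps)
    finally show ?thesis .
  qed
  have L\<epsilon>: "L * \<epsilon> \<le> 1 / 2"
  proof -
    have "L * \<epsilon> \<le> (L + 1) * \<epsilon>" using \<epsilon>(1) by (simp add: algebra_simps)
    also have "\<dots> \<le> 1 / 2" using \<epsilon>(4) L0 by (simp add: field_simps)
    finally show ?thesis .
  qed
  let ?\<alpha> = "b - \<epsilon>" and ?\<beta> = "b + \<epsilon>"
  have in_ball: "(s, y) \<in> ball (b, y0) e" if "s \<in> {?\<alpha>..?\<beta>}" "y \<in> cball y0 \<rho>" for s y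
  proof -
    have "dist (b, y0) (s, y) \<le> dist b s + dist y0 y"
      using sqrt_sum_squares_le_sum[of "dist b s" "dist y0 y"] by (simp add: dist_Pair_Pair)
    also have "\<dots> \<le> \<epsilon> + \<rho>" using that by (intro add_mono) (auto simp: dist_real_def)
    also have "\<dots> < e" using \<epsilon>(2) \<rho>(2) e by simp
    finally show ?thesis by simp
  qed
  define cl where "cl t = max ?\<alpha> (min ?\<beta> t)" for t
  have cl: "cl t \<in> {?\<alpha>..?\<beta>}" for t using \<epsilon>(1) by (auto simp: cl_def)
  have cl_id: "cl t = t" if "t \<in> {?\<alpha>..?\<beta>}" for t using that by (auto simp: cl_def)
  have b: "b \<in> {?\<alpha>..?\<beta>}" using \<epsilon>(1) by simp
  have cl_cont: "continuous_on UNIV cl" unfolding cl_def by (intro continuous_intros)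
  have cl_b: "\<bar>cl t - b\<bar> \<le> \<epsilon>" for t using cl[of t] by auto
  define X where "X = {f :: real \<Rightarrow>\<^sub>C 'a. \<forall>t. apply_bcontfun f t \<in> cball y0 \<rho>}"
  have X_eq: "X = PiC UNIV (\<lambda>_. cball y0 \<rho>)" unfolding X_def by (auto simp: mem_PiC_iff Pi_iff)
  have "complete X" unfolding X_eq by (intro closed_PiC[THEN complete_eq_closed[THEN iffD2]]) auto
  moreover have "const_bcontfun y0 \<in> X" unfolding X_def using \<rho> by (simp add: const_bcontfun.rep_eq)
  then have "X \<noteq> {}" by blast
  have h_cont: "continuous_on {?\<alpha>..?\<beta>} (\<lambda>s. G (s, apply_bcontfun f s))" if "f \<in> X" for f
  proof (rule continuous_on_compose2[OF lipschitz_on_continuous_on[OF L]])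
    show "continuous_on {?\<alpha>..?\<beta>} (\<lambda>s. (s, apply_bcontfun f s))" by (intro continuous_intros) simp
    show "(\<lambda>s. (s, apply_bcontfun f s)) ` {?\<alpha>..?\<beta>} \<subseteq> ball (b, y0) e"
      using that in_ball unfolding X_def by blast
  qed
  have h_bound: "norm (G (s, apply_bcontfun f s)) \<le> B" if "f \<in> X" "s \<in> {?\<alpha>..?\<beta>}" for f s
    using that unfolding X_def by (intro B(1) in_ball) auto
  define Q where "Q f u = integral {?\<alpha>..u} (\<lambda>s. G (s, apply_bcontfun f s))" for f u
  define T0 where "T0 f t = y0 + (Q f (cl t) - Q f b)" for f t
  have T0_ball: "norm (T0 f t - y0) \<le> \<rho>" if "f \<in> X" for f t
  proof -
    have "norm (Q f (cl t) - Q f b) \<le> B * \<bar>cl t - b\<bar>"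
      unfolding Q_def by (rule norm_integral_difference_le[OF h_cont h_bound cl b]) (use that in auto)
    also have "\<dots> \<le> B * \<epsilon>" using B(2) cl_b by (intro mult_left_mono)
    finally show ?thesis using B\<epsilon> by (simp add: T0_def)
  qed
  have T0_cont: "continuous_on UNIV (T0 f)" if "f \<in> X" for f
  proof -
    have "continuous_on {?\<alpha>..?\<beta>} (Q f)"
      unfolding Q_def by (intro indefinite_integral_continuous_1 integrable_continuous_real h_cont that)
    then have "continuous_on UNIV (\<lambda>t. Q f (cl t))"
      by (rule continuous_on_compose2[OF _ cl_cont]) (use cl in auto)
    then show ?thesis unfolding T0_def by (intro continuous_intros)
  qed
  have T0_b: "T0 f \<in> bcontfun" if "f \<in> X" for f
  proof (rule bcontfun_normI[OF T0_cont[OF that]])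
    fix t show "norm (T0 f t) \<le> norm y0 + \<rho>"
      using T0_ball[OF that, of t] norm_triangle_ineq2[of "T0 f t" y0] by linarith
  qed
  define T where "T f = Bcontfun (T0 f)" for f
  have T: "apply_bcontfun (T f) t = T0 f t" if "f \<in> X" for f t
    unfolding T_def using T0_b[OF that] by (simp add: Bcontfun_inverse)
  have "\<exists>!f. f \<in> X \<and> T f = f"
  proof (rule Banach_fix[OF \<open>complete X\<close> \<open>X \<noteq> {}\<close>, of "1/2"])
    show "T ` X \<subseteq> X"
    proof (rule image_subsetI)
      fix f assume "f \<in> X"
      then show "T f \<in> X"
        using T0_ball[of f] T[of f] by (simp add: X_def dist_norm norm_minus_commute)
    qed
    fix f f' assume f: "f \<in> X" and f': "f' \<in> X"
    show "dist (T f) (T f') \<le> 1/2 * dist f f'"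
    proof (rule dist_bound)
      fix t
      let ?h = "\<lambda>s. G (s, apply_bcontfun f s) - G (s, apply_bcontfun f' s)"
      have int: "(\<lambda>s. G (s, apply_bcontfun f s)) integrable_on {?\<alpha>..u}" if "u \<in> {?\<alpha>..?\<beta>}" "f \<in> X" for u f
        using that by (intro integrable_continuous_real continuous_on_subset[OF h_cont]) auto
      have diff: "Q f u - Q f' u = integral {?\<alpha>..u} ?h" if "u \<in> {?\<alpha>..?\<beta>}" for u
        unfolding Q_def using that f f' by (intro Henstock_Kurzweil_Integration.integral_diff[symmetric] int)
      have "T0 f t - T0 f' t = integral {?\<alpha>..cl t} ?h - integral {?\<alpha>..b} ?h"
        unfolding diff[OF cl, symmetric] diff[OF b, symmetric] T0_def by simp
      also have "norm \<dots> \<le> (L * dist f f') * \<bar>cl t - b\<bar>"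
      proof (rule norm_integral_difference_le[OF _ _ cl b])
        show "continuous_on {?\<alpha>..?\<beta>} ?h" by (intro continuous_on_diff h_cont f f')
        fix s assume s: "s \<in> {?\<alpha>..?\<beta>}"
        have "norm (?h s) \<le> L * dist (s, apply_bcontfun f s) (s, apply_bcontfun f' s)"
          using f f' s unfolding X_def dist_norm[symmetric]
          by (intro lipschitz_onD[OF L] in_ball) auto
        also have "\<dots> \<le> L * dist f f'" using L0 dist_bounded[of f s f'] by (intro mult_left_mono) (auto simp: dist_Pair_Pair)
        finally show "norm (?h s) \<le> L * dist f f'" .
      qed
      also have "\<dots> \<le> (L * dist f f') * \<epsilon>" using L0 cl_b by (intro mult_left_mono) auto
      also have "\<dots> = (L * \<epsilon>) * dist f f'" by simp
      also have "\<dots> \<le> 1/2 * dist f f'" by (intro mult_right_mono L\<epsilon>) simp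
      finally show "dist (apply_bcontfun (T f) t) (apply_bcontfun (T f') t) \<le> 1/2 * dist f f'"
        by (simp add: T f f' dist_norm)
    qed
  qed auto
  then obtain f where f: "f \<in> X" "T f = f" by blast
  define z where "z = apply_bcontfun f"
  have z: "z t = T0 f t" for t using T[OF f(1), of t] f(2) by (simp add: z_def)
  have "z b = y0" using cl_id[OF b] by (simp add: z T0_def)
  moreover have "(z has_vector_derivative G (t, z t)) (at t)" if t: "t \<in> ball b \<epsilon>" for t
  proof -
    have t': "?\<alpha> < t" "t < ?\<beta>" using t by (auto simp: dist_real_def)
    have "((\<lambda>u. Q f u) has_vector_derivative G (t, z t)) (at t within {?\<alpha>..?\<beta>})"
      unfolding Q_def z_def using t' by (intro integral_has_vector_derivative h_cont f) auto
    then have "((\<lambda>u. Q f u) has_vector_derivative G (t, z t)) (at t)"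
      by (simp add: at_within_Icc_at[OF t'])
    then have 1: "((\<lambda>u. y0 + (Q f u - Q f b)) has_vector_derivative G (t, z t)) (at t)"
      by (auto intro!: derivative_eq_intros)
    show ?thesis
      by (rule has_vector_derivative_transform_within_open[OF 1 open_greaterThanLessThan[of ?\<alpha> ?\<beta>]])
        (use t' in \<open>auto simp: z T0_def cl_id\<close>)
  qed
  moreover have "z t \<in> ball y0 r" for t
    using T0_ball[OF f(1), of t] \<rho>(3) by (simp add: z dist_norm norm_minus_commute)
  ultimately show thesis using that[of \<epsilon> z] \<epsilon>(1) by blast
qed

text \<open>
  Near a boundary point that it omits, an interval is one side of that point; the sign of
  \<open>\<sigma>\<close> tells which one.
\<close>
lemma interval_at_missing_boundary_point:
  fixes I :: "real set"
  assumes I: "is_interval I" "b \<in> closure I" "b \<notin> I"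
  obtains \<sigma> \<epsilon> :: real where "\<sigma> \<noteq> 0" "\<epsilon> > 0" "\<And>t. t \<in> ball b \<epsilon> \<Longrightarrow> t \<in> I \<longleftrightarrow> \<sigma> * (t - b) < 0"
proof -
  have "I \<noteq> {}" using I(2) by auto
  then obtain t0 where t0: "t0 \<in> I" by blast
  have conv: "t \<in> I" if "x \<in> I" "y \<in> I" "x \<le> t" "t \<le> y" for x y t
    using mem_is_interval_1_I[OF I(1) that(1,2)] that(3,4) by simp
  have near: "\<exists>x\<in>I. dist x b < e" if "e > 0" for e using I(2) that by (simp add: closure_approachable)
  show thesis
  proof (cases "t0 < b")
    case True
    have "t \<in> I \<longleftrightarrow> 1 * (t - b) < 0" if t: "t \<in> ball b (b - t0)" for t
    proof
      assume "t \<in> I"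
      then show "1 * (t - b) < 0" using conv[OF t0, of t b] True I(3) by force
    next
      assume "1 * (t - b) < 0"
      then obtain x where x: "x \<in> I" "dist x b < b - t" using near[of "b - t"] by auto
      then show "t \<in> I" using conv[OF t0 x(1), of t] t by (auto simp: dist_real_def)
    qed
    then show thesis using that[of 1 "b - t0"] True by simp
  next
    case False
    then have "b < t0" using t0 I(3) by (cases "b = t0") auto
    have "t \<in> I \<longleftrightarrow> - 1 * (t - b) < 0" if t: "t \<in> ball b (t0 - b)" for t
    proof
      assume "t \<in> I"
      then show "- 1 * (t - b) < 0" using conv[of t t0 b] t0 \<open>b < t0\<close> I(3) by force
    next
      assume "- 1 * (t - b) < 0"
      then obtain x where x: "x \<in> I" "dist x b < t - b" using near[of "t - b"] by auto
      then show "t \<in> I" using conv[OF x(1) t0, of t] t by (auto simp: dist_real_def)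
    qed
    then show thesis using that[of "-1" "t0 - b"] \<open>b < t0\<close> by simp
  qed
qed

text \<open>
  A single exceptional point does not affect the fundamental theorem of calculus, so \<open>z\<close> is an
  integral of the continuous function \<open>h\<close> everywhere.
\<close>
lemma vector_derivative_at_exceptional_point:
  fixes z h :: "real \<Rightarrow> 'a::banach"
  assumes \<epsilon>: "\<epsilon> > 0"
    and z: "continuous_on (ball b \<epsilon>) z" and h: "continuous_on (ball b \<epsilon>) h"
    and der: "\<And>t. t \<in> ball b \<epsilon> \<Longrightarrow> t \<noteq> b \<Longrightarrow> (z has_vector_derivative h t) (at t)"
  shows "(z has_vector_derivative h b) (at b)"
proof -
  let ?\<alpha> = "b - \<epsilon> / 2" and ?\<beta> = "b + \<epsilon> / 2"
  have sub: "{?\<alpha>..?\<beta>} \<subseteq> ball b \<epsilon>" using \<epsilon> by (auto simp: dist_real_def)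
  have b: "?\<alpha> < b" "b < ?\<beta>" using \<epsilon> by auto
  have ftc: "integral {?\<alpha>..t} h = z t - z ?\<alpha>" if t: "t \<in> {?\<alpha>..?\<beta>}" for t
  proof (rule integral_unique, rule fundamental_theorem_of_calculus_interior_strong[of "{b}"])
    show "continuous_on {?\<alpha>..t} z" by (rule continuous_on_subset[OF z]) (use sub t in auto)
    show "(z has_vector_derivative h s) (at s)" if "s \<in> {?\<alpha><..<t} - {b}" for s
    proof (rule der)
      have "s \<in> {?\<alpha>..?\<beta>}" using that t by simp
      then show "s \<in> ball b \<epsilon>" using sub by blast
    qed (use that in simp)
  qed (use t in auto)
  have "((\<lambda>t. integral {?\<alpha>..t} h) has_vector_derivative h b) (at b within {?\<alpha>..?\<beta>})"
    by (rule integral_has_vector_derivative[OF continuous_on_subset[OF h sub]]) (use b in auto)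
  then have "((\<lambda>t. integral {?\<alpha>..t} h) has_vector_derivative h b) (at b)"
    by (simp add: at_within_Icc_at[OF b])
  then have 1: "((\<lambda>t. z ?\<alpha> + integral {?\<alpha>..t} h) has_vector_derivative h b) (at b)"
    by (auto intro!: derivative_eq_intros)
  show ?thesis
    by (rule has_vector_derivative_transform_within_open[OF 1 open_greaterThanLessThan[of ?\<alpha> ?\<beta>]])
      (use b ftc in auto)
qed

text \<open>
  A solution with a limit at an end point of its interval continues past it: on the other side one
  takes the Picard solution through the limit, and at \<open>b\<close> itself the two halves fit together by
  \<open>vector_derivative_at_exceptional_point\<close>.
\<close>
lemma ode_solution_extends_past_boundary:
  fixes G :: "real \<times> 'a::banach \<Rightarrow> 'a"
  assumes I: "open I" "is_interval I" "b \<in> closure I" "b \<notin> I"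
    and G: "lipschitz_near G (b, y0)" and r: "r > 0" and e: "e > 0"
    and der: "\<And>t. t \<in> I \<Longrightarrow> t \<in> ball b e \<Longrightarrow> (y has_vector_derivative G (t, y t)) (at t)"
    and lim: "(y \<longlongrightarrow> y0) (at b within I)"
  obtains \<epsilon> z where "\<epsilon> > 0" "\<And>t. t \<in> ball b \<epsilon> \<Longrightarrow> (z has_vector_derivative G (t, z t)) (at t)"
    "\<And>t. t \<in> ball b \<epsilon> \<Longrightarrow> z t \<in> ball y0 r" "\<And>t. t \<in> I \<Longrightarrow> t \<in> ball b \<epsilon> \<Longrightarrow> z t = y t"
proof -
  obtain d L where d: "d > 0" and L: "L-lipschitz_on (ball (b, y0) d) G"
    using G unfolding lipschitz_near_def by blast
  define r' where "r' = min r (d / 2)"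
  have r': "r' > 0" "r' \<le> r" "r' \<le> d / 2" using r d by (auto simp: r'_def)
  obtain \<epsilon>1 f where \<epsilon>1: "\<epsilon>1 > 0" and fb: "f b = y0"
    and f: "\<And>t. t \<in> ball b \<epsilon>1 \<Longrightarrow> (f has_vector_derivative G (t, f t)) (at t)"
      "\<And>t. t \<in> ball b \<epsilon>1 \<Longrightarrow> f t \<in> ball y0 r'"
    using picard_local_solution[OF G r'(1)] by blast
  obtain \<sigma> \<epsilon>2 where \<sigma>: "\<sigma> \<noteq> 0" and \<epsilon>2: "\<epsilon>2 > 0" and side: "\<And>t. t \<in> ball b \<epsilon>2 \<Longrightarrow> t \<in> I \<longleftrightarrow> \<sigma> * (t - b) < 0"
    using interval_at_missing_boundary_point[OF I(2-4)] by blast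
  have "\<forall>\<^sub>F t in at b within I. y t \<in> ball y0 r'" by (rule topological_tendstoD[OF lim]) (use r' in auto)
  then obtain \<epsilon>3 where \<epsilon>3: "\<epsilon>3 > 0" "\<And>t. t \<in> I \<Longrightarrow> t \<noteq> b \<Longrightarrow> dist t b < \<epsilon>3 \<Longrightarrow> y t \<in> ball y0 r'"
    unfolding eventually_at by blast
  define \<epsilon> where "\<epsilon> = min (min (min \<epsilon>1 \<epsilon>2) (min \<epsilon>3 e)) (d / 2)"
  have \<epsilon>: "\<epsilon> > 0" "\<epsilon> \<le> \<epsilon>1" "\<epsilon> \<le> \<epsilon>2" "\<epsilon> \<le> \<epsilon>3" "\<epsilon> \<le> e" "\<epsilon> \<le> d / 2"
    using \<epsilon>1 \<epsilon>2 \<epsilon>3 e d by (auto simp: \<epsilon>_def)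
  have balls: "t \<in> ball b \<epsilon>1" "t \<in> ball b \<epsilon>2" "dist t b < \<epsilon>3" "t \<in> ball b e" if "t \<in> ball b \<epsilon>" for t
    using that \<epsilon> by (auto simp: dist_commute)
  define z where "z t = (if t \<in> I then y t else f t)" for t
  have z_ball: "z t \<in> ball y0 r'" if t: "t \<in> ball b \<epsilon>" for t
  proof (cases "t \<in> I")
    case True
    then have "t \<noteq> b" using I(4) by blast
    then show ?thesis using \<epsilon>3(2)[OF True _ balls(3)[OF t]] True by (simp add: z_def)
  next
    case False
    then show ?thesis using f(2)[OF balls(1)[OF t]] by (simp add: z_def)
  qed
  have off: "(z has_vector_derivative G (t, z t)) (at t)" if t: "t \<in> ball b \<epsilon>" "t \<noteq> b" for t
  proof (cases "t \<in> I")
    case True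
    have "(z has_vector_derivative G (t, y t)) (at t)"
      by (rule has_vector_derivative_transform_within_open[OF der[OF True balls(4)[OF t(1)]] I(1) True])
        (simp add: z_def)
    then show ?thesis using True by (simp add: z_def)
  next
    case False
    let ?W = "ball b \<epsilon> \<inter> {s. 0 < \<sigma> * (s - b)}"
    have "open ?W" by (intro open_Int open_ball open_Collect_less continuous_intros)
    moreover have "t \<in> ?W"
    proof -
      have "\<not> \<sigma> * (t - b) < 0" using False side[OF balls(2)[OF t(1)]] by blast
      moreover have "\<sigma> * (t - b) \<noteq> 0" using \<sigma> t(2) by simp
      ultimately have "0 < \<sigma> * (t - b)" by linarith
      then show ?thesis using t(1) by blast
    qed
    moreover have "f s = z s" if s: "s \<in> ?W" for s
    proof -
      have "s \<in> ball b \<epsilon>" "\<not> \<sigma> * (s - b) < 0" using s by auto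
      then show ?thesis using side[OF balls(2), of s] by (simp add: z_def)
    qed
    ultimately have "(z has_vector_derivative G (t, f t)) (at t)"
      by (rule has_vector_derivative_transform_within_open[OF f(1)[OF balls(1)[OF t(1)]]])
    then show ?thesis using False by (simp add: z_def)
  qed
  have "isCont z b"
  proof -
    have "z b = y0" using I(4) fb by (simp add: z_def)
    have "(z \<longlongrightarrow> y0) (at b within I)"
      by (rule Lim_transform_eventually[OF lim]) (simp add: z_def eventually_at_filter)
    moreover have "(z \<longlongrightarrow> y0) (at b within - I)"
    proof (rule Lim_transform_eventually)
      have "isCont f b" using f(1)[of b] \<epsilon>1 has_vector_derivative_continuous by auto
      then show "(f \<longlongrightarrow> y0) (at b within - I)"
        unfolding isCont_def fb by (rule tendsto_within_subset) simp
      show "\<forall>\<^sub>F t in at b within - I. f t = z t" by (simp add: z_def eventually_at_filter)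
    qed
    ultimately have "(z \<longlongrightarrow> y0) (at b)" by (rule Lim_Un_univ) simp
    then show ?thesis by (simp add: isCont_def \<open>z b = y0\<close>)
  qed
  then have z_isCont: "isCont z t" if "t \<in> ball b \<epsilon>" for t
    using off[OF that] has_vector_derivative_continuous by (cases "t = b") auto
  have z_cont: "continuous_on (ball b \<epsilon>) z"
    using z_isCont by (simp add: continuous_at_imp_continuous_on)
  have h_cont: "continuous_on (ball b \<epsilon>) (\<lambda>t. G (t, z t))"
  proof (rule continuous_on_compose2[OF lipschitz_on_continuous_on[OF L]])
    show "continuous_on (ball b \<epsilon>) (\<lambda>t. (t, z t))" by (intro continuous_intros z_cont)
    have "(t, z t) \<in> ball (b, y0) d" if "t \<in> ball b \<epsilon>" for t
    proof -
      have "dist (b, y0) (t, z t) \<le> dist b t + dist y0 (z t)"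
        using sqrt_sum_squares_le_sum[of "dist b t" "dist y0 (z t)"] by (simp add: dist_Pair_Pair)
      also have "\<dots> < d" using that z_ball[OF that] r'(3) \<epsilon>(6) by simp
      finally show ?thesis by simp
    qed
    then show "(\<lambda>t. (t, z t)) ` ball b \<epsilon> \<subseteq> ball (b, y0) d" by blast
  qed
  have "(z has_vector_derivative G (t, z t)) (at t)" if "t \<in> ball b \<epsilon>" for t
    using off[OF that] vector_derivative_at_exceptional_point[OF \<epsilon>(1) z_cont h_cont off] by (cases "t = b") auto
  moreover have "z t \<in> ball y0 r" if "t \<in> ball b \<epsilon>" for t
    using z_ball[OF that] r'(2) by simp
  moreover have "z t = y t" if "t \<in> I" for t using that by (simp add: z_def)
  ultimately show thesis using that \<epsilon>(1) by blast
qed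

section \<open>The equation of motion in a chart\<close>

locale force_fields = levi_civita +
  fixes E :: "'a \<Rightarrow> real \<Rightarrow> 'b \<Rightarrow>\<^sub>L 'b" and R :: "'a \<Rightarrow> real \<Rightarrow> 'b" and V :: "'a \<Rightarrow> real \<Rightarrow> real"
  assumes E_smooth: "smooth_endomorphism_field A E"
    and R_smooth: "smooth_vector_field A R"
    and V_smooth: "smooth_function A V"
begin

definition force :: "'a \<Rightarrow> 'b \<Rightarrow> real \<Rightarrow> 'b" where
  "force p v t = E p t v + R p t - gradient A g (\<lambda>q. V q t) p"

text \<open>
  The right-hand side of the equation in coordinates, solved for \<open>x''\<close>.
\<close>
definition chart_acceleration :: "('a, 'b) chart \<Rightarrow> real \<times> 'b \<times> 'b \<Rightarrow> 'b" where
  "chart_acceleration c = (\<lambda>(t, x, v).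
     components A c (cinv c x) (force (cinv c x) (from_components A c (cinv c x) v) t) - \<Gamma> c x v v)"

lemma equation_of_motion_in_chart:
  assumes jet: "chart_jet c \<gamma> t v a"
  shows "covariant_derivative A \<Gamma> \<gamma> (velocity A \<gamma>) t = force (\<gamma> t) (velocity A \<gamma> t) t
     \<longleftrightarrow> a = chart_acceleration c (t, cmap c (\<gamma> t), v t)"
proof -
  note c = chart_jetD(1,2)[OF jet]
  have "velocity A \<gamma> t = from_components A c (\<gamma> t) (v t)"
    using velocity_components_jet[OF jet] components_from_components(2)[OF c] by metis
  then have "chart_acceleration c (t, cmap c (\<gamma> t), v t)
      = components A c (\<gamma> t) (force (\<gamma> t) (velocity A \<gamma> t) t) - \<Gamma> c (cmap c (\<gamma> t)) (v t) (v t)"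
    using c by (simp add: chart_acceleration_def)
  then show ?thesis
    using covariant_derivative_components[OF linear_connection jet]
    by (metis add_diff_cancel components_eq_iff[OF c] diff_add_cancel)
qed

text \<open>
  The components of the gradient solve the linear equation \<open>G(x) z = dV(x, t)\<close>, where \<open>G\<close> is the
  metric in the chart, so \<open>lipschitz_near_solve\<close> applies.
\<close>
lemma gradient_components_lipschitz:
  assumes c: "c \<in> A" and x0: "x0 \<in> cimg c"
  shows "lipschitz_near (\<lambda>(x, t). components A c (cinv c x) (gradient A g (\<lambda>q. V q t) (cinv c x))) (x0, t0)"
proof -
  let ?U = "cimg c \<times> (UNIV :: real set)" and ?W = "\<lambda>(x, t). V (cinv c x) t"
  have U: "open ?U" "(x0, t0) \<in> ?U" using x0 open_cimg[OF c] by (auto intro: open_Times)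
  have "smooth_on ?U ?W" using V_smooth c unfolding smooth_function_def by blast
  then obtain D where D: "\<And>y. y \<in> ?U \<Longrightarrow> (?W has_derivative blinfun_apply (D y)) (at y)" "smooth_on ?U D"
    using smooth_on_derivative[OF U(1)] by blast
  define inl :: "'b \<Rightarrow>\<^sub>L ('b \<times> real)" where "inl = Blinfun (\<lambda>h. (h, 0))"
  have inl: "inl h = (h, 0)" for h
    unfolding inl_def by (subst bounded_linear_Blinfun_apply) (auto intro!: bounded_linear_intros)
  obtain B where B: "\<And>u. norm u \<le> B * norm (metric_components A g c (cmap c (cinv c x0)) u)"
    using metric_components_bounded_below[OF c cinv_in_cdom[OF x0]] by blast
  show ?thesis
  proof (rule lipschitz_near_solve[where G = "\<lambda>y. metric_components A g c (fst y)" and \<omega> = "\<lambda>y. D y o\<^sub>L inl" and B = B])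
    show "lipschitz_near (\<lambda>y. metric_components A g c (fst y)) (x0, t0)"
      by (rule lipschitz_near_compose[OF lipschitz_near_bounded_linear[OF bounded_linear_fst]])
        (simp add: smooth_on_lipschitz_near[OF open_cimg[OF c] metric_components_smooth[OF c] x0])
    show "lipschitz_near (\<lambda>y. D y o\<^sub>L inl) (x0, t0)"
      by (rule lipschitz_near_compose[OF smooth_on_lipschitz_near[OF U(1) D(2) U(2)]
            lipschitz_near_bounded_linear[OF bounded_bilinear.bounded_linear_left[OF bounded_bilinear_blinfun_compose]]])
    show "norm v \<le> B * norm (metric_components A g c (fst (x0, t0)) v)" for v
      using B[of v] x0 c by simp
    have "\<forall>\<^sub>F y in nhds (x0, t0). y \<in> ?U" using U by (rule eventually_nhds_in_open)
    then show "\<forall>\<^sub>F y in nhds (x0, t0). metric_components A g c (fst y)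
        (case y of (x, t) \<Rightarrow> components A c (cinv c x) (gradient A g (\<lambda>q. V q t) (cinv c x))) = D y o\<^sub>L inl"
    proof eventually_elim
      case (elim y)
      obtain x t where y: "y = (x, t)" by (cases y)
      have x: "x \<in> cimg c" using elim y by simp
      let ?p = "cinv c x"
      have p: "?p \<in> cdom c" "cmap c ?p = x" using x c cinv_in_cdom by auto
      have "((\<lambda>x. (x, t)) has_derivative (\<lambda>h. (h, 0))) (at x)"
        by (auto intro!: derivative_eq_intros)
      from diff_chain_at[OF this D(1)[OF elim, unfolded y]]
      have "(((\<lambda>q. V q t) \<circ> cinv c) has_derivative (\<lambda>h. D y (h, 0))) (at (cmap c ?p))"
        unfolding p(2) by (simp add: o_def y)
      from gradient[OF c p(1) this]
      have "g ?p (gradient A g (\<lambda>q. V q t) ?p) w = D y (components A c ?p w, 0)" for w .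
      then show ?case
        using metric_components_apply[OF c p(1)] p c
        by (intro blinfun_eqI) (simp add: y inl)
    qed
  qed
qed

text \<open>
  The dependence on the velocity is made explicit: affine, apart from the Christoffel term. Lipschitz
  continuity at a point follows from this form, and also boundedness for velocities in a whole ball.
\<close>
lemma chart_acceleration_split:
  assumes c: "c \<in> A" and x0: "x0 \<in> cimg c"
  obtains L :: "'b \<times> real \<Rightarrow> 'b \<Rightarrow>\<^sub>L 'b" and w :: "'b \<times> real \<Rightarrow> 'b"
  where "\<And>t x v. chart_acceleration c (t, x, v) = L (x, t) v + w (x, t) - \<Gamma> c x v v"
    "lipschitz_near L (x0, t0)" "lipschitz_near w (x0, t0)" "lipschitz_near (\<Gamma> c) x0"
proof -
  let ?U = "cimg c \<times> (UNIV :: real set)"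
  have U: "open ?U" "(x0, t0) \<in> ?U" using x0 open_cimg[OF c] by (auto intro: open_Times)
  let ?L = "\<lambda>(x, t). let p = cinv c x in components A c p o\<^sub>L E p t o\<^sub>L from_components A c p"
  let ?R = "\<lambda>(x, t). let p = cinv c x in components A c p (R p t)"
  let ?z = "\<lambda>(x, t). components A c (cinv c x) (gradient A g (\<lambda>q. V q t) (cinv c x))"
  have "smooth_on ?U ?L" using E_smooth c unfolding smooth_endomorphism_field_def by blast
  from smooth_on_lipschitz_near[OF U(1) this U(2)] have L: "lipschitz_near ?L (x0, t0)" .
  have "smooth_on ?U ?R" using R_smooth c unfolding smooth_vector_field_def by blast
  from smooth_on_lipschitz_near[OF U(1) this U(2)] have R: "lipschitz_near ?R (x0, t0)" .
  have w: "lipschitz_near (\<lambda>y. ?R y - ?z y) (x0, t0)"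
    by (rule lipschitz_near_minus[OF R gradient_components_lipschitz[OF c x0]])
  have "smooth_on (cimg c) (\<Gamma> c)" using linear_connection c unfolding linear_connection_def by blast
  from smooth_on_lipschitz_near[OF open_cimg[OF c] this x0] have \<Gamma>: "lipschitz_near (\<Gamma> c) x0" .
  have *: "chart_acceleration c (t, x, v) = ?L (x, t) v + (?R (x, t) - ?z (x, t)) - \<Gamma> c x v v" for t x v
    by (simp add: chart_acceleration_def force_def Let_def blinfun.bilinear_simps)
  show thesis by (rule that[of ?L "\<lambda>y. ?R y - ?z y", OF * L w \<Gamma>])
qed

lemma chart_acceleration_lipschitz:
  assumes c: "c \<in> A" and x0: "x0 \<in> cimg c"
  shows "lipschitz_near (\<lambda>z. (snd (snd z), chart_acceleration c z)) (t0, x0, v0)"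
proof -
  obtain L :: "'b \<times> real \<Rightarrow> 'b \<Rightarrow>\<^sub>L 'b" and w :: "'b \<times> real \<Rightarrow> 'b"
    where eq: "\<And>t x v. chart_acceleration c (t, x, v) = L (x, t) v + w (x, t) - \<Gamma> c x v v"
    and L: "lipschitz_near L (x0, t0)" and w: "lipschitz_near w (x0, t0)" and \<Gamma>: "lipschitz_near (\<Gamma> c) x0"
    using chart_acceleration_split[OF c x0] by blast
  let ?z0 = "(t0, x0, v0)"
  have xt: "lipschitz_near (\<lambda>z :: real \<times> 'b \<times> 'b. (fst (snd z), fst z)) ?z0"
    and x: "lipschitz_near (\<lambda>z :: real \<times> 'b \<times> 'b. fst (snd z)) ?z0"
    and v: "lipschitz_near (\<lambda>z :: real \<times> 'b \<times> 'b. snd (snd z)) ?z0"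
    by (intro lipschitz_near_bounded_linear bounded_linear_intros)+
  have "lipschitz_near (\<lambda>z. L (fst (snd z), fst z) (snd (snd z)) + w (fst (snd z), fst z)
      - \<Gamma> c (fst (snd z)) (snd (snd z)) (snd (snd z))) ?z0"
    by (intro lipschitz_near_minus lipschitz_near_add lipschitz_near_blinfun_apply v
        lipschitz_near_compose[OF xt] lipschitz_near_compose[OF x]) (simp_all add: L w \<Gamma>)
  also have "(\<lambda>z. L (fst (snd z), fst z) (snd (snd z)) + w (fst (snd z), fst z)
      - \<Gamma> c (fst (snd z)) (snd (snd z)) (snd (snd z))) = chart_acceleration c"
    using eq by (intro ext) (metis prod.collapse)
  finally show ?thesis by (rule lipschitz_near_Pair[OF v])
qed

text \<open>
  Unlike local Lipschitz continuity, this bound is uniform over all velocities of norm at most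
  \<open>C\<close>. It is applied before the velocity is known to converge.
\<close>
lemma chart_acceleration_bounded:
  assumes c: "c \<in> A" and x0: "x0 \<in> cimg c"
  obtains e N where "e > 0"
    "\<And>t x v. dist t t0 < e \<Longrightarrow> dist x x0 < e \<Longrightarrow> norm v \<le> C \<Longrightarrow> norm (chart_acceleration c (t, x, v)) \<le> N"
proof -
  obtain L :: "'b \<times> real \<Rightarrow> 'b \<Rightarrow>\<^sub>L 'b" and w :: "'b \<times> real \<Rightarrow> 'b"
    where eq: "\<And>t x v. chart_acceleration c (t, x, v) = L (x, t) v + w (x, t) - \<Gamma> c x v v"
    and L: "lipschitz_near L (x0, t0)" and w: "lipschitz_near w (x0, t0)" and \<Gamma>: "lipschitz_near (\<Gamma> c) x0"
    using chart_acceleration_split[OF c x0] by blast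
  obtain e1 B1 where 1: "e1 > 0" "\<And>y. y \<in> ball (x0, t0) e1 \<Longrightarrow> norm (L y) \<le> B1" "B1 \<ge> 0"
    by (rule lipschitz_near_bounded[OF L]) (rule that)
  obtain e2 B2 where 2: "e2 > 0" "\<And>y. y \<in> ball (x0, t0) e2 \<Longrightarrow> norm (w y) \<le> B2" "B2 \<ge> 0"
    by (rule lipschitz_near_bounded[OF w]) (rule that)
  obtain e3 B3 where 3: "e3 > 0" "\<And>y. y \<in> ball x0 e3 \<Longrightarrow> norm (\<Gamma> c y) \<le> B3" "B3 \<ge> 0"
    by (rule lipschitz_near_bounded[OF \<Gamma>]) (rule that)
  define e where "e = min (min (e1 / 2) (e2 / 2)) e3"
  have e: "e > 0" "e \<le> e1 / 2" "e \<le> e2 / 2" "e \<le> e3" using 1 2 3 by (auto simp: e_def)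
  have "norm (chart_acceleration c (t, x, v)) \<le> B1 * C + B2 + B3 * C * C"
    if tx: "dist t t0 < e" "dist x x0 < e" and v: "norm v \<le> C" for t x v
  proof -
    have C: "0 \<le> C" using norm_ge_zero v by (rule order_trans)
    have d: "dist (x0, t0) (x, t) < 2 * e"
      using sqrt_sum_squares_le_sum[of "dist x0 x" "dist t0 t"] tx by (simp add: dist_Pair_Pair dist_commute)
    have "norm (L (x, t) v) \<le> norm (L (x, t)) * norm v" by (rule norm_blinfun)
    also have "\<dots> \<le> B1 * C" using 1 d e v C by (intro mult_mono 1(2)) auto
    finally have a: "norm (L (x, t) v) \<le> B1 * C" .
    have b: "norm (w (x, t)) \<le> B2" using d e by (intro 2(2)) auto
    have "norm (\<Gamma> c x v v) \<le> norm (\<Gamma> c x v) * norm v" by (rule norm_blinfun)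
    also have "\<dots> \<le> norm (\<Gamma> c x) * norm v * norm v" by (intro mult_right_mono norm_blinfun) simp
    also have "\<dots> \<le> B3 * C * C" using 3 tx e v C by (intro mult_mono 3(2)) (auto simp: dist_commute)
    finally have g: "norm (\<Gamma> c x v v) \<le> B3 * C * C" .
    have "norm (L (x, t) v + w (x, t) - \<Gamma> c x v v) \<le> norm (L (x, t) v) + norm (w (x, t)) + norm (\<Gamma> c x v v)"
      by (intro norm_triangle_le_diff add_right_mono norm_triangle_ineq)
    also have "\<dots> \<le> B1 * C + B2 + B3 * C * C" by (intro add_mono a b g)
    finally show ?thesis unfolding eq .
  qed
  then show thesis using that e(1) by blast
qed

section \<open>A bound for the speed on bounded time intervals\<close>

lemma rdist_le_length_subarc:
  assumes sol: "twice_differentiable_curve A I \<gamma>" "open I" and "s \<le> t" "{s..t} \<subseteq> I"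
  shows "rdist A g (\<gamma> s) (\<gamma> t) \<le> integral {s..t} (speed \<gamma>)"
  using rdist_le_length[OF assms(3) twice_differentiable_curve_piecewise_C1[OF sol assms(4)]]
  by (simp add: curve_length_def)

text \<open>
  The work of \<open>R\<close> is linear in the distance \<open>r\<close> and in the speed \<open>w\<close>; this absorbs it into
  squares.
\<close>
lemma one_plus_mult_le:
  fixes r w :: real
  shows "(1 + r) * w \<le> 1 + r\<^sup>2 + w\<^sup>2 / 2"
proof -
  have "0 \<le> (1 + r - w)\<^sup>2 + (1 - r)\<^sup>2" by simp
  also have "\<dots> = 2 * (1 + r\<^sup>2 + w\<^sup>2 / 2) - 2 * ((1 + r) * w)"
    by (simp add: power2_eq_square algebra_simps)
  finally show ?thesis by simp
qed

text \<open>
  The hypotheses are those of the theorem on the time interval of radius \<open>l\<close> about \<open>t0\<close>, with one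
  constant for all coefficients. The bound \<open>sqrt X\<close> depends only on the data at \<open>t0\<close> and on
  \<open>C\<close> and \<open>l\<close>.
\<close>
lemma speed_bounded_on_bounded_times:
  assumes metric: "Metric_space UNIV (rdist A g)"
    and sol: "solution A \<Gamma> force I \<gamma>" and t0: "t0 \<in> I" and C: "0 \<le> C"
    and E_bound: "\<And>p t. \<bar>t - t0\<bar> \<le> l \<Longrightarrow> op_gnorm g p ((1/2) *\<^sub>R (E p t + gadjoint g p (E p t))) \<le> C"
    and R_bound: "\<And>p t. \<bar>t - t0\<bar> \<le> l \<Longrightarrow> gnorm g p (R p t) \<le> C * (1 + rdist A g p p0)"
    and V_bound: "\<And>p t. \<bar>t - t0\<bar> \<le> l \<Longrightarrow> - V p t \<le> C * (1 + (rdist A g p p0)\<^sup>2)"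
    and dV_bound: "\<And>p t. \<bar>t - t0\<bar> \<le> l \<Longrightarrow> \<bar>deriv (V p) t\<bar> \<le> C * (1 + (rdist A g p p0)\<^sup>2)"
  obtains M where "\<And>t. t \<in> I \<Longrightarrow> \<bar>t - t0\<bar> \<le> l \<Longrightarrow> speed \<gamma> t \<le> M"
proof -
  interpret Metric_space UNIV "rdist A g" by (rule metric)
  have I: "open I" "is_interval I" and twice: "twice_differentiable_curve A I \<gamma>"
    and eom: "\<And>t. t \<in> I \<Longrightarrow> covariant_derivative A \<Gamma> \<gamma> (velocity A \<gamma>) t = force (\<gamma> t) (velocity A \<gamma> t) t"
    using sol unfolding solution_def by blast+
  define W where "W = speed \<gamma>"
  define r0 where "r0 = rdist A g (\<gamma> t0) p0"
  define e where "e t = g (\<gamma> t) (velocity A \<gamma> t) (velocity A \<gamma> t) / 2 + V (\<gamma> t) t" for t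
  define e' where "e' t = g (\<gamma> t) (E (\<gamma> t) t (velocity A \<gamma> t)) (velocity A \<gamma> t)
      + g (\<gamma> t) (R (\<gamma> t) t) (velocity A \<gamma> t) + deriv (V (\<gamma> t)) t" for t
  have W_sq: "(W t)\<^sup>2 = g (\<gamma> t) (velocity A \<gamma> t) (velocity A \<gamma> t)" for t by (simp add: W_def gnorm_sq)
  have W_nonneg: "0 \<le> W t" for t by (simp add: W_def)
  have der: "(e has_real_derivative e' t) (at t)" "isCont W t" if t: "t \<in> I" for t
  proof -
    obtain a where jet: "chart_jet (chart_at A (\<gamma> t)) \<gamma> t (\<lambda>s. vector_derivative (cmap (chart_at A (\<gamma> t)) \<circ> \<gamma>) (at s)) a"
      using twice_differentiable_curve_jet[OF twice I(1) t chart_at] by blast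
    note k = kinetic_energy_derivative[OF jet]
    from DERIV_add[OF DERIV_cdivide[OF k, of 2] potential_derivative[OF V_smooth jet]]
    have "(e has_real_derivative
        g (\<gamma> t) (covariant_derivative A \<Gamma> \<gamma> (velocity A \<gamma>) t) (velocity A \<gamma> t)
        + (g (\<gamma> t) (gradient A g (\<lambda>q. V q t) (\<gamma> t)) (velocity A \<gamma> t) + deriv (V (\<gamma> t)) t)) (at t)"
      unfolding e_def by simp
    moreover have "g (\<gamma> t) (covariant_derivative A \<Gamma> \<gamma> (velocity A \<gamma>) t) (velocity A \<gamma> t)
        = e' t - deriv (V (\<gamma> t)) t - g (\<gamma> t) (gradient A g (\<lambda>q. V q t) (\<gamma> t)) (velocity A \<gamma> t)"
      unfolding eom[OF t] by (simp add: e'_def force_def blinfun.bilinear_simps)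
    ultimately show "(e has_real_derivative e' t) (at t)" by simp
    have "isCont (\<lambda>t. g (\<gamma> t) (velocity A \<gamma> t) (velocity A \<gamma> t)) t" by (rule DERIV_isCont[OF k])
    from isCont_o2[OF this isCont_real_sqrt] show "isCont W t" unfolding W_def gnorm_def .
  qed
  define X where "X = 2 * \<bar>e t0 + 2 * (2 * C) * (1 + r0\<^sup>2)\<bar> * exp ((3 + 6 * (2 * C)) * l)"
  have "speed \<gamma> t \<le> sqrt X" if t: "t \<in> I" "\<bar>t - t0\<bar> \<le> l" for t
  proof -
    let ?\<alpha> = "min t0 t" and ?\<beta> = "max t0 t"
    have in_I: "s \<in> I" if "s \<in> {?\<alpha>..?\<beta>}" for s
      using mem_is_interval_1_I[OF I(2) t0 t(1), of s] mem_is_interval_1_I[OF I(2) t(1) t0, of s] that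
      by (auto simp: min_def max_def split: if_splits)
    have in_l: "\<bar>s - t0\<bar> \<le> l" if "s \<in> {?\<alpha>..?\<beta>}" for s
      using that t(2) by (auto simp: min_def max_def split: if_splits)
    have W_cont: "continuous_on {?\<alpha>..?\<beta>} W"
      using der(2) in_I by (intro continuous_at_imp_continuous_on) blast
    have W_int: "W integrable_on {s..s'}" if "?\<alpha> \<le> s" "s' \<le> ?\<beta>" for s s'
      using that by (intro integrable_continuous_real continuous_on_subset[OF W_cont]) auto
    \<comment> \<open>The length of the curve from the left end of the interval.\<close>
    define P where "P s = integral {?\<alpha>..s} W" for s
    have P_diff: "integral {s..s'} W = P s' - P s" if "?\<alpha> \<le> s" "s \<le> s'" "s' \<le> ?\<beta>" for s s'
      using Henstock_Kurzweil_Integration.integral_combine[OF that(1,2) W_int] that unfolding P_def by simp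
    have P_mono: "P s \<le> P s'" if "?\<alpha> \<le> s" "s \<le> s'" "s' \<le> ?\<beta>" for s s'
      using P_diff[OF that] integral_nonneg[OF W_int[OF that(1,3)]] W_nonneg by simp
    have P_arc: "rdist A g (\<gamma> s) (\<gamma> s') \<le> P s' - P s" if ss': "?\<alpha> \<le> s" "s \<le> s'" "s' \<le> ?\<beta>" for s s'
    proof -
      have "{s..s'} \<subseteq> I" using in_I ss' by force
      from rdist_le_length_subarc[OF twice I(1) ss'(2) this] P_diff[OF ss'] show ?thesis by (simp add: W_def)
    qed
    have dist_le: "rdist A g (\<gamma> s) p0 \<le> r0 + \<bar>P s - P t0\<bar>" if s: "s \<in> {?\<alpha>..?\<beta>}" for s
    proof -
      have "rdist A g (\<gamma> s) p0 \<le> rdist A g (\<gamma> s) (\<gamma> t0) + r0" unfolding r0_def by (rule triangle) auto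
      moreover have "rdist A g (\<gamma> s) (\<gamma> t0) \<le> \<bar>P s - P t0\<bar>"
      proof (cases "s \<le> t0")
        case True
        then show ?thesis using P_arc[of s t0] s by auto
      next
        case False
        then show ?thesis using P_arc[of t0 s] s commute[of "\<gamma> s" "\<gamma> t0"] by auto
      qed
      ultimately show ?thesis by simp
    qed
    let ?r = "\<lambda>s. r0 + \<bar>P s - P t0\<bar>"
    have sq_le: "(rdist A g (\<gamma> s) p0)\<^sup>2 \<le> (?r s)\<^sup>2" if "s \<in> {?\<alpha>..?\<beta>}" for s
      using dist_le[OF that] nonneg by (intro power_mono) auto
    have "(W t)\<^sup>2 \<le> 2 * (e t0 + 2 * (2 * C) * (1 + r0\<^sup>2)) * exp ((3 + 6 * (2 * C)) * \<bar>t - t0\<bar>)"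
    proof (rule speed_bound_from_energy_two_sided[where \<alpha> = ?\<alpha> and \<beta> = ?\<beta> and P = P and e' = e'])
      show "0 \<le> 2 * C" using C by simp
      show "t0 \<in> {?\<alpha>..?\<beta>}" "t \<in> {?\<alpha>..?\<beta>}" by auto
      show "continuous_on {?\<alpha>..?\<beta>} e"
        using DERIV_isCont[OF der(1)] in_I by (intro continuous_at_imp_continuous_on) blast
      show "continuous_on {?\<alpha>..?\<beta>} P"
        unfolding P_def by (rule indefinite_integral_continuous_1[OF W_int]) auto
      show "P s \<le> P s'" if "?\<alpha> \<le> s" "s \<le> s'" "s' \<le> ?\<beta>" for s s' by (rule P_mono[OF that])
    next
      fix s assume s: "?\<alpha> < s" "s < ?\<beta>"
      then have s': "s \<in> {?\<alpha>..?\<beta>}" by auto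
      show "(e has_real_derivative e' s) (at s)" by (rule der(1)[OF in_I[OF s']])
      show "(P has_real_derivative W s) (at s)"
        using integral_has_real_derivative[OF W_cont s'] at_within_Icc_at[OF s] unfolding P_def by simp
      let ?v = "velocity A \<gamma> s" and ?p = "\<gamma> s"
      have "\<bar>g ?p (E ?p s ?v) ?v\<bar> \<le> op_gnorm g ?p ((1/2) *\<^sub>R (E ?p s + gadjoint g ?p (E ?p s))) * (W s)\<^sup>2"
        unfolding W_def by (rule g_self_adjoint_part_bound[OF refl])
      also have "\<dots> \<le> C * (W s)\<^sup>2" by (intro mult_right_mono E_bound in_l s') simp
      finally have 1: "\<bar>g ?p (E ?p s ?v) ?v\<bar> \<le> C * (W s)\<^sup>2" .
      have "\<bar>g ?p (R ?p s) ?v\<bar> \<le> gnorm g ?p (R ?p s) * W s" unfolding W_def by (rule g_Cauchy_Schwarz)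
      also have "\<dots> \<le> C * (1 + rdist A g ?p p0) * W s"
        by (intro mult_right_mono R_bound in_l s' W_nonneg)
      also have "\<dots> \<le> C * (1 + ?r s) * W s"
        using dist_le[OF s'] C W_nonneg[of s] by (intro mult_right_mono mult_left_mono) auto
      also have "\<dots> = C * ((1 + ?r s) * W s)" by simp
      also have "\<dots> \<le> C * (1 + (?r s)\<^sup>2 + (W s)\<^sup>2 / 2)"
        by (intro mult_left_mono one_plus_mult_le C)
      finally have 2: "\<bar>g ?p (R ?p s) ?v\<bar> \<le> C * (1 + (?r s)\<^sup>2 + (W s)\<^sup>2 / 2)" .
      have "\<bar>deriv (V ?p) s\<bar> \<le> C * (1 + (rdist A g ?p p0)\<^sup>2)" by (rule dV_bound[OF in_l[OF s']])
      also have "\<dots> \<le> C * (1 + (?r s)\<^sup>2)" using sq_le[OF s'] C by (intro mult_left_mono) auto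
      finally have 3: "\<bar>deriv (V ?p) s\<bar> \<le> C * (1 + (?r s)\<^sup>2)" .
      have "\<bar>e' s\<bar> \<le> C * (W s)\<^sup>2 + C * (1 + (?r s)\<^sup>2 + (W s)\<^sup>2 / 2) + C * (1 + (?r s)\<^sup>2)"
        unfolding e'_def using 1 2 3 by linarith
      also have "\<dots> = C * (2 + 2 * (?r s)\<^sup>2 + (3 / 2) * (W s)\<^sup>2)" by (simp add: algebra_simps)
      also have "\<dots> \<le> C * (2 * (1 + (?r s)\<^sup>2 + (W s)\<^sup>2))" by (rule mult_left_mono[OF _ C]) simp
      finally show "\<bar>e' s\<bar> \<le> 2 * C * (1 + (?r s)\<^sup>2 + (W s)\<^sup>2)" by (simp add: mult_ac)
    next
      fix s assume "?\<alpha> \<le> s" "s \<le> ?\<beta>"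
      then have s': "s \<in> {?\<alpha>..?\<beta>}" by simp
      have "- V (\<gamma> s) s \<le> C * (1 + (rdist A g (\<gamma> s) p0)\<^sup>2)" by (rule V_bound[OF in_l[OF s']])
      also have "\<dots> \<le> C * (1 + (?r s)\<^sup>2)" using sq_le[OF s'] C by (intro mult_left_mono) auto
      also have "\<dots> \<le> 2 * C * (1 + (?r s)\<^sup>2)" using C by (intro mult_right_mono) auto
      finally show "(W s)\<^sup>2 / 2 \<le> e s + 2 * C * (1 + (?r s)\<^sup>2)" unfolding W_sq e_def by linarith
    qed
    also have "\<dots> \<le> 2 * \<bar>e t0 + 2 * (2 * C) * (1 + r0\<^sup>2)\<bar> * exp ((3 + 6 * (2 * C)) * \<bar>t - t0\<bar>)"
      by (intro mult_right_mono mult_left_mono abs_ge_self) auto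
    also have "\<dots> \<le> X"
      unfolding X_def using t(2) C by (intro mult_left_mono iffD2[OF exp_le_cancel_iff]) auto
    finally have "W t \<le> sqrt X" by (rule real_le_rsqrt)
    then show ?thesis by (simp add: W_def)
  qed
  then show thesis using that by blast
qed

section \<open>Continuation of solutions of bounded speed\<close>

text \<open>
  The curve is Lipschitz for the distance, hence maps a sequence of times tending to \<open>b\<close> to a Cauchy
  sequence. The estimate for the limit \<open>p\<close> expresses convergence of the whole curve and passes to
  the limit from the triangle inequality.
\<close>
lemma bounded_speed_solution_converges:
  assumes complete: "riemannian_complete A g"
    and sol: "twice_differentiable_curve A I \<gamma>" "open I" "is_interval I"
    and b: "b \<in> closure I" and M: "\<And>t. t \<in> I \<Longrightarrow> dist t b < 1 \<Longrightarrow> speed \<gamma> t \<le> M" "0 \<le> M"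
  obtains p where "\<And>t. t \<in> I \<Longrightarrow> dist t b < 1 \<Longrightarrow> rdist A g p (\<gamma> t) \<le> M * dist t b"
proof -
  interpret Metric_space UNIV "rdist A g" using complete unfolding riemannian_complete_def by blast
  have lip: "rdist A g (\<gamma> s) (\<gamma> t) \<le> M * \<bar>s - t\<bar>" if st: "s \<in> I" "t \<in> I" "dist s b < 1" "dist t b < 1" for s t
  proof -
    have le: "rdist A g (\<gamma> s) (\<gamma> t) \<le> M * (t - s)"
      if st: "s \<in> I" "t \<in> I" "dist s b < 1" "dist t b < 1" "s \<le> t" for s t
    proof -
      have sub: "{s..t} \<subseteq> I" using mem_is_interval_1_I[OF sol(3) st(1,2)] by auto
      have "speed \<gamma> integrable_on {s..t}"
        by (rule speed_integrable[OF twice_differentiable_curve_piecewise_C1[OF sol(1,2) sub]])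
      moreover have "speed \<gamma> u \<le> M" if "u \<in> {s..t}" for u
        using that sub st by (intro M) (auto simp: dist_real_def)
      ultimately have "integral {s..t} (speed \<gamma>) \<le> integral {s..t} (\<lambda>_. M)"
        by (intro integral_le) auto
      with rdist_le_length_subarc[OF sol(1,2) st(5) sub] st(5) show ?thesis by (simp add: mult.commute)
    qed
    show ?thesis
    proof (cases "s \<le> t")
      case True
      then show ?thesis using le[OF st] by simp
    next
      case False
      then show ?thesis using le[of t s] st commute[of "\<gamma> s" "\<gamma> t"] by simp
    qed
  qed
  obtain x0 where x0: "\<And>n. x0 n \<in> I" "x0 \<longlonglongrightarrow> b" using b unfolding closure_sequential by blast
  have "\<forall>\<^sub>F n in sequentially. dist (x0 n) b < 1" by (rule tendstoD[OF x0(2)]) simp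
  then obtain N where N: "\<And>n. n \<ge> N \<Longrightarrow> dist (x0 n) b < 1" unfolding eventually_sequentially by blast
  define x where "x n = x0 (n + N)" for n
  have x: "x n \<in> I" "dist (x n) b < 1" for n using x0(1) N by (auto simp: x_def)
  have x_lim: "x \<longlonglongrightarrow> b" unfolding x_def by (rule LIMSEQ_ignore_initial_segment[OF x0(2)])
  have "MCauchy (\<lambda>n. \<gamma> (x n))"
    unfolding MCauchy_def
  proof (intro conjI allI impI)
    fix e :: real assume e: "e > 0"
    then have "e / (M + 1) > 0" using M by simp
    then obtain K where K: "\<And>m n. m \<ge> K \<Longrightarrow> n \<ge> K \<Longrightarrow> dist (x m) (x n) < e / (M + 1)"
      using LIMSEQ_imp_Cauchy[OF x_lim] unfolding Cauchy_def by blast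
    have "rdist A g (\<gamma> (x n)) (\<gamma> (x n')) < e" if "K \<le> n" "K \<le> n'" for n n'
    proof -
      have "rdist A g (\<gamma> (x n)) (\<gamma> (x n')) \<le> M * \<bar>x n - x n'\<bar>" by (intro lip x)
      also have "\<dots> \<le> (M + 1) * \<bar>x n - x n'\<bar>" by (intro mult_right_mono) auto
      also have "\<dots> < e" using K[OF that] M(2) by (simp add: dist_real_def field_simps)
      finally show ?thesis .
    qed
    then show "\<exists>N. \<forall>n n'. N \<le> n \<longrightarrow> N \<le> n' \<longrightarrow> rdist A g (\<gamma> (x n)) (\<gamma> (x n')) < e" by blast
  qed simp
  then obtain p where p: "limitin mtopology (\<lambda>n. \<gamma> (x n)) p sequentially"
    using complete unfolding riemannian_complete_def mcomplete_def by blast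
  have "(\<lambda>n. rdist A g (\<gamma> (x n)) p) \<longlonglongrightarrow> 0"
    using p nonneg unfolding limitin_metric tendsto_iff by simp
  moreover have "(\<lambda>n. M * \<bar>t - x n\<bar>) \<longlonglongrightarrow> M * \<bar>t - b\<bar>" for t by (intro tendsto_intros x_lim)
  ultimately have lim: "(\<lambda>n. rdist A g (\<gamma> (x n)) p + M * \<bar>t - x n\<bar>) \<longlonglongrightarrow> 0 + M * \<bar>t - b\<bar>" for t
    by (intro tendsto_add)
  have "rdist A g p (\<gamma> t) \<le> M * dist t b" if t: "t \<in> I" "dist t b < 1" for t
  proof -
    have "rdist A g p (\<gamma> t) \<le> rdist A g (\<gamma> (x n)) p + M * \<bar>t - x n\<bar>" for n
      using triangle[of p "\<gamma> (x n)" "\<gamma> t"] commute[of p "\<gamma> (x n)"] lip[OF x(1) t(1) x(2) t(2), of n]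
      by (simp add: abs_minus_commute)
    then show ?thesis using LIMSEQ_le_const[OF lim[of t]] by (simp add: dist_real_def)
  qed
  then show thesis by (rule that)
qed

text \<open>
  Near \<open>b\<close> the curve lies in one chart about its limit, its coordinate velocity is bounded by
  comparison of norms, and so its coordinate acceleration is bounded. Position and velocity therefore
  both converge, and the first order system for them is continued past \<open>b\<close>.
\<close>
lemma bounded_speed_solution_extends:
  assumes complete: "riemannian_complete A g"
    and sol: "solution A \<Gamma> force I \<gamma>"
    and b: "b \<in> closure I" "b \<notin> I"
    and M: "\<And>t. t \<in> I \<Longrightarrow> dist t b < 1 \<Longrightarrow> speed \<gamma> t \<le> M"
  shows "\<exists>J \<delta>. solution A \<Gamma> force J \<delta> \<and> I \<subset> J \<and> (\<forall>t\<in>I. \<delta> t = \<gamma> t)"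
proof -
  have metric: "Metric_space UNIV (rdist A g)" using complete unfolding riemannian_complete_def by blast
  have I: "open I" "is_interval I" and twice: "twice_differentiable_curve A I \<gamma>"
    and eom: "\<And>t. t \<in> I \<Longrightarrow> covariant_derivative A \<Gamma> \<gamma> (velocity A \<gamma>) t = force (\<gamma> t) (velocity A \<gamma> t) t"
    using sol unfolding solution_def by blast+
  define M' where "M' = max M 0"
  have M': "0 \<le> M'" "\<And>t. t \<in> I \<Longrightarrow> dist t b < 1 \<Longrightarrow> speed \<gamma> t \<le> M'" using M by (auto simp: M'_def le_max_iff_disj)
  obtain p where p: "\<And>t. t \<in> I \<Longrightarrow> dist t b < 1 \<Longrightarrow> rdist A g p (\<gamma> t) \<le> M' * dist t b"
    using bounded_speed_solution_converges[OF complete twice I b(1) M'(2,1)] by blast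
  define c where "c = chart_at A p"
  have c: "c \<in> A" "p \<in> cdom c" by (simp_all add: c_def chart_at)
  define x0 where "x0 = cmap c p"
  have x0: "x0 \<in> cimg c" using c by (simp add: x0_def)
  obtain k s where k: "k > 0" and s: "s > 0" "ball x0 s \<subseteq> cimg c"
    and coercive: "\<And>q u. q \<in> cdom c \<Longrightarrow> cmap c q \<in> ball x0 s \<Longrightarrow> k * norm (components A c q u) \<le> gnorm g q u"
    using metric_components_coercive_near[OF c] unfolding x0_def by blast
  define x where "x t = cmap c (\<gamma> t)" for t
  have near: "\<exists>d>0. d \<le> 1 \<and> (\<forall>t\<in>I. dist t b < d \<longrightarrow> \<gamma> t \<in> cdom c \<and> x t \<in> ball x0 r)" if r: "r > 0" for r
  proof -
    obtain e where e: "e > 0" "\<And>q. rdist A g p q < e \<Longrightarrow> q \<in> cdom c \<and> cmap c q \<in> ball (cmap c p) r"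
      using rdist_ball_subset_chart_ball[OF metric c r] by blast
    have "\<gamma> t \<in> cdom c \<and> x t \<in> ball x0 r" if t: "t \<in> I" "dist t b < min 1 (e / (M' + 1))" for t
    proof -
      have "rdist A g p (\<gamma> t) \<le> M' * dist t b" using p t by simp
      also have "\<dots> \<le> (M' + 1) * dist t b" by (intro mult_right_mono) auto
      also have "\<dots> < e" using t(2) M'(1) by (simp add: field_simps)
      finally show ?thesis using e(2) unfolding x_def x0_def by blast
    qed
    moreover have "min 1 (e / (M' + 1)) > 0" using e M' by simp
    ultimately show ?thesis by (intro exI[of _ "min 1 (e / (M' + 1))"]) simp
  qed
  obtain e2 N where e2: "e2 > 0"
    "\<And>t x v. dist t b < e2 \<Longrightarrow> dist x x0 < e2 \<Longrightarrow> norm v \<le> M' / k \<Longrightarrow> norm (chart_acceleration c (t, x, v)) \<le> N"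
    using chart_acceleration_bounded[OF c(1) x0] by blast
  obtain d where d: "d > 0" "d \<le> 1"
    "\<And>t. t \<in> I \<Longrightarrow> dist t b < d \<Longrightarrow> \<gamma> t \<in> cdom c \<and> x t \<in> ball x0 (min s e2)"
    using near[of "min s e2"] s e2 by auto
  define e where "e = min d e2"
  have e: "e > 0" "e \<le> 1" "e \<le> e2" using d e2 by (auto simp: e_def)
  define S where "S = I \<inter> ball b e"
  have S: "t \<in> I" "dist t b < 1" "dist t b < e2" "\<gamma> t \<in> cdom c" "x t \<in> ball x0 s" "dist (x t) x0 < e2"
    if "t \<in> S" for t
    using that d(3)[of t] e unfolding S_def e_def by (auto simp: dist_commute)
  define v where "v t = vector_derivative (cmap c \<circ> \<gamma>) (at t)" for t
  have jet: "chart_jet c \<gamma> t v (chart_acceleration c (t, x t, v t))" if t: "t \<in> S" for t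
  proof -
    obtain a where j: "chart_jet c \<gamma> t v a"
      using twice_differentiable_curve_jet[OF twice I(1) S(1)[OF t] c(1) S(4)[OF t]] unfolding v_def by blast
    then show ?thesis
      using equation_of_motion_in_chart[OF j] eom[OF S(1)[OF t]] unfolding x_def by simp
  qed
  have v_bound: "norm (v t) \<le> M' / k" if t: "t \<in> S" for t
  proof -
    have "k * norm (v t) \<le> speed \<gamma> t"
      using coercive[OF S(4)[OF t] S(5)[OF t, unfolded x_def], of "velocity A \<gamma> t"]
      by (simp add: velocity_components_jet[OF jet[OF t]])
    also have "\<dots> \<le> M'" using M'(2) S(1,2)[OF t] by blast
    finally show ?thesis using k by (simp add: field_simps)
  qed
  \<comment> \<open>The part \<open>S\<close> of the interval within \<open>e\<close> of \<open>b\<close> has the same limits at \<open>b\<close> as \<open>I\<close>.\<close>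
  have b_closure: "b \<in> closure S"
    unfolding S_def using b(1) e(1) open_Int_closure_subset[of "ball b e" I] by (auto simp: Int_commute)
  have at_S: "at b within S = at b within I"
    by (rule at_within_nhd[of b "ball b e"]) (use e in \<open>auto simp: S_def\<close>)
  have N: "norm (chart_acceleration c (t, x t, v t)) \<le> \<bar>N\<bar>" if t: "t \<in> S" for t
    using e2(2)[OF S(3)[OF t] S(6)[OF t] v_bound[OF t]] by linarith
  \<comment> \<open>A Lipschitz function into a complete space has a limit at each point of the closure.\<close>
  have "\<bar>N\<bar>-lipschitz_on S v"
  proof (rule lipschitz_onI)
    fix t t' assume tt: "t \<in> S" "t' \<in> S"
    have conv: "convex S" unfolding S_def by (intro convex_Int convex_ball is_interval_convex I)
    have "norm (v t - v t') \<le> \<bar>N\<bar> * norm (t - t')"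
    proof (rule differentiable_bound[OF conv _ _ tt])
      fix u assume u: "u \<in> S"
      show "(v has_derivative (\<lambda>h. h *\<^sub>R chart_acceleration c (u, x u, v u))) (at u within S)"
        using chart_jetD(5)[OF jet[OF u]] unfolding has_vector_derivative_def by (rule has_derivative_at_withinI)
      show "onorm (\<lambda>h. h *\<^sub>R chart_acceleration c (u, x u, v u)) \<le> \<bar>N\<bar>"
        using N[OF u] by (intro onorm_bound) (auto simp: mult.commute[of "\<bar>N\<bar>"] intro: mult_left_mono)
    qed
    then show "dist (v t) (v t') \<le> \<bar>N\<bar> * dist t t'" by (simp add: dist_norm)
  qed simp
  from uniformly_continuous_on_extension_at_closure[OF lipschitz_on_uniformly_continuous[OF this] b_closure]
  obtain v0 where v0: "(v \<longlongrightarrow> v0) (at b within I)" unfolding at_S by blast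
  have x_lim: "(x \<longlongrightarrow> x0) (at b within I)"
  proof (rule tendstoI)
    fix r :: real assume "r > 0"
    from near[OF this] show "\<forall>\<^sub>F t in at b within I. dist (x t) x0 < r"
      unfolding eventually_at by (auto simp: dist_commute)
  qed
  define G where "G z = (snd (snd z), chart_acceleration c z)" for z
  have G_lip: "lipschitz_near G (b, x0, v0)"
    unfolding G_def by (rule chart_acceleration_lipschitz[OF c(1) x0])
  have y_der: "((\<lambda>t. (x t, v t)) has_vector_derivative G (t, x t, v t)) (at t)" if t: "t \<in> I" "t \<in> ball b e" for t
  proof -
    have "t \<in> S" using t by (simp add: S_def)
    note j = jet[OF this]
    have "(x has_vector_derivative v t) (at t)" using chart_jetD(4)[OF j] by (simp add: x_def[abs_def] o_def)
    from has_vector_derivative_Pair[OF this chart_jetD(5)[OF j]] show ?thesis by (simp add: G_def)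
  qed
  obtain \<epsilon>' z where \<epsilon>': "\<epsilon>' > 0"
    and z': "\<And>t. t \<in> ball b \<epsilon>' \<Longrightarrow> (z has_vector_derivative G (t, z t)) (at t)"
      "\<And>t. t \<in> ball b \<epsilon>' \<Longrightarrow> z t \<in> ball (x0, v0) s" "\<And>t. t \<in> I \<Longrightarrow> t \<in> ball b \<epsilon>' \<Longrightarrow> z t = (x t, v t)"
    using ode_solution_extends_past_boundary[OF I b G_lip s(1) e(1) y_der tendsto_Pair[OF x_lim v0]] by blast
  define \<epsilon> where "\<epsilon> = min \<epsilon>' e"
  have \<epsilon>: "\<epsilon> > 0" "\<And>t. t \<in> ball b \<epsilon> \<Longrightarrow> t \<in> ball b \<epsilon>'" "\<And>t. t \<in> I \<Longrightarrow> t \<in> ball b \<epsilon> \<Longrightarrow> t \<in> S"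
    using \<epsilon>' e by (auto simp: \<epsilon>_def S_def)
  \<comment> \<open>The first component of \<open>z\<close> is the position in the chart; \<open>\<eta>\<close> is the curve it describes.\<close>
  define \<eta> where "\<eta> t = cinv c (fst (z t))" for t
  define \<delta> where "\<delta> t = (if t \<in> I then \<gamma> t else \<eta> t)" for t
  have z_img: "fst (z t) \<in> cimg c" if "t \<in> ball b \<epsilon>" for t
  proof -
    have "dist x0 (fst (z t)) \<le> dist (x0, v0) (z t)" using dist_fst_le[of "(x0, v0)" "z t"] by simp
    also have "\<dots> < s" using z'(2)[OF \<epsilon>(2)[OF that]] by simp
    finally show ?thesis using s(2) by (auto simp: subset_iff)
  qed
  have \<eta>_eq: "\<eta> t = \<delta> t" if t: "t \<in> ball b \<epsilon>" for t
  proof (cases "t \<in> I")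
    case True
    then show ?thesis using z'(3)[OF True \<epsilon>(2)[OF t]] S(4)[OF \<epsilon>(3)[OF True t]] c by (simp add: \<delta>_def \<eta>_def x_def)
  qed (simp add: \<delta>_def)
  have jet_ball: "chart_jet c \<delta> t (\<lambda>t. snd (z t)) (chart_acceleration c (t, z t))" if t: "t \<in> ball b \<epsilon>" for t
  proof (rule chart_jet_transform[of c \<eta>])
    have ev: "\<forall>\<^sub>F s in nhds t. s \<in> ball b \<epsilon>" using t by (intro eventually_nhds_in_open) auto
    then show "\<forall>\<^sub>F s in nhds t. \<eta> s = \<delta> s" by eventually_elim (rule \<eta>_eq)
    have z_fst: "((\<lambda>t. fst (z t)) has_vector_derivative snd (z s)) (at s)"
      and z_snd: "((\<lambda>t. snd (z t)) has_vector_derivative chart_acceleration c (s, z s)) (at s)"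
      if "s \<in> ball b \<epsilon>" for s
      using bounded_linear.has_vector_derivative[OF bounded_linear_fst z'(1)[OF \<epsilon>(2)[OF that]]]
        bounded_linear.has_vector_derivative[OF bounded_linear_snd z'(1)[OF \<epsilon>(2)[OF that]]]
      by (simp_all add: G_def)
    show "chart_jet c \<eta> t (\<lambda>t. snd (z t)) (chart_acceleration c (t, z t))"
      unfolding chart_jet_def
    proof (intro conjI z_snd t c(1))
      show "\<forall>\<^sub>F s in nhds t. \<eta> s \<in> cdom c \<and> isCont \<eta> s \<and> ((cmap c \<circ> \<eta>) has_vector_derivative snd (z s)) (at s)"
        using ev
      proof (eventually_elim, intro conjI)
        fix s assume s: "s \<in> ball b \<epsilon>"
        show "\<eta> s \<in> cdom c" unfolding \<eta>_def by (rule cinv_in_cdom[OF z_img[OF s]])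
        have "isCont (\<lambda>t. fst (z t)) s" using z_fst[OF s] by (rule has_vector_derivative_continuous)
        then show "isCont \<eta> s" unfolding \<eta>_def by (rule isCont_o2) (rule isCont_cinv[OF c(1) z_img[OF s]])
        show "((cmap c \<circ> \<eta>) has_vector_derivative snd (z s)) (at s)"
          by (rule has_vector_derivative_transform_within_open[OF z_fst[OF s] open_ball s])
            (use z_img c in \<open>simp add: \<eta>_def\<close>)
      qed
    qed
  qed
  define J where "J = I \<union> ball b \<epsilon>"
  have "solution A \<Gamma> force J \<delta>"
    unfolding solution_def
  proof (intro conjI ballI)
    show "open J" unfolding J_def using I by auto
    have "\<exists>t\<in>I. dist t b < \<epsilon>" using b(1) \<epsilon>(1) by (simp add: closure_approachable)
    then have "I \<inter> ball b \<epsilon> \<noteq> {}" by (auto simp: dist_commute)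
    then show "is_interval J"
      unfolding J_def is_interval_connected_1 using I(2)
      by (intro connected_Un) (auto simp: is_interval_connected_1 intro: convex_connected)
    show "J \<noteq> {}" unfolding J_def using \<epsilon>(1) by auto
    have on_J: "\<exists>c v a. chart_jet c \<delta> t v a \<and> a = chart_acceleration c (t, cmap c (\<delta> t), v t)" if t: "t \<in> J" for t
    proof (cases "t \<in> ball b \<epsilon>")
      case True
      have "cmap c (\<delta> t) = fst (z t)" using cmap_cinv[OF c(1) z_img[OF True]] \<eta>_eq[OF True] by (simp add: \<eta>_def)
      then show ?thesis using jet_ball[OF True] by (metis prod.collapse)
    next
      case False
      then have tI: "t \<in> I" using t by (simp add: J_def)
      let ?c = "chart_at A (\<gamma> t)"
      obtain v a where j: "chart_jet ?c \<gamma> t v a"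
        using twice_differentiable_curve_jet[OF twice I(1) tI chart_at] by blast
      have "\<forall>\<^sub>F s in nhds t. s \<in> I" by (rule eventually_nhds_in_open[OF I(1) tI])
      then have "\<forall>\<^sub>F s in nhds t. \<gamma> s = \<delta> s" by eventually_elim (simp add: \<delta>_def)
      from chart_jet_transform[OF j this] have "chart_jet ?c \<delta> t v a" .
      moreover have "a = chart_acceleration ?c (t, cmap ?c (\<delta> t), v t)"
        using equation_of_motion_in_chart[OF j] eom[OF tI] tI by (simp add: \<delta>_def)
      ultimately show ?thesis by blast
    qed
    show "twice_differentiable_curve A J \<delta>"
      using on_J by (intro twice_differentiable_curveI) blast
    show "covariant_derivative A \<Gamma> \<delta> (velocity A \<delta>) t = force (\<delta> t) (velocity A \<delta> t) t" if "t \<in> J" for t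
      using on_J[OF that] equation_of_motion_in_chart by blast
  qed
  moreover have "I \<subset> J"
  proof
    show "I \<subseteq> J" unfolding J_def by (rule Un_upper1)
    have "b \<in> J" unfolding J_def using \<epsilon>(1) by simp
    then show "I \<noteq> J" using b(2) by blast
  qed
  moreover have "\<forall>t\<in>I. \<delta> t = \<gamma> t" by (simp add: \<delta>_def)
  ultimately show ?thesis by blast
qed

end

section \<open>Completeness of inextensible solutions\<close>

theorem theorem2:
  fixes A :: "('m::t2_space, 'h::{real_inner,banach}) chart set"
    and g :: "'m \<Rightarrow> 'h \<Rightarrow>\<^sub>L 'h \<Rightarrow>\<^sub>L real"
    and \<Gamma> :: "('m, 'h) chart \<Rightarrow> 'h \<Rightarrow> 'h \<Rightarrow>\<^sub>L 'h \<Rightarrow>\<^sub>L 'h"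
    and p0 :: 'm
    and E S H :: "'m \<Rightarrow> real \<Rightarrow> 'h \<Rightarrow>\<^sub>L 'h"
    and R :: "'m \<Rightarrow> real \<Rightarrow> 'h"
    and V :: "'m \<Rightarrow> real \<Rightarrow> real"
    and C\<^sub>0 C\<^sub>1 C\<^sub>2 :: "real \<Rightarrow> real"
    and I :: "real set"
    and \<gamma> :: "real \<Rightarrow> 'm"
  assumes "hilbert_manifold A"
    and "riemannian_metric A g"
    and "riemannian_complete A g"
    and "levi_civita_connection A g \<Gamma>"
    and "smooth_endomorphism_field A E"
    and "smooth_vector_field A R"
    and "smooth_function A V"
    and S: "\<And>p t. S p t = (1/2) *\<^sub>R (E p t + gadjoint g p (E p t))"
    and H: "\<And>p t. H p t = (1/2) *\<^sub>R (E p t - gadjoint g p (E p t))"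
    and "continuous_on UNIV C\<^sub>0" "continuous_on UNIV C\<^sub>1" "continuous_on UNIV C\<^sub>2"
    and "\<And>t. C\<^sub>0 t > 0" "\<And>t. C\<^sub>1 t > 0" "\<And>t. C\<^sub>2 t > 0"
    and "\<And>p t. op_gnorm g p (S p t) \<le> C\<^sub>0 t"
    and "\<And>p t. gnorm g p (R p t) \<le> C\<^sub>0 t + C\<^sub>1 t * rdist A g p p0"
    and "\<And>p t. - V p t \<le> C\<^sub>0 t + C\<^sub>2 t * (rdist A g p p0)\<^sup>2"
    and "\<And>p t. \<bar>deriv (V p) t\<bar> \<le> C\<^sub>0 t + C\<^sub>2 t * (rdist A g p p0)\<^sup>2"
    and "inextensible_solution A \<Gamma>
           (\<lambda>p v t. E p t v + R p t - gradient A g (\<lambda>q. V q t) p) I \<gamma>"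
  shows "I = UNIV"
proof (rule ccontr)
  interpret force_fields A g \<Gamma> E R V
    using assms(1,2,4-7) unfolding hilbert_manifold_def by unfold_locales auto
  let ?Q = "\<lambda>p v t. E p t v + R p t - gradient A g (\<lambda>q. V q t) p"
  have Q: "?Q = force" by (intro ext) (simp add: force_def)
  have sol: "solution A \<Gamma> force I \<gamma>"
    and max: "\<nexists>J \<delta>. solution A \<Gamma> force J \<delta> \<and> I \<subset> J \<and> (\<forall>t\<in>I. \<delta> t = \<gamma> t)"
    using assms(20) unfolding Q inextensible_solution_def by blast+
  have metric: "Metric_space UNIV (rdist A g)" using assms(3) unfolding riemannian_complete_def by blast
  interpret Metric_space UNIV "rdist A g" by (rule metric)
  assume "I \<noteq> UNIV"
  have I: "open I" "I \<noteq> {}" using sol unfolding solution_def by blast+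
  have "\<not> closed I" using clopen[of I] I \<open>I \<noteq> UNIV\<close> by blast
  then obtain b where b: "b \<in> closure I" "b \<notin> I" using closure_subset_eq by blast
  obtain t0 where t0: "t0 \<in> I" using I by blast
  define l where "l = \<bar>b - t0\<bar> + 1"
  have "compact ((\<lambda>t. C\<^sub>0 t + C\<^sub>1 t + C\<^sub>2 t) ` {t0 - l..t0 + l})"
    by (intro compact_continuous_image continuous_intros continuous_on_subset[OF assms(10)]
        continuous_on_subset[OF assms(11)] continuous_on_subset[OF assms(12)]) auto
  from compact_imp_bounded[OF this]
  obtain C where C: "\<And>t. t \<in> {t0 - l..t0 + l} \<Longrightarrow> norm (C\<^sub>0 t + C\<^sub>1 t + C\<^sub>2 t) \<le> C"
    unfolding bounded_iff ball_simps by blast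
  have C_bounds: "C\<^sub>0 t \<le> C" "C\<^sub>1 t \<le> C" "C\<^sub>2 t \<le> C" if "\<bar>t - t0\<bar> \<le> l" for t
  proof -
    have "norm (C\<^sub>0 t + C\<^sub>1 t + C\<^sub>2 t) \<le> C" using that by (intro C) auto
    then show "C\<^sub>0 t \<le> C" "C\<^sub>1 t \<le> C" "C\<^sub>2 t \<le> C"
      using assms(13)[of t] assms(14)[of t] assms(15)[of t] by auto
  qed
  have C_pos: "0 \<le> C" using C_bounds(1)[of t0] assms(13)[of t0] by (simp add: l_def)
  have growth: "C\<^sub>0 t + c * r \<le> C * (1 + r)" if "\<bar>t - t0\<bar> \<le> l" "c \<le> C" "0 \<le> r" for t c r
    using C_bounds(1)[OF that(1)] mult_right_mono[OF that(2,3)] by (simp add: distrib_left)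
  have bounds: "op_gnorm g p ((1/2) *\<^sub>R (E p t + gadjoint g p (E p t))) \<le> C"
    "gnorm g p (R p t) \<le> C * (1 + rdist A g p p0)"
    "- V p t \<le> C * (1 + (rdist A g p p0)\<^sup>2)"
    "\<bar>deriv (V p) t\<bar> \<le> C * (1 + (rdist A g p p0)\<^sup>2)" if t: "\<bar>t - t0\<bar> \<le> l" for p t
  proof -
    show "op_gnorm g p ((1/2) *\<^sub>R (E p t + gadjoint g p (E p t))) \<le> C"
      using assms(16)[of p t] C_bounds(1)[OF t] unfolding S by linarith
    show "gnorm g p (R p t) \<le> C * (1 + rdist A g p p0)"
      by (rule order_trans[OF assms(17) growth[OF t C_bounds(2)[OF t]]]) simp
    show "- V p t \<le> C * (1 + (rdist A g p p0)\<^sup>2)"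
      by (rule order_trans[OF assms(18) growth[OF t C_bounds(3)[OF t]]]) simp
    show "\<bar>deriv (V p) t\<bar> \<le> C * (1 + (rdist A g p p0)\<^sup>2)"
      by (rule order_trans[OF assms(19) growth[OF t C_bounds(3)[OF t]]]) simp
  qed
  obtain M where M: "\<And>t. t \<in> I \<Longrightarrow> \<bar>t - t0\<bar> \<le> l \<Longrightarrow> speed \<gamma> t \<le> M"
    by (rule speed_bounded_on_bounded_times[where l = l, OF metric sol t0 C_pos])
      (erule bounds | rule that)+
  have "speed \<gamma> t \<le> M" if "t \<in> I" "dist t b < 1" for t
    using that by (intro M) (auto simp: l_def dist_real_def)
  from bounded_speed_solution_extends[OF assms(3) sol b this] max show False by blast
qed

end
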